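(* Let $F/K$ be a finite separable extension, and let $L,M$ be fields between $K$ and $F$ with $F = L.M$ (the compositum of $L$ and $M$). Suppose $|\cdot|_K$ is a complete discrete absolute value on $K$ such that $L/K$ is tamely ramified and the residue field of $K$ is perfect. Then $e(F/K) = \operatorname{lcm}(e(L/K), e(M/K))$.
   Context: A discrete absolute value is a non-archimedean absolute value whose value group $|K^*|_K$ is a discrete subgroup of $\mathbb{R}_{>0}$; complete means $K$ is complete with respect to $|\cdot|_K$. There is a unique extension of $|\cdot|_K$ to an absolute value $|\cdot|_F$ on $F$. For fields $U,V$ with $K\le V\le U\le F$, the ramification index $e(U/V)$ is the index $[|U^*|_F:|V^*|_F]$ of $|V^*|_F$ in $|U^*|_F$ as subgroups of $\mathbb{R}^*$. $L/K$ is tamely ramified (standard meaning) if the residue field extension of $L/K$ is separable and $e(L/K)$ is not divisible by the characteristic of the residue field of $K$ (no condition on $e(L/K)$ when this characteristic is $0$). *)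

theory Defs
  imports
    "HOL-Analysis.Isolated"
    "HOL-Analysis.Abstract_Metric_Spaces"
    "HOL-Algebra.Multiplicative_Group"
    "HOL-Algebra.QuotRing"
    "HOL-Algebra.Generated_Fields"
    "HOL-Algebra.Finite_Extensions"
begin

section \<open>Separability\<close>

text \<open>Polynomials in HOL-Algebra are coefficient lists with the leading coefficient first; hence
  the indices below run downwards from the degree to 1.\<close>

definition formal_derivative :: "('a, 'b) ring_scheme \<Rightarrow> 'a list \<Rightarrow> 'a list"
  where "formal_derivative R p =
    ring.normalize R (map (\<lambda>i. [i] \<cdot>\<^bsub>R\<^esub> ring.coeff R p i) (rev [1..<length p]))"

definition separable_poly :: "('a, 'b) ring_scheme \<Rightarrow> 'a set \<Rightarrow> 'a list \<Rightarrow> bool"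
  where "separable_poly R K p \<longleftrightarrow>
    isgcd (K[X]\<^bsub>R\<^esub>) \<one>\<^bsub>K[X]\<^bsub>R\<^esub>\<^esub> p (formal_derivative R p)"

definition separable_extension :: "('a, 'b) ring_scheme \<Rightarrow> 'a set \<Rightarrow> bool"
  where "separable_extension R K \<longleftrightarrow>
    (\<forall>x\<in>carrier R. \<not> ring.transcendental R K x \<and> separable_poly R K (ring.Irr R K x))"

definition perfect_field :: "('a, 'b) ring_scheme \<Rightarrow> bool"
  where "perfect_field R \<longleftrightarrow> field R \<and>
    (\<forall>p\<in>carrier (poly_ring R). pirreducible\<^bsub>R\<^esub> (carrier R) p \<longrightarrow> separable_poly R (carrier R) p)"

text \<open>The additive order of 1, which \<^const>\<open>group.ord\<close> sets to 0 if it is infinite.\<close>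

definition ring_char :: "('a, 'b) ring_scheme \<Rightarrow> nat"
  where "ring_char R = group.ord (add_monoid R) \<one>\<^bsub>R\<^esub>"


section \<open>Absolute values\<close>

definition value_group :: "('a, 'b) ring_scheme \<Rightarrow> ('a \<Rightarrow> real) \<Rightarrow> 'a set \<Rightarrow> real set"
  where "value_group R v U = v ` (U - {\<zero>\<^bsub>R\<^esub>})"

locale absolute_value = field R for R (structure) +
  fixes v :: "'a \<Rightarrow> real"
  assumes abs_nonneg: "x \<in> carrier R \<Longrightarrow> 0 \<le> v x"
    and abs_eq_0_iff: "x \<in> carrier R \<Longrightarrow> v x = 0 \<longleftrightarrow> x = \<zero>"
    and abs_mult: "\<lbrakk>x \<in> carrier R; y \<in> carrier R\<rbrakk> \<Longrightarrow> v (x \<otimes> y) = v x * v y"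
    and abs_triangle: "\<lbrakk>x \<in> carrier R; y \<in> carrier R\<rbrakk> \<Longrightarrow> v (x \<oplus> y) \<le> v x + v y"

locale nonarch_absolute_value = absolute_value +
  assumes abs_ultrametric: "\<lbrakk>x \<in> carrier R; y \<in> carrier R\<rbrakk> \<Longrightarrow> v (x \<oplus> y) \<le> max (v x) (v y)"

locale discrete_absolute_value = nonarch_absolute_value +
  assumes value_group_discrete: "discrete (value_group R v (carrier R))"

text \<open>\<^locale>\<open>Metric_space\<close> asks for nonnegativity and symmetry on the whole type, so the distance
  is set to 0 outside the carrier.\<close>

definition abs_dist :: "('a, 'b) ring_scheme \<Rightarrow> ('a \<Rightarrow> real) \<Rightarrow> 'a \<Rightarrow> 'a \<Rightarrow> real"
  where "abs_dist R v x y =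
    (if x \<in> carrier R \<and> y \<in> carrier R then v (x \<ominus>\<^bsub>R\<^esub> y) else 0)"

locale complete_discrete_absolute_value = discrete_absolute_value +
  assumes abs_complete: "Metric_space.mcomplete (carrier R) (abs_dist R v)"


section \<open>Ramification\<close>

text \<open>From here on \<open>v\<close> is an absolute value on the ambient field \<open>F\<close>, and \<open>U\<close>, \<open>V\<close> are subfields
  of \<open>F\<close>.\<close>

definition real_mult_group :: "real monoid"
  where "real_mult_group = \<lparr>carrier = UNIV - {0}, monoid.mult = (*), one = 1\<rparr>"

definition ramification_index ::
    "('a, 'b) ring_scheme \<Rightarrow> ('a \<Rightarrow> real) \<Rightarrow> 'a set \<Rightarrow> 'a set \<Rightarrow> nat"
  where "ramification_index F v U V =
    card (rcosets\<^bsub>real_mult_group\<lparr>carrier := value_group F v U\<rparr>\<^esub> (value_group F v V))"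

definition valuation_ring ::
    "('a, 'b) ring_scheme \<Rightarrow> ('a \<Rightarrow> real) \<Rightarrow> 'a set \<Rightarrow> ('a, 'b) ring_scheme"
  where "valuation_ring F v U = F\<lparr>carrier := {x \<in> U. v x \<le> 1}\<rparr>"

definition valuation_ideal :: "('a \<Rightarrow> real) \<Rightarrow> 'a set \<Rightarrow> 'a set"
  where "valuation_ideal v U = {x \<in> U. v x < 1}"

definition residue_field ::
    "('a, 'b) ring_scheme \<Rightarrow> ('a \<Rightarrow> real) \<Rightarrow> 'a set \<Rightarrow> 'a set ring"
  where "residue_field F v U = valuation_ring F v U Quot valuation_ideal v U"

text \<open>The image of the residue field of \<open>V\<close> in the residue field of \<open>U\<close>, for \<open>V \<subseteq> U\<close>.\<close>

definition residue_subfield ::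
    "('a, 'b) ring_scheme \<Rightarrow> ('a \<Rightarrow> real) \<Rightarrow> 'a set \<Rightarrow> 'a set \<Rightarrow> 'a set set"
  where "residue_subfield F v U V =
    (\<lambda>x. valuation_ideal v U +>\<^bsub>valuation_ring F v U\<^esub> x) ` carrier (valuation_ring F v V)"

text \<open>In characteristic 0 there is no condition on the ramification index.\<close>

definition tamely_ramified ::
    "('a, 'b) ring_scheme \<Rightarrow> ('a \<Rightarrow> real) \<Rightarrow> 'a set \<Rightarrow> 'a set \<Rightarrow> bool"
  where "tamely_ramified F v U V \<longleftrightarrow>
    separable_extension (residue_field F v U) (residue_subfield F v U V) \<and>
    (ring_char (residue_field F v V) \<noteq> 0 \<longrightarrow>
      \<not> ring_char (residue_field F v V) dvd ramification_index F v U V)"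

end

theory Submission
  imports Defs
begin

text \<open>
This is Abhyankar's lemma. Let \<open>\<Gamma>\<^sub>U\<close> denote the value group of a field \<open>U\<close> between \<open>K\<close> and \<open>F\<close>.

A group of positive reals that contains the discrete, hence cyclic, group \<open>\<Gamma>\<^sub>K\<close> with finite index
\<open>e > 0\<close> consists of all \<open>e\<close>-th roots of elements of \<open>\<Gamma>\<^sub>K\<close>. Consequently the index of \<open>\<Gamma>\<^sub>L \<Gamma>\<^sub>M\<close> over \<open>\<Gamma>\<^sub>K\<close> is
the least common multiple of the indices of \<open>\<Gamma>\<^sub>L\<close> and \<open>\<Gamma>\<^sub>M\<close> (\<open>index_product_lcm\<close>), and the theorem
follows from \<open>\<Gamma>\<^sub>F = \<Gamma>\<^sub>L \<Gamma>\<^sub>M\<close> (\<open>value_group_tame_compositum\<close>).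

To see this, choose a subfield \<open>E\<close> of \<open>F\<close> that contains \<open>M\<close>, satisfies \<open>\<Gamma>\<^sub>E \<subseteq> \<Gamma>\<^sub>L \<Gamma>\<^sub>M\<close> and is maximal with these
properties. It suffices to show \<open>L \<subseteq> E\<close>, since then \<open>E = F\<close>. Two kinds of elements can be adjoined
without leaving \<open>\<Gamma>\<^sub>L \<Gamma>\<^sub>M\<close>, and hence lie in \<open>E\<close> already.
\<^item> Every residue of \<open>F\<close> is separable over the residue field of \<open>K\<close>, because that field is perfect
  (\<open>perfect_residue_separable\<close>). Hensel's lemma lifts it to a root of a lift of its minimal polynomial
  over the residue field of \<open>E\<close>, and adjoining this root does not change the value group
  (\<open>adjoin_residue\<close>). Thus \<open>E\<close> has the residue field of \<open>F\<close>.
\<^item> Let \<open>e\<close> be the ramification index of \<open>L\<close> over \<open>K\<close>, which is invertible in the residue field. If \<open>y \<in> L\<close>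
  and \<open>y\<^sup>e \<in> E\<close>, then the value group of \<open>E(y)\<close> is generated by \<open>\<Gamma>\<^sub>E\<close> and \<open>\<bar>y\<bar>\<close> (\<open>adjoin_tame_root\<close>).

Now \<open>W = E \<inter> L\<close> has the residue field of \<open>L\<close>, because a Hensel lift over \<open>K\<close> of a residue of \<open>L\<close> is
unique in \<open>F\<close> and exists both in \<open>L\<close> and in \<open>E\<close>. It has the value group of \<open>L\<close> as well: each \<open>x \<in> L\<close>
satisfies \<open>x\<^sup>e = u k\<close> with \<open>k \<in> K\<close> and a unit \<open>u\<close>, and dividing \<open>x\<close> by an \<open>e\<close>-th root of the one-unit part
of \<open>u\<close> gives an element of the second kind with the same absolute value
(\<open>divide_root_of_unit_part\<close>). As \<open>W\<close> is complete and the values are discrete, successive approximation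
yields \<open>W = L\<close> (\<open>dense_complete_subfield_eq\<close>).

Completeness of all intermediate fields comes from completeness of finite-dimensional subspaces
(\<open>complete_on_Span\<close>). Residue fields of extensions are handled through polynomials over valuation
rings: a polynomial with a unit coefficient and a value of absolute value less than 1 at \<open>c\<close> stands
for a nonzero polynomial over the residue field that vanishes at the residue of \<open>c\<close>.
\<close>

section \<open>Subfields and absolute values\<close>

context ring
begin

lemma subring_a_minus:
  assumes "subring S R" "y \<in> S" shows "x \<ominus>\<^bsub>R\<lparr>carrier := S\<rparr>\<^esub> y = x \<ominus> y"
proof -
  interpret S: ring "R\<lparr>carrier := S\<rparr>" by (rule subring_is_ring[OF assms(1)])
  have "\<ominus>\<^bsub>R\<lparr>carrier := S\<rparr>\<^esub> y = \<ominus> y"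
    using assms subringE(1,5)[OF assms(1)] by (intro S.minus_equality) (auto simp: l_neg)
  then show ?thesis by (simp add: S.minus_eq minus_eq)
qed

end

context field
begin

lemma inv_nonzero: "\<lbrakk>x \<in> carrier R; x \<noteq> \<zero>\<rbrakk> \<Longrightarrow> inv x \<noteq> \<zero>"
  using field_Units Units_inv_Units by blast

lemma inv_carrier: "\<lbrakk>x \<in> carrier R; x \<noteq> \<zero>\<rbrakk> \<Longrightarrow> inv x \<in> carrier R"
  using field_Units by simp

lemma subfield_closed:
  assumes "subfield E R"
  shows "x \<in> E \<Longrightarrow> x \<in> carrier R"
    and "\<lbrakk>x \<in> E; y \<in> E\<rbrakk> \<Longrightarrow> x \<oplus> y \<in> E"
    and "\<lbrakk>x \<in> E; y \<in> E\<rbrakk> \<Longrightarrow> x \<ominus> y \<in> E"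
    and "\<lbrakk>x \<in> E; y \<in> E\<rbrakk> \<Longrightarrow> x \<otimes> y \<in> E"
    and "x \<in> E \<Longrightarrow> \<ominus> x \<in> E"
    and "\<lbrakk>x \<in> E; x \<noteq> \<zero>\<rbrakk> \<Longrightarrow> inv x \<in> E"
    and "\<zero> \<in> E" and "\<one> \<in> E"
    and "x \<in> E \<Longrightarrow> x [^] (n::nat) \<in> E"
    and "x \<in> E \<Longrightarrow> [n] \<cdot> x \<in> E"
proof -
  note sub = subfieldE(1)[OF assms]
  note [simp] = subringE(2,3,5,6,7)[OF sub]
  show c: "x \<in> E \<Longrightarrow> x \<in> carrier R" using subringE(1)[OF sub] by blast
  show "\<lbrakk>x \<in> E; y \<in> E\<rbrakk> \<Longrightarrow> x \<oplus> y \<in> E" "\<lbrakk>x \<in> E; y \<in> E\<rbrakk> \<Longrightarrow> x \<otimes> y \<in> E" "x \<in> E \<Longrightarrow> \<ominus> x \<in> E"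
    "\<zero> \<in> E" "\<one> \<in> E" by simp_all
  show "\<lbrakk>x \<in> E; y \<in> E\<rbrakk> \<Longrightarrow> x \<ominus> y \<in> E" by (simp add: minus_eq)
  show "\<lbrakk>x \<in> E; x \<noteq> \<zero>\<rbrakk> \<Longrightarrow> inv x \<in> E"
    using subfield_m_inv(1)[OF assms] by blast
  show "x \<in> E \<Longrightarrow> x [^] (n::nat) \<in> E" by (induction n) simp_all
  show "x \<in> E \<Longrightarrow> [n] \<cdot> x \<in> E" using c by (induction n) (simp_all add: add_pow_def)
qed

lemma subfieldI_closed:
  assumes "E \<subseteq> carrier R" "\<one> \<in> E" "\<And>x y. \<lbrakk>x \<in> E; y \<in> E\<rbrakk> \<Longrightarrow> x \<oplus> y \<in> E"
    "\<And>x y. \<lbrakk>x \<in> E; y \<in> E\<rbrakk> \<Longrightarrow> x \<otimes> y \<in> E" "\<And>x. x \<in> E \<Longrightarrow> \<ominus> x \<in> E"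
    "\<And>x. \<lbrakk>x \<in> E; x \<noteq> \<zero>\<rbrakk> \<Longrightarrow> inv x \<in> E"
  shows "subfield E R"
  by (rule subfieldI'[OF subringI]) (use assms in auto)

lemma subfield_inter:
  assumes "subfield E R" "subfield E' R" shows "subfield (E \<inter> E') R"
  using subfield_closed[OF assms(1)] subfield_closed[OF assms(2)] 
  by (intro subfieldI_closed) auto

lemma chain_Union_subfield:
  assumes C: "\<C> \<noteq> {}" "\<And>E. E \<in> \<C> \<Longrightarrow> subfield E R" "\<And>A B. \<lbrakk>A \<in> \<C>; B \<in> \<C>\<rbrakk> \<Longrightarrow> A \<subseteq> B \<or> B \<subseteq> A"
  shows "subfield (\<Union>\<C>) R"
proof (rule subfieldI_closed)
  have common: "\<exists>E\<in>\<C>. x \<in> E \<and> y \<in> E" if "x \<in> \<Union>\<C>" "y \<in> \<Union>\<C>" for x y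
    using that C(3) by blast
  show "\<Union>\<C> \<subseteq> carrier R" using subfield_closed(1)[OF C(2)] by blast
  show "\<one> \<in> \<Union>\<C>" using subfield_closed(8)[OF C(2)] C(1) by blast
  show "x \<oplus> y \<in> \<Union>\<C>" if "x \<in> \<Union>\<C>" "y \<in> \<Union>\<C>" for x y
    using common[OF that] subfield_closed(2)[OF C(2)] by blast
  show "x \<otimes> y \<in> \<Union>\<C>" if "x \<in> \<Union>\<C>" "y \<in> \<Union>\<C>" for x y
    using common[OF that] subfield_closed(4)[OF C(2)] by blast
  show "\<ominus> x \<in> \<Union>\<C>" if "x \<in> \<Union>\<C>" for x
    using that subfield_closed(5)[OF C(2)] by blast
  show "inv x \<in> \<Union>\<C>" if "x \<in> \<Union>\<C>" "x \<noteq> \<zero>" for x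
    using that subfield_closed(6)[OF C(2)] by blast
qed

end

context absolute_value
begin

lemma abs_zero [simp]: "v \<zero> = 0"
  by (simp add: abs_eq_0_iff)

lemma abs_pos: "\<lbrakk>x \<in> carrier R; x \<noteq> \<zero>\<rbrakk> \<Longrightarrow> 0 < v x"
  using abs_nonneg[of x] abs_eq_0_iff[of x] by linarith

lemma abs_one [simp]: "v \<one> = 1"
  using abs_mult[of \<one> \<one>] abs_pos[of \<one>] by simp

lemma abs_pow: "x \<in> carrier R \<Longrightarrow> v (x [^] (n::nat)) = v x ^ n"
  by (induction n) (simp_all add: abs_mult)

lemma abs_uminus: assumes "x \<in> carrier R" shows "v (\<ominus> x) = v x"
proof -
  have "v (\<ominus> \<one>) * v (\<ominus> \<one>) = 1"
    using abs_mult[of "\<ominus> \<one>" "\<ominus> \<one>"] by (simp add: l_minus)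
  then have "v (\<ominus> \<one>) = 1"
    using abs_nonneg[of "\<ominus> \<one>"] by (simp add: square_eq_1_iff)
  then show ?thesis
    using abs_mult[of "\<ominus> \<one>" x] assms by (simp add: l_minus)
qed

lemma abs_minus_commute: "\<lbrakk>x \<in> carrier R; y \<in> carrier R\<rbrakk> \<Longrightarrow> v (x \<ominus> y) = v (y \<ominus> x)"
  using abs_uminus[of "x \<ominus> y"] by (simp add: minus_eq minus_add add.m_comm)

lemma abs_inv: assumes "x \<in> carrier R" "x \<noteq> \<zero>" shows "v (inv x) = inverse (v x)"
proof -
  have "v x * v (inv x) = 1"
    using abs_mult[of x "inv x"] assms field_Units by simp
  then show ?thesis by (simp add: inverse_unique)
qed

end

context nonarch_absolute_value
begin

lemma abs_ultrametric_minus: "\<lbrakk>x \<in> carrier R; y \<in> carrier R\<rbrakk> \<Longrightarrow> v (x \<ominus> y) \<le> max (v x) (v y)"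
  using abs_ultrametric[of x "\<ominus> y"] by (simp add: minus_eq abs_uminus)

lemma abs_add_le: "\<lbrakk>x \<in> carrier R; y \<in> carrier R; v x \<le> r; v y \<le> r\<rbrakk> \<Longrightarrow> v (x \<oplus> y) \<le> r"
  using abs_ultrametric[of x y] by linarith

lemma abs_add_less: "\<lbrakk>x \<in> carrier R; y \<in> carrier R; v x < r; v y < r\<rbrakk> \<Longrightarrow> v (x \<oplus> y) < r"
  using abs_ultrametric[of x y] by linarith

lemma abs_minus_le: "\<lbrakk>x \<in> carrier R; y \<in> carrier R; v x \<le> r; v y \<le> r\<rbrakk> \<Longrightarrow> v (x \<ominus> y) \<le> r"
  using abs_ultrametric_minus[of x y] by linarith

lemma abs_minus_less: "\<lbrakk>x \<in> carrier R; y \<in> carrier R; v x < r; v y < r\<rbrakk> \<Longrightarrow> v (x \<ominus> y) < r"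
  using abs_ultrametric_minus[of x y] by linarith

lemma abs_mult_le1: "\<lbrakk>x \<in> carrier R; y \<in> carrier R; v x \<le> 1; v y \<le> 1\<rbrakk> \<Longrightarrow> v (x \<otimes> y) \<le> 1"
  by (simp add: abs_mult abs_nonneg mult_le_one)

lemma abs_mult_less1:
  assumes "x \<in> carrier R" "y \<in> carrier R" "v x \<le> 1" "v y < 1" 
  shows "v (x \<otimes> y) < 1" "v (y \<otimes> x) < 1"
proof -
  have "v x * v y \<le> 1 * v y"
    using assms abs_nonneg by (intro mult_right_mono) auto
  then show "v (x \<otimes> y) < 1" "v (y \<otimes> x) < 1"
    using assms by (simp_all add: abs_mult mult.commute)
qed

lemma abs_add_eq_left:
  assumes "x \<in> carrier R" "y \<in> carrier R" "v y < v x" shows "v (x \<oplus> y) = v x"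
proof -
  have "v x \<le> max (v (x \<oplus> y)) (v y)"
    using abs_ultrametric_minus[of "x \<oplus> y" y] assms by (simp add: minus_eq a_assoc r_neg)
  then show ?thesis using assms abs_ultrametric[of x y] by linarith
qed

lemma abs_add_neq:
  assumes "x \<in> carrier R" "y \<in> carrier R" "v y \<noteq> v x" shows "v (x \<oplus> y) = max (v x) (v y)"
  using abs_add_eq_left[of x y] abs_add_eq_left[of y x] assms by (auto simp: a_comm max_def)

lemma abs_eq_of_close:
  assumes "x \<in> carrier R" "y \<in> carrier R" "v (x \<ominus> y) < v y" shows "v x = v y"
proof -
  have "x = y \<oplus> (x \<ominus> y)" using assms(1,2) by algebra
  then show ?thesis using abs_add_eq_left[of y "x \<ominus> y"] assms by simp
qed

lemma abs_minus_trans: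
  assumes "x \<in> carrier R" "y \<in> carrier R" "z \<in> carrier R" "v (x \<ominus> y) < r" "v (y \<ominus> z) < r"
  shows "v (x \<ominus> z) < r"
proof -
  have "x \<ominus> z = (x \<ominus> y) \<oplus> (y \<ominus> z)" using assms(1-3) by algebra
  then show ?thesis using abs_add_less[of "x \<ominus> y" "y \<ominus> z"] assms by simp
qed

lemma abs_le1_of_close:
  assumes "x \<in> carrier R" "y \<in> carrier R" "v y \<le> 1" "v (x \<ominus> y) < 1" shows "v x \<le> 1"
proof -
  have "x = y \<oplus> (x \<ominus> y)" using assms(1,2) by algebra
  then show ?thesis using abs_add_le[of y "x \<ominus> y" 1] assms by simp
qed

lemma abs_nat_le1: "v ([n] \<cdot> \<one>) \<le> 1" for n :: nat
  by (induction n) (auto intro!: abs_add_le)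

lemma abs_add_pow_le: "\<lbrakk>x \<in> carrier R; v x \<le> r\<rbrakk> \<Longrightarrow> v ([n] \<cdot> x) \<le> r" for n :: nat
  using abs_nonneg[of x] by (induction n) (auto intro!: abs_add_le)

end

section \<open>Evaluation of polynomials and of their derivatives\<close>

context ring
begin

text \<open>The formal derivative before normalisation. Keeping leading zeros makes the length depend only on
the length of the polynomial, so that bounds on degrees need no case distinctions.\<close>

fun deriv :: "'a list \<Rightarrow> 'a list" where
  "deriv [] = []"
| "deriv (a # p) = (if p = [] then [] else ([length p] \<cdot> a) # deriv p)"

lemma length_deriv [simp]: "length (deriv p) = length p - 1"
  by (induction p) auto

lemma formal_derivative_eq: "formal_derivative R p = normalize (deriv p)"
proof -
  have "map (\<lambda>i. [i] \<cdot> coeff p i) (rev [1..<length p]) = deriv p"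
  proof (induction p)
    case (Cons a p)
    have "map (\<lambda>i. [i] \<cdot> coeff (a # p) i) (rev [1..<length p]) =
        map (\<lambda>i. [i] \<cdot> coeff p i) (rev [1..<length p])"
      by (rule map_cong) auto
    with Cons.IH show ?case
      by (cases "p = []") (simp_all add: Suc_le_eq)
  qed simp
  then show ?thesis by (simp add: formal_derivative_def)
qed

lemma deriv_closed:
  "\<lbrakk>set p \<subseteq> A; \<And>a n. a \<in> A \<Longrightarrow> [(n::nat)] \<cdot> a \<in> A\<rbrakk> \<Longrightarrow> set (deriv p) \<subseteq> A"
  by (induction p) auto

lemma deriv_carrier: "set p \<subseteq> carrier R \<Longrightarrow> set (deriv p) \<subseteq> carrier R"
  by (rule deriv_closed) auto

end

context cring
begin

text \<open>The product rule for \<open>p X + a\<close>. With the leading coefficient first, appending a coefficient is a step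
of Horner's scheme, and reverse induction on coefficient lists becomes induction along that scheme.\<close>

lemma eval_deriv_snoc:
  assumes "set p \<subseteq> carrier R" "a \<in> carrier R" "x \<in> carrier R"
  shows "eval (deriv (p @ [a])) x = eval (deriv p) x \<otimes> x \<oplus> eval p x"
  using assms(1)
proof (induction p)
  case Nil
  then show ?case using assms by simp
next
  case (Cons b p)
  have c: "b \<in> carrier R" "set p \<subseteq> carrier R" using Cons.prems by auto
  note [simp] = assms(2,3) c eval_in_carrier[OF c(2)] eval_in_carrier[OF deriv_carrier[OF c(2)]]
  show ?case
  proof (cases "p = []")
    case True
    then show ?thesis by simp
  next
    case False
    then obtain n where n: "length p = Suc n" by (cases p) auto
    let ?D = "eval (deriv p) x" and ?P = "eval p x"
    have "eval (deriv ((b # p) @ [a])) x = ([Suc (Suc n)] \<cdot> b) \<otimes> x [^] Suc n \<oplus> (?D \<otimes> x \<oplus> ?P)"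
      using Cons.IH[OF c(2)] n by simp
    also have "\<dots> = (([Suc n] \<cdot> b) \<otimes> x [^] n \<oplus> ?D) \<otimes> x \<oplus> (b \<otimes> x [^] Suc n \<oplus> ?P)"
    proof -
      have "([Suc (Suc n)] \<cdot> b) = [Suc n] \<cdot> b \<oplus> b" by simp
      moreover obtain y where y: "y = [Suc n] \<cdot> b" "y \<in> carrier R" by simp
      moreover obtain z where z: "z = x [^] n" "z \<in> carrier R" by simp
      moreover have "x [^] Suc n = z \<otimes> x" using z by simp
      moreover have "(y \<oplus> b) \<otimes> (z \<otimes> x) \<oplus> (?D \<otimes> x \<oplus> ?P) = (y \<otimes> z \<oplus> ?D) \<otimes> x \<oplus> (b \<otimes> (z \<otimes> x) \<oplus> ?P)"
        using y(2) z(2) by (simp add: l_distr m_assoc a_ac)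
      ultimately show ?thesis by metis
    qed
    also have "\<dots> = eval (deriv (b # p)) x \<otimes> x \<oplus> eval (b # p) x"
      using False n by simp
    finally show ?thesis .
  qed
qed

end

context nonarch_absolute_value
begin

lemma eval_ball:
  assumes "set p \<subseteq> carrier R" "\<forall>a\<in>set p. v a \<le> 1" "x \<in> carrier R" "v x \<le> 1"
  shows "v (eval p x) \<le> 1"
  using assms(1,2)
  by (induction p)
    (auto intro!: abs_add_le abs_mult_le1 eval_in_carrier simp: assms abs_pow power_le_one abs_nonneg)

lemma eval_small:
  assumes "set p \<subseteq> carrier R" "\<forall>a\<in>set p. v a < 1" "x \<in> carrier R" "v x \<le> 1"
  shows "v (eval p x) < 1"
  using assms(1,2)
  by (induction p)
    (auto intro!: abs_add_less abs_mult_less1(2) eval_in_carrier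
      simp: assms abs_pow power_le_one abs_nonneg)

lemma deriv_ball:
  assumes "set p \<subseteq> carrier R" "\<forall>a\<in>set p. v a \<le> 1"
  shows "\<forall>a\<in>set (deriv p). v a \<le> 1"
  using deriv_closed[of p "{a \<in> carrier R. v a \<le> 1}"] assms abs_add_pow_le by fastforce

lemma deriv_small:
  assumes "set p \<subseteq> carrier R" "\<forall>a\<in>set p. v a < 1"
  shows "\<forall>a\<in>set (deriv p). v a < 1"
proof -
  have "v ([n] \<cdot> a) < 1" if "a \<in> carrier R" "v a < 1" for a and n :: nat
    using abs_add_pow_le[OF that(1) order_refl, of n] that by linarith
  then show ?thesis
    using deriv_closed[of p "{a \<in> carrier R. v a < 1}"] assms by fastforce
qed

text \<open>In Horner's scheme the coefficient of \<open>y\<^sup>2\<close> is built from ring operations only, with no division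
by 2; hence it stays in the valuation ring in every characteristic.\<close>

lemma eval_taylor:
  assumes "set p \<subseteq> carrier R" "\<forall>a\<in>set p. v a \<le> 1"
    and xy: "x \<in> carrier R" "v x \<le> 1" "y \<in> carrier R" "v y \<le> 1"
  shows "\<exists>r\<in>carrier R. v r \<le> 1 \<and>
    eval p (x \<oplus> y) = eval p x \<oplus> y \<otimes> eval (deriv p) x \<oplus> y \<otimes> y \<otimes> r"
  using assms(1,2)
proof (induction p rule: rev_induct)
  case Nil
  then show ?case using xy by (intro bexI[of _ \<zero>]) auto
next
  case (snoc a p)
  then have p: "set p \<subseteq> carrier R" "\<forall>a\<in>set p. v a \<le> 1" and a: "a \<in> carrier R" by auto
  obtain r where r: "r \<in> carrier R" "v r \<le> 1"
    "eval p (x \<oplus> y) = eval p x \<oplus> y \<otimes> eval (deriv p) x \<oplus> y \<otimes> y \<otimes> r"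
    using snoc.IH[OF p] by blast
  let ?e = "eval p x" and ?d = "eval (deriv p) x"
  have e: "?e \<in> carrier R" using eval_in_carrier[OF p(1)] xy by simp
  have d: "?d \<in> carrier R" using eval_in_carrier[OF deriv_carrier[OF p(1)]] xy by simp
  have "v ?d \<le> 1"
    using eval_ball[OF deriv_carrier[OF p(1)] deriv_ball[OF p] xy(1,2)] .
  then have "v (r \<otimes> x \<oplus> ?d \<oplus> y \<otimes> r) \<le> 1"
    using r(1,2) d xy by (intro abs_add_le abs_mult_le1) auto
  moreover have "eval (p @ [a]) (x \<oplus> y) = eval (p @ [a]) x \<oplus> y \<otimes> eval (deriv (p @ [a])) x
      \<oplus> y \<otimes> y \<otimes> (r \<otimes> x \<oplus> ?d \<oplus> y \<otimes> r)"
    unfolding eval_append_aux[OF p(1) a xy(1)] eval_deriv_snoc[OF p(1) a xy(1)]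
      eval_append_aux[OF p(1) a add.m_closed[OF xy(1,3)]] r(3)
    using e d r(1) a xy by algebra
  ultimately show ?case
    using r(1) d xy by (intro bexI[of _ "r \<otimes> x \<oplus> ?d \<oplus> y \<otimes> r"]) auto
qed

lemma eval_close:
  assumes p: "set p \<subseteq> carrier R" "\<forall>a\<in>set p. v a \<le> 1"
    and xy: "x \<in> carrier R" "v x \<le> 1" "y \<in> carrier R" "v y \<le> 1"
  shows "v (eval p x \<ominus> eval p y) \<le> v (x \<ominus> y)"
proof -
  have "v (x \<ominus> y) \<le> 1" using xy by (intro abs_minus_le) auto
  then obtain r where r: "r \<in> carrier R" "v r \<le> 1" "eval p (y \<oplus> (x \<ominus> y)) =
      eval p y \<oplus> (x \<ominus> y) \<otimes> eval (deriv p) y \<oplus> (x \<ominus> y) \<otimes> (x \<ominus> y) \<otimes> r"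
    using eval_taylor[OF p xy(3,4), of "x \<ominus> y"] xy by auto
  let ?d = "eval (deriv p) y"
  have d: "?d \<in> carrier R" "v ?d \<le> 1" "eval p y \<in> carrier R"
    using eval_in_carrier p(1) deriv_carrier[OF p(1)] eval_ball[OF deriv_carrier[OF p(1)] deriv_ball[OF p] xy(3,4)] xy by auto
  have "y \<oplus> (x \<ominus> y) = x" using xy by algebra
  moreover have "eval p y \<oplus> (x \<ominus> y) \<otimes> ?d \<oplus> (x \<ominus> y) \<otimes> (x \<ominus> y) \<otimes> r \<ominus> eval p y =
      (x \<ominus> y) \<otimes> (?d \<oplus> (x \<ominus> y) \<otimes> r)"
    using xy d r(1) by algebra
  ultimately have "v (eval p x \<ominus> eval p y) = v (x \<ominus> y) * v (?d \<oplus> (x \<ominus> y) \<otimes> r)"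
    using r xy d abs_mult by simp
  moreover have "v (?d \<oplus> (x \<ominus> y) \<otimes> r) \<le> 1"
    using d r xy \<open>v (x \<ominus> y) \<le> 1\<close> by (intro abs_add_le abs_mult_le1) auto
  ultimately show ?thesis
    using xy by (simp add: mult_left_le abs_nonneg)
qed

end

text \<open>For \<open>\<bar>x\<bar> \<le> 1\<close> the power \<open>(1 + x)\<^sup>n\<close> is a polynomial in \<open>x\<close> with \<open>n + 1\<close> coefficients in the valuation ring
of \<open>K\<close>. The triangle inequality gives \<open>\<bar>1 + x\<bar>\<^sup>n \<le> n + 1\<close> for all \<open>n\<close>, which forces \<open>\<bar>1 + x\<bar> \<le> 1\<close>.\<close>

lemma (in absolute_value) nonarch_from_subfield:
  assumes K: "subfield K R" and ultra: "\<And>x y. \<lbrakk>x \<in> K; y \<in> K\<rbrakk> \<Longrightarrow> v (x \<oplus> y) \<le> max (v x) (v y)"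
  shows "nonarch_absolute_value R v"
proof
  define S where "S = {x \<in> K. v x \<le> 1}"
  note Kc = subfield_closed[OF K]
  have S: "subring S R"
  proof (rule subringI)
    show "x \<oplus> y \<in> S" if "x \<in> S" "y \<in> S" for x y
      using that ultra[of x y] Kc unfolding S_def by fastforce
  qed (use Kc in \<open>auto simp: S_def abs_uminus abs_mult abs_nonneg mult_le_one\<close>)
  have SR: "S \<subseteq> carrier R" using subringE(1)[OF S] .
  have bound: "v (eval p x) \<le> length p" if p: "set p \<subseteq> S" and x: "x \<in> carrier R" "v x \<le> 1" for p x
    using p
  proof (induction p)
    case (Cons a p)
    have c: "a \<in> carrier R" "v a \<le> 1" "eval p x \<in> carrier R"
      using Cons.prems SR x eval_in_carrier[of p x] by (auto simp: S_def)
    have "v (a \<otimes> x [^] length p) \<le> 1"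
      using c x by (simp add: abs_mult abs_pow mult_le_one power_le_one abs_nonneg)
    moreover have "v (a \<otimes> x [^] length p \<oplus> eval p x) \<le> v (a \<otimes> x [^] length p) + v (eval p x)"
      using c x by (intro abs_triangle) auto
    ultimately show ?case using Cons by simp
  qed simp
  have pow: "\<exists>p. set p \<subseteq> S \<and> length p \<le> Suc n \<and> (\<one> \<oplus> x) [^] n = eval p x" if x: "x \<in> carrier R" for x and n :: nat
  proof (induction n)
    case 0
    then show ?case using subringE(3)[OF S] by (intro exI[of _ "[\<one>]"]) auto
  next
    case (Suc n)
    then obtain p where p: "set p \<subseteq> S" "length p \<le> Suc n" "(\<one> \<oplus> x) [^] n = eval p x" by blast
    \<comment> \<open>The coefficient list of \<open>(X + 1) p\<close>.\<close>
    let ?q = "poly_add (p @ [\<zero>]) p"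
    have pR: "set p \<subseteq> carrier R" "set (p @ [\<zero>]) \<subseteq> carrier R" using p(1) SR by auto
    have "polynomial S ?q"
      using poly_add_is_polynomial[OF S, of "p @ [\<zero>]" p] p(1) subringE(2)[OF S] by simp
    then have "set ?q \<subseteq> S" by (rule polynomial_incl)
    moreover have "length ?q \<le> Suc (Suc n)"
      using poly_add_length_le[of "p @ [\<zero>]" p] p(2) by simp
    moreover have "(\<one> \<oplus> x) [^] Suc n = eval ?q x"
      unfolding eval_poly_add[OF pR(2,1) x] eval_append_aux[OF pR(1) zero_closed x]
      using p(3) x eval_in_carrier[OF pR(1) x] by (simp add: r_distr a_ac)
    ultimately show ?case by blast
  qed
  have one: "v (\<one> \<oplus> x) \<le> 1" if x: "x \<in> carrier R" "v x \<le> 1" for x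
  proof (rule ccontr)
    assume "\<not> ?thesis"
    then have a: "1 < v (\<one> \<oplus> x)" (is "1 < ?a") by simp
    have le: "?a ^ n \<le> real (Suc n)" for n
    proof -
      obtain p where p: "set p \<subseteq> S" "length p \<le> Suc n" "(\<one> \<oplus> x) [^] n = eval p x"
        using pow[OF x(1)] by blast
      show ?thesis using bound[OF p(1) x] p(2,3) abs_pow[of "\<one> \<oplus> x" n] x(1) by simp
    qed
    have "(\<lambda>n. real n / ?a ^ n + inverse (?a ^ n)) \<longlonglongrightarrow> 0 + 0"
      using a by (intro tendsto_add lim_n_over_pown LIMSEQ_inverse_realpow_zero) auto
    then have "\<forall>\<^sub>F n in sequentially. real n / ?a ^ n + inverse (?a ^ n) < 1"
      by (intro order_tendstoD(2)) auto
    then obtain n where "real n / ?a ^ n + inverse (?a ^ n) < 1"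
      by (meson eventually_happens' sequentially_bot)
    with le[of n] a show False
      by (simp add: field_simps)
  qed
  show "v (x \<oplus> y) \<le> max (v x) (v y)" if xy: "x \<in> carrier R" "y \<in> carrier R" for x y
  proof -
    have *: "v (x \<oplus> y) \<le> v x" if "x \<in> carrier R" "y \<in> carrier R" "v y \<le> v x" for x y
    proof (cases "x = \<zero>")
      case True
      then show ?thesis using that abs_nonneg[of y] by simp
    next
      case False
      note i = inv_carrier[OF that(1) False]
      have "x \<otimes> inv x = \<one>" using False that(1) field_Units by simp
      then have "x \<otimes> (\<one> \<oplus> inv x \<otimes> y) = x \<oplus> y"
        using that i by (simp add: r_distr m_assoc[symmetric])
      then have "v (x \<oplus> y) = v x * v (\<one> \<oplus> inv x \<otimes> y)"
        using that i abs_mult by (metis add.m_closed m_closed one_closed)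
      moreover have "v (inv x \<otimes> y) \<le> 1"
        using that False i abs_pos[of x] by (simp add: abs_mult abs_inv field_simps)
      ultimately show ?thesis
        using one[of "inv x \<otimes> y"] that i abs_nonneg[of x] by (simp add: mult_left_le)
    qed
    show ?thesis
      using *[of x y] *[of y x] xy by (cases "v x \<le> v y") (auto simp: a_comm)
  qed
qed

section \<open>Completeness of finite-dimensional subspaces\<close>

lemma squeeze_to_0:
  fixes f g :: "nat \<Rightarrow> real"
  assumes "g \<longlonglongrightarrow> 0" "\<And>n. 0 \<le> f n" "\<And>n. f n \<le> g n"
  shows "f \<longlonglongrightarrow> 0"
  by (rule tendsto_sandwich[OF _ _ tendsto_const assms(1)]) (simp_all add: assms)

context nonarch_absolute_value
begin

text \<open>For an ultrametric a sequence is Cauchy as soon as its consecutive differences tend to 0.\<close>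

definition complete_on :: "'a set \<Rightarrow> bool" where
  "complete_on E \<longleftrightarrow> (\<forall>\<sigma>. range \<sigma> \<subseteq> E \<longrightarrow> (\<lambda>n. v (\<sigma> (Suc n) \<ominus> \<sigma> n)) \<longlonglongrightarrow> 0 \<longrightarrow>
    (\<exists>x\<in>E. (\<lambda>n. v (\<sigma> n \<ominus> x)) \<longlonglongrightarrow> 0))"

lemma complete_onE:
  assumes "complete_on E" "\<And>n. \<sigma> n \<in> E" "(\<lambda>n. v (\<sigma> (Suc n) \<ominus> \<sigma> n)) \<longlonglongrightarrow> 0"
  obtains x where "x \<in> E" "(\<lambda>n. v (\<sigma> n \<ominus> x)) \<longlonglongrightarrow> 0"
  using assms unfolding complete_on_def by blast

lemma mcomplete_imp_complete_on:
  assumes K: "subfield K R" and eq: "\<And>x. x \<in> K \<Longrightarrow> w x = v x"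
    and complete: "Metric_space.mcomplete K (abs_dist (R\<lparr>carrier := K\<rparr>) w)"
  shows "complete_on K"
  unfolding complete_on_def
proof (intro allI impI)
  fix \<sigma> :: "nat \<Rightarrow> 'a"
  assume range: "range \<sigma> \<subseteq> K" and step: "(\<lambda>n. v (\<sigma> (Suc n) \<ominus> \<sigma> n)) \<longlonglongrightarrow> 0"
  note Kc = subfield_closed[OF K]
  let ?d = "abs_dist (R\<lparr>carrier := K\<rparr>) w"
  have d: "?d x y = v (x \<ominus> y)" if "x \<in> K" "y \<in> K" for x y
    using that Kc(3) eq subring_a_minus[OF subfieldE(1)[OF K], of y x] by (simp add: abs_dist_def)
  have d0: "?d x y = 0" if "x \<notin> K \<or> y \<notin> K" for x y
    using that by (auto simp: abs_dist_def)
  interpret M: Metric_space K ?d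
  proof
    show "0 \<le> ?d x y" for x y
      using d[of x y] d0[of x y] Kc abs_nonneg[of "x \<ominus> y"] by (cases "x \<in> K \<and> y \<in> K") auto
    show "?d x y = ?d y x" for x y
      using d[of x y] d[of y x] d0[of x y] d0[of y x] Kc(1)[of x] Kc(1)[of y] abs_minus_commute[of x y]
      by (cases "x \<in> K \<and> y \<in> K") auto
    show "?d x y = 0 \<longleftrightarrow> x = y" if "x \<in> K" "y \<in> K" for x y
      using d[OF that] Kc(1)[OF that(1)] Kc(1)[OF that(2)] abs_eq_0_iff[of "x \<ominus> y"]
      by (simp add: r_right_minus_eq)
    show "?d x z \<le> ?d x y + ?d y z" if "x \<in> K" "y \<in> K" "z \<in> K" for x y z
    proof -
      note c = that[THEN Kc(1)]
      have "x \<ominus> z = (x \<ominus> y) \<oplus> (y \<ominus> z)" using c by algebra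
      then show ?thesis using that c d abs_triangle[of "x \<ominus> y" "y \<ominus> z"] by simp
    qed
  qed
  have \<sigma>: "\<sigma> n \<in> K" "\<sigma> n \<in> carrier R" for n using range Kc(1) by auto
  have "M.MCauchy \<sigma>"
    unfolding M.MCauchy_def
  proof (intro conjI allI impI range)
    fix e :: real assume e: "0 < e"
    then have "\<forall>\<^sub>F n in sequentially. v (\<sigma> (Suc n) \<ominus> \<sigma> n) < e"
      using order_tendstoD(2)[OF step] by simp
    then obtain N where N: "\<And>n. N \<le> n \<Longrightarrow> v (\<sigma> (Suc n) \<ominus> \<sigma> n) < e"
      unfolding eventually_sequentially by blast
    have close: "v (\<sigma> (N + k) \<ominus> \<sigma> N) < e" for k
    proof (induction k)
      case 0
      then show ?case using \<sigma> e by (simp add: minus_eq r_neg)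
    next
      case (Suc k)
      then show ?case
        using abs_minus_trans[of "\<sigma> (Suc (N + k))" "\<sigma> (N + k)" "\<sigma> N" e] N[of "N + k"] \<sigma> by simp
    qed
    have "?d (\<sigma> m) (\<sigma> n) < e" if mn: "N \<le> m" "N \<le> n" for m n
    proof -
      have "v (\<sigma> m \<ominus> \<sigma> N) < e" using close[of "m - N"] mn(1) by simp
      moreover have "v (\<sigma> N \<ominus> \<sigma> n) < e" 
        using close[of "n - N"] mn(2) abs_minus_commute[of "\<sigma> N" "\<sigma> n"] \<sigma> by simp
      ultimately show ?thesis
        using abs_minus_trans[of "\<sigma> m" "\<sigma> N" "\<sigma> n" e] \<sigma> d by simp
    qed
    then show "\<exists>N. \<forall>n n'. N \<le> n \<longrightarrow> N \<le> n' \<longrightarrow> ?d (\<sigma> n) (\<sigma> n') < e" by blast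
  qed
  then obtain x where "limitin M.mtopology \<sigma> x sequentially"
    using complete unfolding M.mcomplete_def by blast
  then have x: "x \<in> K" "\<And>e. 0 < e \<Longrightarrow> \<exists>N. \<forall>n\<ge>N. \<sigma> n \<in> K \<and> ?d (\<sigma> n) x < e"
    unfolding M.limit_metric_sequentially by blast+
  have "(\<lambda>n. v (\<sigma> n \<ominus> x)) \<longlonglongrightarrow> 0"
  proof (rule LIMSEQ_I)
    fix e :: real assume "0 < e"
    then obtain N where "\<And>n. N \<le> n \<Longrightarrow> ?d (\<sigma> n) x < e" using x(2) by blast
    then show "\<exists>N. \<forall>n\<ge>N. norm (v (\<sigma> n \<ominus> x) - 0) < e"
      using d \<sigma> x(1) Kc(1) abs_nonneg by (intro exI[of _ N]) auto
  qed
  then show "\<exists>x\<in>K. (\<lambda>n. v (\<sigma> n \<ominus> x)) \<longlonglongrightarrow> 0" using x(1) by blast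
qed

text \<open>A complete set is closed: otherwise points of \<open>W\<close> at distance less than \<open>1/n\<close> from \<open>u\<close> would form a
Cauchy sequence whose limit is \<open>u\<close>.\<close>

lemma complete_on_dist_pos:
  assumes W: "complete_on W" "W \<subseteq> carrier R" and u: "u \<in> carrier R" "u \<notin> W"
  obtains d where "0 < d" "\<And>w. w \<in> W \<Longrightarrow> d \<le> v (u \<ominus> w)"
proof -
  have "\<exists>d>0. \<forall>w\<in>W. d \<le> v (u \<ominus> w)"
  proof (rule ccontr)
    assume "\<not> ?thesis"
    then have "\<exists>w\<in>W. v (u \<ominus> w) < inverse (real (Suc n))" for n
      by (metis inverse_positive_iff_positive not_le of_nat_0_less_iff zero_less_Suc)
    then obtain \<sigma> where \<sigma>: "\<And>n. \<sigma> n \<in> W" "\<And>n. v (u \<ominus> \<sigma> n) < inverse (real (Suc n))"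
      by metis
    have \<sigma>c: "\<sigma> n \<in> carrier R" for n using \<sigma>(1) W(2) by blast
    have near: "v (\<sigma> n \<ominus> u) < inverse (real (Suc n))" for n
      using \<sigma>(2)[of n] abs_minus_commute[OF u(1) \<sigma>c] by simp
    have "v (\<sigma> (Suc n) \<ominus> \<sigma> n) \<le> inverse (real (Suc n))" for n
    proof -
      have "inverse (real (Suc (Suc n))) \<le> inverse (real (Suc n))" by (simp add: field_simps)
      then have "v (\<sigma> (Suc n) \<ominus> u) < inverse (real (Suc n))" using near[of "Suc n"] by linarith
      then show ?thesis
        using abs_minus_trans[OF \<sigma>c u(1) \<sigma>c _ \<sigma>(2)] by (simp add: less_imp_le)
    qed
    then have "(\<lambda>n. v (\<sigma> (Suc n) \<ominus> \<sigma> n)) \<longlonglongrightarrow> 0"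
      using \<sigma>c by (intro tendsto_sandwich[OF _ _ tendsto_const LIMSEQ_inverse_real_of_nat])
        (auto simp: abs_nonneg)
    then obtain x where x: "x \<in> W" "(\<lambda>n. v (\<sigma> n \<ominus> x)) \<longlonglongrightarrow> 0"
      using complete_onE[OF W(1), of \<sigma>] \<sigma>(1) by blast
    have xc: "x \<in> carrier R" using x(1) W(2) by blast
    have "v (u \<ominus> x) \<le> v (u \<ominus> \<sigma> n) + v (\<sigma> n \<ominus> x)" for n
    proof -
      have "u \<ominus> x = (u \<ominus> \<sigma> n) \<oplus> (\<sigma> n \<ominus> x)" using u(1) xc \<sigma>c[of n] by algebra
      then show ?thesis using abs_triangle[of "u \<ominus> \<sigma> n" "\<sigma> n \<ominus> x"] u(1) xc \<sigma>c[of n] by simp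
    qed
    then have "v (u \<ominus> x) \<le> inverse (real (Suc n)) + v (\<sigma> n \<ominus> x)" for n
      using \<sigma>(2)[of n] by (meson add_mono le_less_trans order_trans less_imp_le order_refl)
    moreover have "(\<lambda>n. inverse (real (Suc n)) + v (\<sigma> n \<ominus> x)) \<longlonglongrightarrow> 0 + 0"
      by (intro tendsto_add LIMSEQ_inverse_real_of_nat x(2))
    ultimately have "v (u \<ominus> x) \<le> 0"
      by (intro LIMSEQ_le_const[of _ 0]) auto
    then have "u = x"
      using abs_nonneg[of "u \<ominus> x"] abs_eq_0_iff[of "u \<ominus> x"] u(1) xc by (simp add: r_right_minus_eq)
    then show False using x(1) u(2) by simp
  qed
  then show ?thesis using that by blast
qed

text \<open>If \<open>u\<close> has distance at least \<open>d > 0\<close> from the complete subspace \<open>W\<close>, then \<open>\<bar>k u + w\<bar> \<ge> d \<bar>k\<bar>\<close> for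
\<open>w \<in> W\<close>. So the coefficients of \<open>u\<close> along a Cauchy sequence are Cauchy in \<open>K\<close>, and subtracting their
contribution leaves a Cauchy sequence in \<open>W\<close>.\<close>

lemma complete_on_Span:
  assumes K: "subfield K R" "complete_on K" and Us: "set Us \<subseteq> carrier R"
  shows "complete_on (Span K Us)"
  using Us
proof (induction Us)
  case Nil
  have "(\<lambda>n. v (\<sigma> n \<ominus> \<zero>)) \<longlonglongrightarrow> 0" if "range \<sigma> \<subseteq> {\<zero>}" for \<sigma> :: "nat \<Rightarrow> 'a"
  proof -
    have "\<sigma> n = \<zero>" for n using that by auto
    then show ?thesis by (simp add: minus_eq)
  qed
  then show ?case by (auto simp: complete_on_def)
next
  case (Cons u Us)
  let ?W = "Span K Us"
  have u: "u \<in> carrier R" and Us: "set Us \<subseteq> carrier R" using Cons.prems by auto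
  have W: "complete_on ?W" using Cons.IH[OF Us] .
  have Wc: "?W \<subseteq> carrier R" using Span_subgroup_props(1)[OF K(1) Us] .
  note Wp = Span_subgroup_props[OF K(1) Us] Span_smult_closed[OF K(1) Us]
  note Kc = subfield_closed[OF K(1)]
  have mem: "x \<in> Span K (u # Us) \<longleftrightarrow> (\<exists>k\<in>K. \<exists>w\<in>?W. x = k \<otimes> u \<oplus> w)" for x
    using line_extension_mem_iff by simp
  show ?case
  proof (cases "u \<in> ?W")
    case True
    have "x \<in> Span K (u # Us) \<longleftrightarrow> x \<in> ?W" for x
    proof
      show "x \<in> ?W" if "x \<in> Span K (u # Us)" using that True Wp unfolding mem by blast
      assume "x \<in> ?W"
      then have "x = \<zero> \<otimes> u \<oplus> x" using u Wc by auto
      then show "x \<in> Span K (u # Us)" using \<open>x \<in> ?W\<close> Kc(7) unfolding mem by blast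
    qed
    then have "Span K (u # Us) = ?W" by blast
    then show ?thesis using W by simp
  next
    case False
    then obtain d where d: "0 < d" "\<And>w. w \<in> ?W \<Longrightarrow> d \<le> v (u \<ominus> w)"
      using complete_on_dist_pos[OF W Wc u] by blast
    have coeff: "d * v k \<le> v (k \<otimes> u \<oplus> w)" if k: "k \<in> K" and w: "w \<in> ?W" for k w
    proof (cases "k = \<zero>")
      case True
      then show ?thesis using w Wc u abs_nonneg by auto
    next
      case nz: False
      have kc: "k \<in> carrier R" "inv k \<in> K" "inv k \<in> carrier R"  
        using k nz Kc(1,6) by auto
      have wc: "w \<in> carrier R" using w Wc by blast
      have "\<ominus> (inv k \<otimes> w) \<in> ?W" using Wp kc(2) w by blast
      then have "d \<le> v (u \<ominus> (\<ominus> (inv k \<otimes> w)))" using d(2) by blast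
      moreover have "k \<otimes> (u \<ominus> (\<ominus> (inv k \<otimes> w))) = k \<otimes> u \<oplus> w"
      proof -
        have "k \<otimes> (u \<ominus> (\<ominus> (inv k \<otimes> w))) = k \<otimes> u \<oplus> k \<otimes> inv k \<otimes> w"
          using kc wc u by algebra
        also have "k \<otimes> inv k = \<one>" using kc(1) nz field_Units by simp
        finally show ?thesis using wc by simp
      qed
      then have "v (k \<otimes> u \<oplus> w) = v k * v (u \<ominus> (\<ominus> (inv k \<otimes> w)))"
        using abs_mult[of k "u \<ominus> (\<ominus> (inv k \<otimes> w))"] kc wc u by simp
      ultimately show ?thesis
        using abs_nonneg[OF kc(1)] mult_left_mono[of d _ "v k"] by (simp add: mult.commute[of d])
    qed
    show ?thesis
      unfolding complete_on_def
    proof (intro allI impI)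
      fix \<sigma> :: "nat \<Rightarrow> 'a"
      assume range: "range \<sigma> \<subseteq> Span K (u # Us)"
        and step: "(\<lambda>n. v (\<sigma> (Suc n) \<ominus> \<sigma> n)) \<longlonglongrightarrow> 0"
      then have "\<forall>n. \<exists>k w. k \<in> K \<and> w \<in> ?W \<and> \<sigma> n = k \<otimes> u \<oplus> w" using mem by (meson range_subsetD)
      then obtain k w where kw: "\<And>n. k n \<in> K" "\<And>n. w n \<in> ?W" "\<And>n. \<sigma> n = k n \<otimes> u \<oplus> w n"
        by metis
      have kc: "k n \<in> carrier R" for n using kw(1) Kc(1) by blast
      have wc: "w n \<in> carrier R" for n using kw(2) Wc by blast
      have diff: "\<sigma> (Suc n) \<ominus> \<sigma> n = (k (Suc n) \<ominus> k n) \<otimes> u \<oplus> (w (Suc n) \<ominus> w n)" for n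
        unfolding kw(3) using kc[of n] kc[of "Suc n"] wc[of n] wc[of "Suc n"] u by algebra
      have W_minus: "a \<ominus> b \<in> ?W" if "a \<in> ?W" "b \<in> ?W" for a b
        using that Wp by (simp add: minus_eq)
      have kstep: "v (k (Suc n) \<ominus> k n) \<le> v (\<sigma> (Suc n) \<ominus> \<sigma> n) / d" for n
        using coeff[of "k (Suc n) \<ominus> k n" "w (Suc n) \<ominus> w n"] kw W_minus Kc(3) d(1)
        unfolding diff by (simp add: field_simps)
      have k_nonneg: "0 \<le> v (k (Suc n) \<ominus> k n)" for n using kc by (simp add: abs_nonneg)
      have "(\<lambda>n. v (\<sigma> (Suc n) \<ominus> \<sigma> n) / d) \<longlonglongrightarrow> 0"
        using tendsto_divide[OF step tendsto_const[of d]] d(1) by simp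
      then have klim: "(\<lambda>n. v (k (Suc n) \<ominus> k n)) \<longlonglongrightarrow> 0"
        by (rule squeeze_to_0[OF _ k_nonneg kstep])
      then obtain k0 where k0: "k0 \<in> K" "(\<lambda>n. v (k n \<ominus> k0)) \<longlonglongrightarrow> 0"
        using complete_onE[OF K(2), of k] kw(1) by blast
      have k0c: "k0 \<in> carrier R" using k0(1) Kc(1) by blast
      have wstep: "v (w (Suc n) \<ominus> w n) \<le> v (\<sigma> (Suc n) \<ominus> \<sigma> n) + v (k (Suc n) \<ominus> k n) * v u" for n
      proof -
        have \<sigma>c: "\<sigma> (Suc n) \<in> carrier R" "\<sigma> n \<in> carrier R" using kw(3) kc wc u by simp_all
        have "w (Suc n) \<ominus> w n = (\<sigma> (Suc n) \<ominus> \<sigma> n) \<oplus> \<ominus> ((k (Suc n) \<ominus> k n) \<otimes> u)"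
          unfolding diff using kc[of n] kc[of "Suc n"] wc[of n] wc[of "Suc n"] u by algebra
        then show ?thesis
          using abs_triangle[of "\<sigma> (Suc n) \<ominus> \<sigma> n" "\<ominus> ((k (Suc n) \<ominus> k n) \<otimes> u)"] kc \<sigma>c u
          by (simp add: abs_uminus abs_mult)
      qed
      have "(\<lambda>n. v (\<sigma> (Suc n) \<ominus> \<sigma> n) + v (k (Suc n) \<ominus> k n) * v u) \<longlonglongrightarrow> 0 + 0 * v u"
        by (intro tendsto_intros step klim)
      then have "(\<lambda>n. v (\<sigma> (Suc n) \<ominus> \<sigma> n) + v (k (Suc n) \<ominus> k n) * v u) \<longlonglongrightarrow> 0" by simp
      moreover have "0 \<le> v (w (Suc n) \<ominus> w n)" for n using wc by (simp add: abs_nonneg)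
      ultimately have "(\<lambda>n. v (w (Suc n) \<ominus> w n)) \<longlonglongrightarrow> 0"
        by (rule squeeze_to_0[OF _ _ wstep])
      then obtain w0 where w0: "w0 \<in> ?W" "(\<lambda>n. v (w n \<ominus> w0)) \<longlonglongrightarrow> 0"
        using complete_onE[OF W, of w] kw(2) by blast
      have w0c: "w0 \<in> carrier R" using w0(1) Wc by blast
      let ?x = "k0 \<otimes> u \<oplus> w0"
      have bound: "v (\<sigma> n \<ominus> ?x) \<le> v (k n \<ominus> k0) * v u + v (w n \<ominus> w0)" for n
      proof -
        have "\<sigma> n \<ominus> ?x = (k n \<ominus> k0) \<otimes> u \<oplus> (w n \<ominus> w0)"
          unfolding kw(3) using kc[of n] wc[of n] u k0c w0c by algebra
        then show ?thesis
          using abs_triangle[of "(k n \<ominus> k0) \<otimes> u" "w n \<ominus> w0"] kc[of n] wc[of n] u k0c w0c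
          by (simp add: abs_mult)
      qed
      have "(\<lambda>n. v (k n \<ominus> k0) * v u + v (w n \<ominus> w0)) \<longlonglongrightarrow> 0 * v u + 0"
        by (intro tendsto_intros k0(2) w0(2))
      then have "(\<lambda>n. v (k n \<ominus> k0) * v u + v (w n \<ominus> w0)) \<longlonglongrightarrow> 0" by simp
      moreover have "0 \<le> v (\<sigma> n \<ominus> ?x)" for n
        unfolding kw(3) using kc[of n] wc[of n] u k0c w0c by (simp add: abs_nonneg)
      ultimately have "(\<lambda>n. v (\<sigma> n \<ominus> ?x)) \<longlonglongrightarrow> 0"
        by (rule squeeze_to_0[OF _ _ bound])
      moreover have "?x \<in> Span K (u # Us)" using k0(1) w0(1) mem by blast
      ultimately show "\<exists>x\<in>Span K (u # Us). (\<lambda>n. v (\<sigma> n \<ominus> x)) \<longlonglongrightarrow> 0" by blast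
    qed
  qed
qed

lemma complete_on_subfield:
  assumes K: "subfield K R" "complete_on K" and fin: "finite_dimension K (carrier R)"
    and E: "subfield E R" "K \<subseteq> E"
  shows "complete_on E"
proof -
  note Ec = subfield_closed[OF E(1)]
  have "subgroup E (add_monoid R)"
    using subring.axioms(1)[OF subfieldE(1)[OF E(1)]] .
  then have "subalgebra K E R"
    using E(2) Ec(4) by (intro subalgebra.intro) (auto simp: subalgebra_axioms_def subset_iff)
  then have "finite_dimension K E"
    using subalbegra_incl_imp_finite_dimension[OF K(1) fin] Ec(1) by blast
  then obtain Us where "set Us \<subseteq> carrier R" "Span K Us = E"
    using exists_base[OF K(1) finite_dimensionE[OF K(1)]] by blast
  then show ?thesis using complete_on_Span[OF K] by blast
qed

section \<open>Hensel's lemma\<close>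

text \<open>By Taylor's formula the correction cancels the terms of order 0 and 1, so the new value is quadratic
in the old one.\<close>

lemma newton_step:
  assumes p: "set p \<subseteq> carrier R" "\<forall>a\<in>set p. v a \<le> 1" and y: "y \<in> carrier R" "v y \<le> 1"
    and d: "v (eval (deriv p) y) = 1"
    and z: "z = y \<ominus> eval p y \<otimes> inv (eval (deriv p) y)"
  shows "z \<in> carrier R" "v (z \<ominus> y) = v (eval p y)" "v z \<le> 1" "v (eval p z) \<le> v (eval p y) ^ 2"
proof -
  let ?e = "eval p y" and ?d = "eval (deriv p) y"
  have c: "?e \<in> carrier R" "?d \<in> carrier R"
    using eval_in_carrier p(1) deriv_carrier[OF p(1)] y(1) by blast+
  have nz: "?d \<noteq> \<zero>" using d by auto
  have i: "inv ?d \<in> carrier R" "?d \<otimes> inv ?d = \<one>" "v (inv ?d) = 1"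
    using inv_carrier[OF c(2) nz] field_Units c nz abs_inv[OF c(2) nz] d by auto
  define h where "h = \<ominus> (?e \<otimes> inv ?d)"
  have h: "h \<in> carrier R" "v h = v ?e" using c i by (simp_all add: h_def abs_uminus abs_mult)
  have e1: "v ?e \<le> 1" using eval_ball[OF p y] .
  have zh: "z = y \<oplus> h" by (simp add: z h_def minus_eq)
  show zc: "z \<in> carrier R" using zh y h by simp
  have "z \<ominus> y = h" unfolding zh using y(1) h(1) by algebra
  then show "v (z \<ominus> y) = v ?e" using h by simp
  show "v z \<le> 1" unfolding zh using y h e1 by (intro abs_add_le) auto
  obtain r where r: "r \<in> carrier R" "v r \<le> 1" "eval p (y \<oplus> h) = ?e \<oplus> h \<otimes> ?d \<oplus> h \<otimes> h \<otimes> r"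
    using eval_taylor[OF p y, of h] h e1 by auto
  have "h \<otimes> ?d = \<ominus> (?e \<otimes> (?d \<otimes> inv ?d))" unfolding h_def using c i(1) by algebra
  then have "h \<otimes> ?d = \<ominus> ?e" using i(2) c by simp
  then have "eval p z = h \<otimes> h \<otimes> r" unfolding zh r(3) using c h(1) r(1) by (simp add: r_neg)
  then have "v (eval p z) = v ?e ^ 2 * v r"
    using h r(1) by (simp add: abs_mult power2_eq_square)
  also have "\<dots> \<le> v ?e ^ 2 * 1" using r(2) by (intro mult_left_mono) auto
  finally show "v (eval p z) \<le> v ?e ^ 2" by simp
qed

text \<open>For two roots at distance less than 1, Taylor's formula exhibits 0 as their difference times an
element of absolute value 1.\<close>

lemma hensel_unique:
  assumes p: "set p \<subseteq> carrier R" "\<forall>a\<in>set p. v a \<le> 1"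
    and x: "x \<in> carrier R" "v x \<le> 1" "eval p x = \<zero>"
    and y: "y \<in> carrier R" "v y \<le> 1" "eval p y = \<zero>"
    and "v (x \<ominus> y) < 1" "v (eval (deriv p) y) = 1"
  shows "x = y"
proof -
  let ?h = "x \<ominus> y" and ?d = "eval (deriv p) y"
  have h: "?h \<in> carrier R" "v ?h < 1" using x y assms by auto
  have d: "?d \<in> carrier R" using eval_in_carrier[OF deriv_carrier[OF p(1)] y(1)] .
  obtain r where r: "r \<in> carrier R" "v r \<le> 1"
    "eval p (y \<oplus> ?h) = eval p y \<oplus> ?h \<otimes> ?d \<oplus> ?h \<otimes> ?h \<otimes> r"
    using eval_taylor[OF p y(1,2), of ?h] h by auto
  have "y \<oplus> ?h = x" using x(1) y(1) by algebra
  then have "\<zero> = ?h \<otimes> ?d \<oplus> ?h \<otimes> ?h \<otimes> r" using r(3) x(3) y(3) h d r by simp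
  also have "\<dots> = ?h \<otimes> (?d \<oplus> ?h \<otimes> r)" using h(1) d r(1) by algebra
  finally have "?h = \<zero> \<or> ?d \<oplus> ?h \<otimes> r = \<zero>" using integral[of ?h] h(1) d r(1) by auto
  moreover have "v (?d \<oplus> ?h \<otimes> r) = 1"
    using abs_add_eq_left[of ?d "?h \<otimes> r"] abs_mult_less1(2)[of r ?h] h d r assms by auto
  ultimately show ?thesis using x(1) y(1) by (auto simp: r_right_minus_eq)
qed

lemma hensel:
  assumes E: "subfield E R" "complete_on E" and p: "set p \<subseteq> E" "\<forall>a\<in>set p. v a \<le> 1"
    and x: "x \<in> E" "v x \<le> 1" "v (eval p x) < 1" "v (eval (deriv p) x) = 1"
  obtains y where "y \<in> E" "v y \<le> 1" "v (y \<ominus> x) < 1" "eval p y = \<zero>"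
proof -
  note Ec = subfield_closed[OF E(1)]
  have pc: "set p \<subseteq> carrier R" using p(1) Ec(1) by blast
  have evE: "eval q z \<in> E" if "set q \<subseteq> E" "z \<in> E" for q z
    using that(1) by (induction q) (use that(2) Ec in auto)
  have dE: "set (deriv p) \<subseteq> E" using deriv_closed[OF p(1)] Ec(10) by blast
  define a where "a = v (eval p x)"
  have a: "0 \<le> a" "a < 1" using x(3) Ec(1)[OF evE[OF p(1) x(1)]] by (simp_all add: a_def abs_nonneg)
  define f where "f z = z \<ominus> eval p z \<otimes> inv (eval (deriv p) z)" for z
  define \<sigma> where "\<sigma> n = (f ^^ n) x" for n
  have \<sigma>_Suc: "\<sigma> (Suc n) = f (\<sigma> n)" and \<sigma>_0: "\<sigma> 0 = x" for n by (simp_all add: \<sigma>_def)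
  have xc: "x \<in> carrier R" using x(1) Ec(1) by blast
  have deriv1: "v (eval (deriv p) z) = 1" if "z \<in> carrier R" "v z \<le> 1" "v (z \<ominus> x) < 1" for z
  proof -
    have "v (eval (deriv p) z \<ominus> eval (deriv p) x) < 1"
      using eval_close[OF deriv_carrier[OF pc] deriv_ball[OF pc p(2)] that(1,2) xc x(2)] that(3) by simp
    then show ?thesis
      using abs_eq_of_close[OF eval_in_carrier[OF deriv_carrier[OF pc] that(1)]
          eval_in_carrier[OF deriv_carrier[OF pc] xc]] x(4) by simp
  qed
  \<comment> \<open>The Newton iterates \<open>\<sigma> n\<close> stay in the residue class of \<open>x\<close>, where the derivative is a unit.\<close>
  have invariant: "\<sigma> n \<in> E \<and> v (\<sigma> n) \<le> 1 \<and> v (\<sigma> n \<ominus> x) < 1 \<and> v (eval p (\<sigma> n)) \<le> a ^ Suc n" for n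
  proof (induction n)
    case 0
    show ?case using x xc by (simp add: \<sigma>_0 a_def minus_eq r_neg)
  next
    case (Suc n)
    let ?y = "\<sigma> n"
    have y: "?y \<in> E" "?y \<in> carrier R" "v ?y \<le> 1" "v (?y \<ominus> x) < 1" "v (eval p ?y) \<le> a ^ Suc n"
      using Suc.IH Ec(1) by blast+
    have d1: "v (eval (deriv p) ?y) = 1" using deriv1[OF y(2-4)] .
    note s = newton_step[OF pc p(2) y(2,3) d1, of "\<sigma> (Suc n)"]
    have eq: "\<sigma> (Suc n) = ?y \<ominus> eval p ?y \<otimes> inv (eval (deriv p) ?y)" by (simp add: \<sigma>_Suc f_def)
    note s = s[OF eq]
    have "eval (deriv p) ?y \<noteq> \<zero>" using d1 by auto
    then have 1: "\<sigma> (Suc n) \<in> E"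
      unfolding eq by (intro Ec(3)[OF y(1)] Ec(4)[OF evE[OF p(1) y(1)]] Ec(6)[OF evE[OF dE y(1)]])
    have "a ^ Suc n \<le> a" using a power_decreasing[of 1 "Suc n" a] by simp
    then have "v (\<sigma> (Suc n) \<ominus> ?y) < 1" using s(2) y(5) a by linarith
    then have 2: "v (\<sigma> (Suc n) \<ominus> x) < 1"
      using abs_minus_trans[OF s(1) y(2) xc] y(4) by blast
    have "v (eval p ?y) ^ 2 \<le> (a ^ Suc n) ^ 2"
      using y(5) abs_nonneg[OF eval_in_carrier[OF pc y(2)]] by (intro power_mono) auto
    also have "\<dots> \<le> a ^ Suc (Suc n)"
      unfolding power_mult[symmetric] using a by (intro power_decreasing) auto
    finally have "v (eval p (\<sigma> (Suc n))) \<le> a ^ Suc (Suc n)" using s(4) by linarith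
    then show ?case using 1 2 s(3) by blast
  qed
  have \<sigma>c: "\<sigma> n \<in> carrier R" for n using invariant Ec(1) by blast
  have "v (\<sigma> (Suc n) \<ominus> \<sigma> n) \<le> a ^ Suc n" for n
  proof -
    have "\<sigma> (Suc n) = \<sigma> n \<ominus> eval p (\<sigma> n) \<otimes> inv (eval (deriv p) (\<sigma> n))"
      by (simp only: \<sigma>_Suc f_def)
    moreover have "v (\<sigma> n) \<le> 1" "v (eval (deriv p) (\<sigma> n)) = 1" "v (eval p (\<sigma> n)) \<le> a ^ Suc n"
      using invariant[of n] deriv1[OF \<sigma>c] by blast+
    ultimately show ?thesis using newton_step(2)[OF pc p(2) \<sigma>c] by metis
  qed
  moreover have alim: "(\<lambda>n. a ^ Suc n) \<longlonglongrightarrow> 0"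
    using LIMSEQ_Suc[OF LIMSEQ_realpow_zero[OF a]] .
  ultimately have "(\<lambda>n. v (\<sigma> (Suc n) \<ominus> \<sigma> n)) \<longlonglongrightarrow> 0"
    using \<sigma>c by (intro tendsto_sandwich[OF _ _ tendsto_const alim]) (auto simp: abs_nonneg)
  then obtain y where y: "y \<in> E" "(\<lambda>n. v (\<sigma> n \<ominus> y)) \<longlonglongrightarrow> 0"
    using complete_onE[OF E(2), of \<sigma>] invariant by blast
  have yc: "y \<in> carrier R" using y(1) Ec(1) by blast
  obtain n where "v (\<sigma> n \<ominus> y) < 1"
    using order_tendstoD(2)[OF y(2), of 1] by (auto simp: eventually_sequentially)
  then have n: "v (y \<ominus> \<sigma> n) < 1" using abs_minus_commute[OF \<sigma>c yc] by simp
  then have 1: "v (y \<ominus> x) < 1" using abs_minus_trans[OF yc \<sigma>c xc] invariant by blast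
  then have 2: "v y \<le> 1" using abs_le1_of_close[OF yc xc x(2)] by blast
  have "v (eval p y) \<le> a ^ Suc n + v (\<sigma> n \<ominus> y)" for n
  proof -
    let ?s = "eval p (\<sigma> n)"
    have c: "?s \<in> carrier R" "eval p y \<in> carrier R" using eval_in_carrier[OF pc] \<sigma>c yc by auto
    have "eval p y = ?s \<ominus> (?s \<ominus> eval p y)" using c by algebra
    then have "v (eval p y) \<le> max (v ?s) (v (?s \<ominus> eval p y))"
      using abs_ultrametric_minus[of ?s "?s \<ominus> eval p y"] c by simp
    moreover have "v (?s \<ominus> eval p y) \<le> v (\<sigma> n \<ominus> y)"
      using eval_close[OF pc p(2) \<sigma>c _ yc 2] invariant by blast
    moreover have "v ?s \<le> a ^ Suc n" using invariant by blast
    moreover have "0 \<le> v (\<sigma> n \<ominus> y)" "0 \<le> v ?s" using \<sigma>c yc c by (simp_all add: abs_nonneg)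
    ultimately show ?thesis by linarith
  qed
  moreover have "(\<lambda>n. a ^ Suc n + v (\<sigma> n \<ominus> y)) \<longlonglongrightarrow> 0 + 0"
    by (intro tendsto_add alim y(2))
  ultimately have "v (eval p y) \<le> 0"
    by (intro LIMSEQ_le_const[of _ 0]) auto
  then have "eval p y = \<zero>"
    using eval_in_carrier[OF pc yc] abs_nonneg[of "eval p y"] abs_eq_0_iff[of "eval p y"] by simp
  then show ?thesis using that y(1) 1 2 by blast
qed

text \<open>A simple root that is known to exist in the ambient field already lies in \<open>E\<close> if \<open>E\<close> contains an
approximation of it: Hensel's lemma in \<open>E\<close> produces a root close to it, and such a root is unique.\<close>

lemma hensel_mem:
  assumes E: "subfield E R" "complete_on E" and p: "set p \<subseteq> E" "\<forall>a\<in>set p. v a \<le> 1"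
    and s: "s \<in> carrier R" "v s \<le> 1" "eval p s = \<zero>" "v (eval (deriv p) s) = 1"
    and x: "x \<in> E" "v (s \<ominus> x) < 1"
  shows "s \<in> E"
proof -
  note Ec = subfield_closed[OF E(1)]
  have pc: "set p \<subseteq> carrier R" using p(1) Ec(1) by blast
  have xc: "x \<in> carrier R" using x(1) Ec(1) by blast
  have xs: "v (x \<ominus> s) < 1" using x(2) abs_minus_commute[OF s(1) xc] by simp
  have x1: "v x \<le> 1" using abs_le1_of_close[OF xc s(1,2) xs] .
  have "v (eval p x \<ominus> eval p s) < 1"
    using eval_close[OF pc p(2) xc x1 s(1,2)] xs by simp
  then have "v (eval p x) < 1"
    using s(3) eval_in_carrier[OF pc xc] by (simp add: minus_eq)
  moreover have "v (eval (deriv p) x) = 1"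
  proof -
    have "v (eval (deriv p) x \<ominus> eval (deriv p) s) < 1"
      using eval_close[OF deriv_carrier[OF pc] deriv_ball[OF pc p(2)] xc x1 s(1,2)] xs by simp
    then show ?thesis
      using abs_eq_of_close[OF eval_in_carrier[OF deriv_carrier[OF pc] xc]
          eval_in_carrier[OF deriv_carrier[OF pc] s(1)]] s(4) by simp
  qed
  ultimately obtain y where y: "y \<in> E" "v y \<le> 1" "v (y \<ominus> x) < 1" "eval p y = \<zero>"
    using hensel[OF E p x(1) x1] by blast
  have yc: "y \<in> carrier R" using y(1) Ec(1) by blast
  have "v (y \<ominus> s) < 1" using abs_minus_trans[OF yc xc s(1) y(3) xs] .
  then have "y = s" using hensel_unique[OF pc p(2) yc y(2,4) s(1-3)] s(4) by blast
  then show ?thesis using y(1) by simp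
qed

end

section \<open>Adjoining elements with a separable residue\<close>

context ring
begin

lemma eval_zeros: "\<lbrakk>set p \<subseteq> {\<zero>}; x \<in> carrier R\<rbrakk> \<Longrightarrow> eval p x = \<zero>"
  by (induction p) auto

end

context cring
begin

lemma eval_smult:
  "\<lbrakk>set p \<subseteq> carrier R; k \<in> carrier R; x \<in> carrier R\<rbrakk> \<Longrightarrow> eval (map ((\<otimes>) k) p) x = k \<otimes> eval p x"
  by (induction p) (auto simp: r_distr m_assoc eval_in_carrier)

lemma eval_map2:
  assumes "length s = length t" "set s \<subseteq> carrier R" "set t \<subseteq> carrier R" "b \<in> carrier R" "x \<in> carrier R"
  shows "eval (map2 (\<lambda>u w. u \<ominus> b \<otimes> w) s t) x = eval s x \<ominus> b \<otimes> eval t x"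
    and "eval (deriv (map2 (\<lambda>u w. u \<ominus> b \<otimes> w) s t)) x = eval (deriv s) x \<ominus> b \<otimes> eval (deriv t) x"
  using assms(1-3)
proof (induction s t rule: list_induct2)
  case Nil
  case 1 show ?case using assms by (simp add: minus_eq)
  case 2 show ?case using assms by (simp add: minus_eq)
next
  case (Cons u s w t)
  case 1
  have c: "u \<in> carrier R" "w \<in> carrier R" "set s \<subseteq> carrier R" "set t \<subseteq> carrier R" using 1 by auto
  then have e: "eval s x \<in> carrier R" "eval t x \<in> carrier R" "x [^] length t \<in> carrier R"
    using eval_in_carrier assms(5) by auto
  have "(u \<ominus> b \<otimes> w) \<otimes> x [^] length t \<oplus> (eval s x \<ominus> b \<otimes> eval t x) =
      u \<otimes> x [^] length t \<oplus> eval s x \<ominus> b \<otimes> (w \<otimes> x [^] length t \<oplus> eval t x)"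
    using c(1,2) e assms(4) by algebra
  then show ?case using Cons.IH(1)[OF c(3,4)] Cons.hyps by simp
next
  case (Cons u s w t)
  case 2
  have c: "u \<in> carrier R" "w \<in> carrier R" "set s \<subseteq> carrier R" "set t \<subseteq> carrier R" using 2 by auto
  let ?D = "eval (deriv s) x" and ?D' = "eval (deriv t) x" and ?y = "x [^] (length t - 1)"
  obtain N where N: "N = [length t] \<cdot> \<one>" "N \<in> carrier R" by simp
  have e: "?D \<in> carrier R" "?D' \<in> carrier R" "?y \<in> carrier R"
    using eval_in_carrier deriv_carrier c assms(5) by auto
  have n: "[length t] \<cdot> a = N \<otimes> a" if "a \<in> carrier R" for a
    unfolding N using that add_pow_ldistr[of \<one> a "length t"] by simp
  show ?case
  proof (cases "t = []")
    case True
    then show ?thesis using Cons.hyps assms by (simp add: minus_eq)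
  next
    case False
    then have ne: "s \<noteq> []" "t \<noteq> []" using Cons.hyps by auto
    have "N \<otimes> (u \<ominus> b \<otimes> w) \<otimes> ?y \<oplus> (?D \<ominus> b \<otimes> ?D') =
        N \<otimes> u \<otimes> ?y \<oplus> ?D \<ominus> b \<otimes> (N \<otimes> w \<otimes> ?y \<oplus> ?D')"
      using c(1,2) e N(2) assms(4) by algebra
    then show ?thesis
      using Cons.IH(2)[OF c(3,4)] Cons.hyps ne c assms(4) n by simp
  qed
qed

text \<open>One step of the division by a monic polynomial, whose leading coefficient is split off from the list
\<open>t\<close>, together with its derivative.\<close>

lemma eval_reduce:
  assumes "length s = length t" "set s \<subseteq> carrier R" "set t \<subseteq> carrier R" "b \<in> carrier R" "x \<in> carrier R"
  defines "s' \<equiv> map2 (\<lambda>u w. u \<ominus> b \<otimes> w) s t"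
  shows "eval (b # s) x = b \<otimes> eval (\<one> # t) x \<oplus> eval s' x"
    and "eval (deriv (b # s)) x = b \<otimes> eval (deriv (\<one> # t)) x \<oplus> eval (deriv s') x"
proof -
  have e: "eval s x \<in> carrier R" "eval t x \<in> carrier R" "x [^] length t \<in> carrier R"
    using eval_in_carrier assms by auto
  have "b \<otimes> x [^] length t \<oplus> eval s x =
      b \<otimes> (\<one> \<otimes> x [^] length t \<oplus> eval t x) \<oplus> (eval s x \<ominus> b \<otimes> eval t x)"
    using e assms(4) by algebra
  then show "eval (b # s) x = b \<otimes> eval (\<one> # t) x \<oplus> eval s' x"
    unfolding s'_def eval_map2(1)[OF assms(1-5)] using assms(1) by simp
  let ?D = "eval (deriv s) x" and ?D' = "eval (deriv t) x" and ?y = "x [^] (length t - 1)"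
  obtain N where N: "N = [length t] \<cdot> \<one>" "N \<in> carrier R" by simp
  have e: "?D \<in> carrier R" "?D' \<in> carrier R" "?y \<in> carrier R"
    using eval_in_carrier deriv_carrier assms by auto
  show "eval (deriv (b # s)) x = b \<otimes> eval (deriv (\<one> # t)) x \<oplus> eval (deriv s') x"
  proof (cases "t = []")
    case True
    then show ?thesis using assms by simp
  next
    case False
    then have ne: "s \<noteq> []" using assms(1) by auto
    have "[length t] \<cdot> b = N \<otimes> b"
      unfolding N using assms(4) add_pow_ldistr[of \<one> b "length t"] by simp
    moreover have "N \<otimes> b \<otimes> ?y \<oplus> ?D = b \<otimes> (N \<otimes> ?y \<oplus> ?D') \<oplus> (?D \<ominus> b \<otimes> ?D')"
      using e N(2) assms(4) by algebra
    ultimately show ?thesis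
      unfolding s'_def eval_map2(2)[OF assms(1-5)] using False ne assms(1) by (simp add: N(1))
  qed
qed

end

context field
begin

lemma set_map2_closed:
  assumes "subfield E R" "set s \<subseteq> E" "set t \<subseteq> E" "b \<in> E"
  shows "set (map2 (\<lambda>u w. u \<ominus> b \<otimes> w) s t) \<subseteq> E"
proof -
  have "u \<ominus> b \<otimes> w \<in> E" if "(u, w) \<in> set (zip s t)" for u w
    using assms(2-4) set_zip_leftD[OF that] set_zip_rightD[OF that]
    by (intro subfield_closed(3,4)[OF assms(1)]) auto
  then show ?thesis by auto
qed

text \<open>A monic equation of degree \<open>n\<close> for \<open>x\<close> lets every polynomial expression in \<open>x\<close> be rewritten with
powers below \<open>n\<close>; inductively, \<open>x\<close> times such an expression is reduced by one division step.\<close>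

lemma simple_extension_eval:
  assumes E: "subfield E R" and x: "x \<in> carrier R"
    and g: "set g \<subseteq> E" "eval (\<one> # g) x = \<zero>" and y: "y \<in> simple_extension E x"
  shows "\<exists>r. set r \<subseteq> E \<and> length r = length g \<and> y = eval r x"
  using y
proof induction
  case zero
  show ?case
    using subfield_closed(7)[OF E] eval_replicate[of "[]" x "length g"] x
    by (intro exI[of _ "replicate (length g) \<zero>"]) (simp add: set_replicate_conv_if)
next
  case (lin k1 k2)
  note Ec = subfield_closed[OF E]
  obtain r where r: "set r \<subseteq> E" "length r = length g" "k1 = eval r x" using lin.IH by blast
  obtain b s where bs: "r @ [k2] = b # s" by (cases r) auto
  have s: "length s = length g" "set s \<subseteq> E" "b \<in> E"
  proof -
    show "length s = length g" using arg_cong[OF bs, of length] r(2) by simp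
    have "set (b # s) \<subseteq> E" using r(1) lin.hyps unfolding bs[symmetric] by auto
    then show "set s \<subseteq> E" "b \<in> E" by auto
  qed
  have c: "set s \<subseteq> carrier R" "set g \<subseteq> carrier R" "b \<in> carrier R" "set r \<subseteq> carrier R" "k2 \<in> carrier R"
    using s g r lin.hyps Ec(1) by auto
  let ?t = "map2 (\<lambda>u w. u \<ominus> b \<otimes> w) s g"
  have t: "set ?t \<subseteq> E" using set_map2_closed[OF E s(2) g(1) s(3)] .
  have "k1 \<otimes> x \<oplus> k2 = eval (b # s) x"
    unfolding bs[symmetric] eval_append_aux[OF c(4,5) x] r(3) ..
  also have "\<dots> = eval ?t x"
    unfolding eval_reduce(1)[OF s(1) c(1-3) x] g(2)
  proof -
    have "set ?t \<subseteq> carrier R" using t Ec(1) by blast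
    then show "b \<otimes> \<zero> \<oplus> eval ?t x = eval ?t x"
      using eval_in_carrier[OF _ x, of ?t] c(3) by simp
  qed
  finally show ?case using t s(1) by (intro exI[of _ ?t]) simp
qed

end

context nonarch_absolute_value
begin

text \<open>A polynomial over the valuation ring of \<open>E\<close> whose reduction is nonzero and vanishes at the residue
of \<open>c\<close>. Calculating with such lifts replaces algebra in extensions of residue fields.\<close>

definition residual_poly :: "'a set \<Rightarrow> 'a \<Rightarrow> 'a list \<Rightarrow> bool" where
  "residual_poly E c p \<longleftrightarrow>
    set p \<subseteq> E \<and> (\<forall>a\<in>set p. v a \<le> 1) \<and> (\<exists>a\<in>set p. v a = 1) \<and> v (eval p c) < 1"

text \<open>The polynomial \<open>\<one> # p\<close> lifts the minimal polynomial of the residue of \<open>c\<close> over the residue field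
of \<open>E\<close>.\<close>

definition min_residual_poly :: "'a set \<Rightarrow> 'a \<Rightarrow> 'a list \<Rightarrow> bool" where
  "min_residual_poly E c p \<longleftrightarrow> residual_poly E c (\<one> # p) \<and>
    (\<forall>q. residual_poly E c q \<longrightarrow> length p < length q)"

lemma normalize_content:
  assumes E: "subfield E R" and p: "set p \<subseteq> E" "\<not> set p \<subseteq> {\<zero>}"
  obtains a where "a \<in> set p" "a \<noteq> \<zero>" "set (map ((\<otimes>) (inv a)) p) \<subseteq> E"
    "\<forall>b\<in>set (map ((\<otimes>) (inv a)) p). v b \<le> 1" "\<exists>b\<in>set (map ((\<otimes>) (inv a)) p). v b = 1"
proof -
  note Ec = subfield_closed[OF E]
  have ne: "set p \<noteq> {}" using p by auto
  then have "Max (v ` set p) \<in> v ` set p" by (intro Max_in) auto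
  then obtain a where a: "a \<in> set p" "v a = Max (v ` set p)" by auto
  have max: "v b \<le> v a" if "b \<in> set p" for b using a(2) that by simp
  have c: "b \<in> carrier R" if "b \<in> set p" for b using that p(1) Ec(1) by blast
  have "a \<noteq> \<zero>"
  proof
    assume "a = \<zero>"
    then have "b = \<zero>" if "b \<in> set p" for b
      using max[OF that] abs_nonneg[OF c[OF that]] abs_eq_0_iff[OF c[OF that]] by simp
    then show False using p(2) by blast
  qed
  have ac: "a \<in> carrier R" "inv a \<in> E" "inv a \<in> carrier R" "0 < v a"
    using a(1) c p(1) \<open>a \<noteq> \<zero>\<close> Ec(6) Ec(1) abs_pos by blast+
  have val: "v (inv a \<otimes> b) = v b / v a" if "b \<in> set p" for b
    using ac \<open>a \<noteq> \<zero>\<close> c[OF that] by (simp add: abs_mult abs_inv field_simps)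
  show ?thesis
  proof (rule that[OF a(1) \<open>a \<noteq> \<zero>\<close>])
    show "set (map ((\<otimes>) (inv a)) p) \<subseteq> E" using ac(2) p(1) Ec(4) by auto
    show "\<forall>b\<in>set (map ((\<otimes>) (inv a)) p). v b \<le> 1" using val max ac(4) by auto
    show "\<exists>b\<in>set (map ((\<otimes>) (inv a)) p). v b = 1" using val[OF a(1)] a(1) ac(4) by auto
  qed
qed

lemma exists_residual_poly:
  assumes E: "subfield E R" and c: "c \<in> carrier R" "(algebraic over E) c"
  obtains p where "residual_poly E c p"
proof -
  note Ec = subfield_closed[OF E]
  obtain p where p: "p \<in> carrier (E[X])" "p \<noteq> []" "eval p c = \<zero>"
    using algebraicE[OF subfieldE(1)[OF E] c] by blast
  then have pE: "set p \<subseteq> E" "hd p \<noteq> \<zero>"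
    unfolding univ_poly_carrier[symmetric] polynomial_def by auto
  have pc: "set p \<subseteq> carrier R" using pE(1) Ec(1) by blast
  have "\<not> set p \<subseteq> {\<zero>}" using pE(2) p(2) by (cases p) auto
  then obtain a where a: "a \<in> set p" "a \<noteq> \<zero>" "set (map ((\<otimes>) (inv a)) p) \<subseteq> E"
    "\<forall>b\<in>set (map ((\<otimes>) (inv a)) p). v b \<le> 1" "\<exists>b\<in>set (map ((\<otimes>) (inv a)) p). v b = 1"
    using normalize_content[OF E pE(1)] by blast
  have "inv a \<in> carrier R" using inv_carrier a(1,2) pc by blast
  then have "eval (map ((\<otimes>) (inv a)) p) c = \<zero>"
    using eval_smult[OF pc _ c(1)] p(3) by simp
  then have "residual_poly E c (map ((\<otimes>) (inv a)) p)" using a unfolding residual_poly_def by simp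
  then show ?thesis by (rule that)
qed

text \<open>In a shortest residual polynomial the leading coefficient is a unit, because a leading coefficient
of absolute value less than 1 could be dropped.\<close>

lemma exists_min_residual_poly:
  assumes E: "subfield E R" and c: "c \<in> carrier R" "v c \<le> 1" and p: "residual_poly E c p"
  obtains g where "min_residual_poly E c g"
proof -
  note Ec = subfield_closed[OF E]
  obtain q where q: "residual_poly E c q" and least: "\<And>q'. residual_poly E c q' \<Longrightarrow> length q \<le> length q'"
    using ex_has_least_nat[of "residual_poly E c" p length] p by blast
  obtain a t where at: "q = a # t" using q unfolding residual_poly_def by (cases q) auto
  have E': "a \<in> E" "set t \<subseteq> E" "a \<in> carrier R" "set t \<subseteq> carrier R" "v a \<le> 1" "\<forall>b\<in>set t. v b \<le> 1"
    and small: "v (eval q c) < 1"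
    using q Ec(1) unfolding residual_poly_def at by auto
  have tc: "eval t c \<in> carrier R" using eval_in_carrier[OF E'(4) c(1)] .
  have va: "v a = 1"
  proof (rule ccontr)
    assume "v a \<noteq> 1"
    then have a1: "v a < 1" using E'(5) by simp
    then have "v (a \<otimes> c [^] length t) < 1"
      using E'(3) c by (intro abs_mult_less1(2)) (auto simp: abs_pow power_le_one abs_nonneg)
    then have "v (eval q c \<ominus> a \<otimes> c [^] length t) < 1"
      using small eval_in_carrier[of q c] E'(3,4) c at by (intro abs_minus_less) auto
    moreover have "eval q c \<ominus> a \<otimes> c [^] length t = eval t c"
    proof -
      have "a \<otimes> y \<oplus> eval t c \<ominus> a \<otimes> y = eval t c" if "y \<in> carrier R" for y
        using that E'(3) tc by algebra
      then show ?thesis using c(1) unfolding at by simp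
    qed
    ultimately have "residual_poly E c t"
      using q a1 unfolding residual_poly_def at by auto
    then show False using least[of t] at by simp
  qed
  then have a0: "a \<noteq> \<zero>" by auto
  have ia: "inv a \<in> E" "inv a \<in> carrier R" "v (inv a) = 1" "inv a \<otimes> a = \<one>"
    using Ec(6)[OF E'(1) a0] Ec(1) abs_inv[OF E'(3) a0] va field_Units E'(3) a0 by auto
  let ?g = "map ((\<otimes>) (inv a)) t"
  have eq: "map ((\<otimes>) (inv a)) q = \<one> # ?g" using ia(4) at by simp
  have "eval (\<one> # ?g) c = inv a \<otimes> eval q c"
    unfolding eq[symmetric] using E'(3,4) at c(1) ia(2) by (intro eval_smult) auto
  then have "v (eval (\<one> # ?g) c) < 1"
    using small ia(2,3) eval_in_carrier[of q c] E'(3,4) c(1) at by (simp add: abs_mult)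
  moreover have "set ?g \<subseteq> E" "\<forall>b\<in>set ?g. v b \<le> 1"
    using E'(2,4,6) ia Ec(4) by (auto simp: abs_mult subset_iff)
  ultimately have "residual_poly E c (\<one> # ?g)"
    unfolding residual_poly_def using Ec(8) by auto
  moreover have "length ?g < length q'" if "residual_poly E c q'" for q'
    using least[OF that] at by simp
  ultimately show ?thesis using that unfolding min_residual_poly_def by blast
qed

text \<open>Being residual depends only on the residue of \<open>c\<close>, hence survives passing from an approximate root
to the exact root found by Hensel's lemma.\<close>

lemma residual_poly_close:
  assumes "set p \<subseteq> carrier R" "c \<in> carrier R" "v c \<le> 1" "c' \<in> carrier R" "v (c' \<ominus> c) < 1"
    and "residual_poly E c p"
  shows "residual_poly E c' p"
proof -
  have c': "v c' \<le> 1" using abs_le1_of_close[OF assms(4,2,3,5)] .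
  have p: "\<forall>a\<in>set p. v a \<le> 1" "v (eval p c) < 1" using assms(6) unfolding residual_poly_def by auto
  have e: "eval p c \<in> carrier R" "eval p c' \<in> carrier R" using eval_in_carrier assms by auto
  have "v (eval p c' \<ominus> eval p c) < 1"
    using eval_close[OF assms(1) p(1) assms(4) c' assms(2,3)] assms(5) by simp
  then have "v (eval p c' \<ominus> \<zero>) < 1"
    using abs_minus_trans[OF e(2,1) zero_closed] p(2) e by (simp add: minus_eq)
  then show ?thesis using assms(6) e unfolding residual_poly_def by (simp add: minus_eq)
qed

lemma min_residual_poly_close:
  assumes E: "E \<subseteq> carrier R" and c: "c \<in> carrier R" "v c \<le> 1" "c' \<in> carrier R" "v (c' \<ominus> c) < 1"
    and g: "min_residual_poly E c g"
  shows "min_residual_poly E c' g"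
proof -
  have c': "v c' \<le> 1" using abs_le1_of_close[OF c(3,1,2,4)] .
  have "v (c \<ominus> c') < 1" using c abs_minus_commute by simp
  then have "residual_poly E c q" if "residual_poly E c' q" for q
    using residual_poly_close[OF _ c(3) c' c(1), of q E] that E unfolding residual_poly_def by blast
  moreover have "residual_poly E c' (\<one> # g)"
    using residual_poly_close[OF _ c, of "\<one> # g" E] g E
    unfolding min_residual_poly_def residual_poly_def by auto
  ultimately show ?thesis using g unfolding min_residual_poly_def by blast
qed

lemma min_residual_poly_small:
  assumes "min_residual_poly E c g" "set r \<subseteq> E" "\<forall>a\<in>set r. v a \<le> 1" "length r \<le> length g"
    "v (eval r c) < 1"
  shows "\<forall>a\<in>set r. v a < 1"
proof (rule ccontr)
  assume "\<not> ?thesis"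
  then have "residual_poly E c r" using assms unfolding residual_poly_def by force
  then show False using assms unfolding min_residual_poly_def by fastforce
qed

text \<open>After division by a coefficient of largest absolute value, \<open>r\<close> is too short to be residual, so its
value at \<open>c\<close> has absolute value 1. In other words, the powers of \<open>c\<close> below the degree of the minimal
residual polynomial are orthogonal over \<open>E\<close>.\<close>

lemma min_residual_poly_orthogonal:
  assumes E: "subfield E R" and c: "c \<in> carrier R" "v c \<le> 1" and g: "min_residual_poly E c g"
    and r: "set r \<subseteq> E" "length r \<le> length g" "eval r c \<noteq> \<zero>"
  obtains a where "a \<in> E" "a \<noteq> \<zero>" "v (eval r c) = v a"
proof -
  note Ec = subfield_closed[OF E]
  have rc: "set r \<subseteq> carrier R" using r(1) Ec(1) by blast
  have "\<not> set r \<subseteq> {\<zero>}" using r(3) eval_zeros[OF _ c(1)] by blast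
  then obtain a where a: "a \<in> set r" "a \<noteq> \<zero>" "set (map ((\<otimes>) (inv a)) r) \<subseteq> E"
    "\<forall>b\<in>set (map ((\<otimes>) (inv a)) r). v b \<le> 1" "\<exists>b\<in>set (map ((\<otimes>) (inv a)) r). v b = 1"
    using normalize_content[OF E r(1)] by blast
  have ac: "a \<in> carrier R" "inv a \<in> carrier R" "0 < v a" "a \<in> E"
    using a(1,2) rc inv_carrier abs_pos r(1) by auto
  let ?q = "map ((\<otimes>) (inv a)) r"
  have "\<not> v (eval ?q c) < 1"
    using min_residual_poly_small[OF g a(3,4)] r(2) a(5) by fastforce
  moreover have "v (eval ?q c) \<le> 1"
    using eval_ball[OF _ a(4) c] a(3) Ec(1) by blast
  moreover have "eval ?q c = inv a \<otimes> eval r c" using eval_smult[OF rc ac(2) c(1)] .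
  ultimately have "v (inv a \<otimes> eval r c) = 1" by simp
  then have "v (eval r c) = v a"
    using ac a(2) eval_in_carrier[OF rc c(1)] by (simp add: abs_mult abs_inv field_simps)
  then show ?thesis using that[OF ac(4) a(2)] by blast
qed

text \<open>Division with remainder by a monic polynomial with coefficients in the valuation ring, evaluated at
\<open>x\<close> together with its derivative: \<open>q\<close> and \<open>q'\<close> are the values at \<open>x\<close> of the quotient and of its
derivative.\<close>

lemma monic_division:
  assumes E: "subfield E R" and x: "x \<in> carrier R" "v x \<le> 1"
    and g: "set g \<subseteq> E" "\<forall>a\<in>set g. v a \<le> 1" and p: "set p \<subseteq> E" "\<forall>a\<in>set p. v a \<le> 1"
  shows "\<exists>q q' r. q \<in> carrier R \<and> v q \<le> 1 \<and> q' \<in> carrier R \<and> v q' \<le> 1 \<and>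
    set r \<subseteq> E \<and> (\<forall>a\<in>set r. v a \<le> 1) \<and> length r = length g \<and>
    eval p x = q \<otimes> eval (\<one> # g) x \<oplus> eval r x \<and>
    eval (deriv p) x = q' \<otimes> eval (\<one> # g) x \<oplus> q \<otimes> eval (deriv (\<one> # g)) x \<oplus> eval (deriv r) x"
  using p
proof (induction p rule: rev_induct)
  case Nil
  let ?r = "replicate (length g) \<zero>"
  have r: "set ?r \<subseteq> {\<zero>}" by auto
  then have "set (deriv ?r) \<subseteq> {\<zero>}" by (rule deriv_closed) auto
  note z = eval_zeros[OF r x(1)] eval_zeros[OF this x(1)]
  have gc: "set (\<one> # g) \<subseteq> carrier R" using g(1) subfield_closed(1)[OF E] by auto
  note e = eval_in_carrier[OF gc x(1)] eval_in_carrier[OF deriv_carrier[OF gc] x(1)]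
  show ?case
    using z e r subfield_closed(7)[OF E]
    by (intro exI[of _ \<zero>] exI[of _ "?r"]) (auto simp del: eval.simps(2) deriv.simps(2))
next
  case (snoc a p)
  note Ec = subfield_closed[OF E]
  have pE: "set p \<subseteq> E" "\<forall>a\<in>set p. v a \<le> 1" and a: "a \<in> E" "v a \<le> 1" using snoc.prems by auto
  obtain q q' r where q: "q \<in> carrier R" "v q \<le> 1" "q' \<in> carrier R" "v q' \<le> 1"
    and r: "set r \<subseteq> E" "\<forall>a\<in>set r. v a \<le> 1" "length r = length g"
    and eq: "eval p x = q \<otimes> eval (\<one> # g) x \<oplus> eval r x"
      "eval (deriv p) x = q' \<otimes> eval (\<one> # g) x \<oplus> q \<otimes> eval (deriv (\<one> # g)) x \<oplus> eval (deriv r) x"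
    using snoc.IH[OF pE] by blast
  obtain b s where bs: "r @ [a] = b # s" by (cases r) auto
  have len: "length s = length g" using arg_cong[OF bs, of length] r(3) by simp
  have "set (b # s) \<subseteq> E" "\<forall>a\<in>set (b # s). v a \<le> 1" using r a unfolding bs[symmetric] by auto
  then have s: "set s \<subseteq> E" "\<forall>a\<in>set s. v a \<le> 1" "b \<in> E" "v b \<le> 1" by auto
  have c: "set p \<subseteq> carrier R" "set r \<subseteq> carrier R" "set s \<subseteq> carrier R" "set g \<subseteq> carrier R"
    "a \<in> carrier R" "b \<in> carrier R" "set (\<one> # g) \<subseteq> carrier R"
    using pE r s g a Ec(1) by auto
  define t where "t = map2 (\<lambda>u w. u \<ominus> b \<otimes> w) s g"
  have t: "set t \<subseteq> E" "length t = length g" "set t \<subseteq> carrier R"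
    unfolding t_def using set_map2_closed[OF E s(1) g(1) s(3)] len Ec(1) by auto
  have t1: "\<forall>a\<in>set t. v a \<le> 1"
  proof
    fix y assume "y \<in> set t"
    then obtain u w where uw: "u \<in> set s" "w \<in> set g" "y = u \<ominus> b \<otimes> w"
      unfolding t_def by (auto dest: set_zip_leftD set_zip_rightD)
    then show "v y \<le> 1"
      using s g c by (auto intro!: abs_minus_le abs_mult_le1)
  qed
  let ?G = "eval (\<one> # g) x" and ?G' = "eval (deriv (\<one> # g)) x"
  have G: "?G \<in> carrier R" "?G' \<in> carrier R" "eval r x \<in> carrier R" "eval (deriv r) x \<in> carrier R"
    "eval t x \<in> carrier R" "eval (deriv t) x \<in> carrier R"
    using eval_in_carrier[OF _ x(1)] deriv_carrier c(2,7) t(3) by blast+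
  have red: "eval r x \<otimes> x \<oplus> a = b \<otimes> ?G \<oplus> eval t x"
    "eval (deriv r) x \<otimes> x \<oplus> eval r x = b \<otimes> ?G' \<oplus> eval (deriv t) x"
    by (rule trans[OF eval_append_aux[OF c(2,5) x(1), symmetric, unfolded bs]
          eval_reduce(1)[OF len c(3,4,6) x(1), folded t_def]],
        rule trans[OF eval_deriv_snoc[OF c(2,5) x(1), symmetric, unfolded bs]
          eval_reduce(2)[OF len c(3,4,6) x(1), folded t_def]])
  have alg1: "(q \<otimes> G \<oplus> r) \<otimes> x \<oplus> a = (q \<otimes> x) \<otimes> G \<oplus> (r \<otimes> x \<oplus> a)"
    "(q \<otimes> x) \<otimes> G \<oplus> (b \<otimes> G \<oplus> t) = (q \<otimes> x \<oplus> b) \<otimes> G \<oplus> t"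
    if "G \<in> carrier R" "r \<in> carrier R" "t \<in> carrier R" for G r t
    using that q(1) c(5,6) x(1) by algebra+
  have alg2: "(q' \<otimes> G \<oplus> q \<otimes> G' \<oplus> r') \<otimes> x \<oplus> (q \<otimes> G \<oplus> r) =
      (q' \<otimes> x \<oplus> q) \<otimes> G \<oplus> (q \<otimes> x) \<otimes> G' \<oplus> (r' \<otimes> x \<oplus> r)"
    "(q' \<otimes> x \<oplus> q) \<otimes> G \<oplus> (q \<otimes> x) \<otimes> G' \<oplus> (b \<otimes> G' \<oplus> r') =
      (q' \<otimes> x \<oplus> q) \<otimes> G \<oplus> (q \<otimes> x \<oplus> b) \<otimes> G' \<oplus> r'"
    if "G \<in> carrier R" "G' \<in> carrier R" "r \<in> carrier R" "r' \<in> carrier R" for G G' r r'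
    using that q(1,3) c(5,6) x(1) by algebra+
  have 1: "eval (p @ [a]) x = (q \<otimes> x \<oplus> b) \<otimes> ?G \<oplus> eval t x"
    unfolding eval_append_aux[OF c(1,5) x(1)] eq(1) alg1(1)[OF G(1,3,5)] red(1) alg1(2)[OF G(1,3,5)] ..
  have 2: "eval (deriv (p @ [a])) x =
    (q' \<otimes> x \<oplus> q) \<otimes> ?G \<oplus> (q \<otimes> x \<oplus> b) \<otimes> ?G' \<oplus> eval (deriv t) x"
    unfolding eval_deriv_snoc[OF c(1,5) x(1)] eq alg2(1)[OF G(1,2,3,4)] red(2) alg2(2)[OF G(1,2,5,6)] ..
  have q1: "q \<otimes> x \<oplus> b \<in> carrier R" "q' \<otimes> x \<oplus> q \<in> carrier R" using q c(6) x(1) by auto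
  have q2: "v (q \<otimes> x \<oplus> b) \<le> 1" "v (q' \<otimes> x \<oplus> q) \<le> 1"
    using abs_add_le[OF _ c(6) abs_mult_le1 s(4)] abs_add_le[OF _ q(1) abs_mult_le1 q(2)] q x by auto
  show ?case
    by (rule exI[of _ "q \<otimes> x \<oplus> b"], rule exI[of _ "q' \<otimes> x \<oplus> q"], rule exI[of _ t])
      (intro conjI q1 q2 t(1,2) t1 1 2)
qed

text \<open>A residue that is separable over a small field remains so over a larger one, since its minimal
polynomial over the larger field divides the given polynomial \<open>h\<close>. For lifts: the remainder of \<open>h\<close>
is small at \<open>c\<close>, hence has small coefficients, and the derivative of \<open>h\<close> at \<open>c\<close> would be small if
that of \<open>g\<close> were.\<close>

lemma min_residual_poly_separable:
  assumes E: "subfield E R" and c: "c \<in> carrier R" "v c \<le> 1" and g: "min_residual_poly E c g"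
    and h: "residual_poly E c h" "v (eval (deriv h) c) = 1"
  shows "v (eval (deriv (\<one> # g)) c) = 1"
proof (rule ccontr)
  assume ne: "\<not> ?thesis"
  note Ec = subfield_closed[OF E]
  have gE: "set g \<subseteq> E" "\<forall>a\<in>set (\<one> # g). v a \<le> 1" "v (eval (\<one> # g) c) < 1"
    using g unfolding min_residual_poly_def residual_poly_def by auto
  have hE: "set h \<subseteq> E" "\<forall>a\<in>set h. v a \<le> 1" "v (eval h c) < 1"
    using h(1) unfolding residual_poly_def by auto
  have gc: "set (\<one> # g) \<subseteq> carrier R" "set h \<subseteq> carrier R" using gE(1) hE(1) Ec(1) by auto
  have "\<forall>a\<in>set g. v a \<le> 1" using gE(2) by simp
  then obtain q q' r where q: "q \<in> carrier R" "v q \<le> 1" "q' \<in> carrier R" "v q' \<le> 1"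
    and r: "set r \<subseteq> E" "\<forall>a\<in>set r. v a \<le> 1" "length r = length g"
    and eq: "eval h c = q \<otimes> eval (\<one> # g) c \<oplus> eval r c"
      "eval (deriv h) c = q' \<otimes> eval (\<one> # g) c \<oplus> q \<otimes> eval (deriv (\<one> # g)) c \<oplus> eval (deriv r) c"
    using monic_division[OF E c gE(1) _ hE(1,2)] by blast
  have rc: "set r \<subseteq> carrier R" using r(1) Ec(1) by blast
  let ?G = "eval (\<one> # g) c" and ?G' = "eval (deriv (\<one> # g)) c"
  have G: "?G \<in> carrier R" "?G' \<in> carrier R" "eval r c \<in> carrier R" "eval (deriv r) c \<in> carrier R"
    using eval_in_carrier[OF _ c(1)] deriv_carrier gc(1) rc by blast+
  have "v ?G' \<le> 1" using eval_ball[OF deriv_carrier[OF gc(1)] deriv_ball[OF gc(1) gE(2)] c] .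
  with ne have G'1: "v ?G' < 1" by simp
  have "eval r c = eval h c \<ominus> q \<otimes> ?G"
    unfolding eq using G q by algebra
  moreover have "v (q \<otimes> ?G) < 1" using abs_mult_less1(1)[OF q(1) G(1) q(2) gE(3)] .
  ultimately have "v (eval r c) < 1"
    using hE(3) G q eval_in_carrier[OF gc(2) c(1)] abs_minus_less[of "eval h c" "q \<otimes> ?G" 1] by simp
  then have "\<forall>a\<in>set r. v a < 1" using min_residual_poly_small[OF g r(1,2)] r(3) by simp
  then have "v (eval (deriv r) c) < 1"
    using eval_small[OF deriv_carrier[OF rc] deriv_small[OF rc] c] by blast
  moreover have "v (q' \<otimes> ?G) < 1" "v (q \<otimes> ?G') < 1"
    using abs_mult_less1(1)[OF q(3) G(1) q(4) gE(3)] abs_mult_less1(1)[OF q(1) G(2) q(2) G'1] by auto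
  ultimately have "v (eval (deriv h) c) < 1"
    unfolding eq using G q by (intro abs_add_less) auto
  then show False using h(2) by simp
qed

text \<open>The unramified step: lifting a separable residue to an exact root \<open>c'\<close> of its minimal residual
polynomial gives an extension of \<open>E\<close> with an orthogonal basis of elements of absolute value 1, and
so with the value group of \<open>E\<close>.\<close>

lemma adjoin_residue:
  assumes E: "subfield E R" and complete: "complete_on (carrier R)"
    and alg: "\<And>x. x \<in> carrier R \<Longrightarrow> (algebraic over E) x"
    and c: "c \<in> carrier R" "v c \<le> 1" 
    and h: "residual_poly E c h" "v (eval (deriv h) c) = 1"
  obtains c' where "c' \<in> carrier R" "v (c' \<ominus> c) < 1" "subfield (simple_extension E c') R"
    "\<And>y. \<lbrakk>y \<in> simple_extension E c'; y \<noteq> \<zero>\<rbrakk> \<Longrightarrow> \<exists>a\<in>E. a \<noteq> \<zero> \<and> v y = v a"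
proof -
  note Ec = subfield_closed[OF E]
  obtain g where g: "min_residual_poly E c g"
    using exists_min_residual_poly[OF E c h(1)] by blast
  then have gE: "set g \<subseteq> E" "set (\<one> # g) \<subseteq> carrier R" "\<forall>a\<in>set (\<one> # g). v a \<le> 1" "v (eval (\<one> # g) c) < 1"
    using Ec(1) unfolding min_residual_poly_def residual_poly_def by auto
  obtain c' where c': "c' \<in> carrier R" "v c' \<le> 1" "v (c' \<ominus> c) < 1" "eval (\<one> # g) c' = \<zero>"
    using hensel[OF carrier_is_subfield complete gE(2,3) c gE(4)
        min_residual_poly_separable[OF E c g h]] by blast
  have "E \<subseteq> carrier R" using Ec(1) by blast
  then have g': "min_residual_poly E c' g" using min_residual_poly_close[OF _ c c'(1,3) g] by blast
  show ?thesis
  proof (rule that[OF c'(1,3)])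
    show "subfield (simple_extension E c') R"
      using simple_extension_is_subfield[OF E c'(1)] alg[OF c'(1)] by simp
    show "\<exists>a\<in>E. a \<noteq> \<zero> \<and> v y = v a" if y: "y \<in> simple_extension E c'" "y \<noteq> \<zero>" for y
    proof -
      obtain r where r: "set r \<subseteq> E" "length r = length g" "y = eval r c'"
        using simple_extension_eval[OF E c'(1) gE(1) c'(4) y(1)] by blast
      then show ?thesis
        using min_residual_poly_orthogonal[OF E c'(1,2) g' r(1)] y(2) by auto
    qed
  qed
qed

end

section \<open>Adjoining tame radicals\<close>

context cring
begin

text \<open>The list is that of \<open>X\<^sup>n - y\<close>.\<close>

lemma eval_binomial:
  assumes "x \<in> carrier R" "y \<in> carrier R" "0 < n"
  shows "eval (monom \<one> (n - 1) @ [\<ominus> y]) x = x [^] n \<ominus> y"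
    and "eval (deriv (monom \<one> (n - 1) @ [\<ominus> y])) x = ([n] \<cdot> \<one>) \<otimes> x [^] (n - 1)"
proof -
  obtain k where k: "n = Suc k" using assms(3) gr0_implies_Suc by blast
  have m: "set (monom \<one> k) \<subseteq> carrier R" for k by (rule monom_in_carrier) simp
  show "eval (monom \<one> (n - 1) @ [\<ominus> y]) x = x [^] n \<ominus> y"
    unfolding k using assms eval_append_aux[OF m _ assms(1), of "\<ominus> y"] eval_monom[OF one_closed assms(1)]
    by (simp add: minus_eq)
  have D: "eval (deriv (monom \<one> k)) x \<otimes> x = ([k] \<cdot> \<one>) \<otimes> x [^] k" for k
  proof (induction k)
    case 0
    then show ?case using assms by (simp add: monom_def)
  next
    case (Suc k)
    have eq: "monom \<one> (Suc k) = monom \<one> k @ [\<zero>]"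
      by (simp add: monom_def replicate_append_same)
    have "eval (deriv (monom \<one> (Suc k))) x = ([k] \<cdot> \<one>) \<otimes> x [^] k \<oplus> x [^] k"
      unfolding eq eval_deriv_snoc[OF m zero_closed assms(1)] Suc.IH
      using eval_monom[OF one_closed assms(1)] assms(1) by simp
    also have "\<dots> = ([Suc k] \<cdot> \<one>) \<otimes> x [^] k" using assms(1) by (simp add: l_distr)
    finally show ?case using assms(1) by (simp add: m_assoc)
  qed
  show "eval (deriv (monom \<one> (n - 1) @ [\<ominus> y])) x = ([n] \<cdot> \<one>) \<otimes> x [^] (n - 1)"
    unfolding k using eval_deriv_snoc[OF m _ assms(1), of "\<ominus> y" k] D[of k]
      eval_monom[OF one_closed assms(1)] assms(1,2) by (simp add: l_distr)
qed

end

context nonarch_absolute_value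
begin

lemma binomial_ball:
  assumes E: "subfield E R" and y: "y \<in> E" "v y \<le> 1"
  shows "set (monom \<one> k @ [\<ominus> y]) \<subseteq> E" "\<forall>a\<in>set (monom \<one> k @ [\<ominus> y]). v a \<le> 1"
  using subfield_closed[OF E] y abs_uminus by (auto simp: monom_def)

lemma abs_nat_dvd:
  fixes m j :: nat
  assumes "v ([m] \<cdot> \<one>) = 1" "j dvd m" shows "v ([j] \<cdot> \<one>) = 1"
proof -
  obtain d where d: "m = j * d" using assms(2) by blast
  have "[m] \<cdot> \<one> = [d] \<cdot> ([j] \<cdot> \<one>)" unfolding d by (simp add: add.nat_pow_pow)
  then have "1 \<le> v ([j] \<cdot> \<one>)"
    using assms(1) abs_add_pow_le[of "[j] \<cdot> \<one>" "v ([j] \<cdot> \<one>)" d] by simp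
  then show ?thesis using abs_nat_le1[of j] by simp
qed

lemma one_unit_root:
  fixes n :: nat
  assumes E: "subfield E R" "complete_on E" and u: "u \<in> E" "v (u \<ominus> \<one>) < 1"
    and n: "0 < n" "v ([n] \<cdot> \<one>) = 1"
  obtains r where "r \<in> E" "v r = 1" "r [^] n = u"
proof -
  note Ec = subfield_closed[OF E(1)]
  have uc: "u \<in> carrier R" using u(1) Ec(1) by blast
  have u1: "v u = 1" using abs_eq_of_close[of u \<one>] uc u(2) by simp
  let ?p = "monom \<one> (n - 1) @ [\<ominus> u]"
  note ev = eval_binomial[OF one_closed uc n(1)]
  note ball = binomial_ball[OF E(1) u(1) eq_refl[OF u1], where k = "n - 1"]
  have "v (eval ?p \<one>) < 1"
    unfolding ev(1) using abs_minus_commute[OF uc one_closed] u(2) by simp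
  moreover have "v (eval (deriv ?p) \<one>) = 1" unfolding ev(2) using n(2) by simp
  ultimately obtain r where r: "r \<in> E" "v (r \<ominus> \<one>) < 1" "eval ?p r = \<zero>"
    using hensel[OF E ball Ec(8)] by auto
  have rc: "r \<in> carrier R" using r(1) Ec(1) by blast
  have "v r = 1" using abs_eq_of_close[of r \<one>] rc r(2) by simp
  moreover have "r [^] n = u"
    using r(3) eval_binomial(1)[OF rc uc n(1)] rc uc r_right_minus_eq[of "r [^] n" u] by simp
  ultimately show ?thesis using that r(1) by blast
qed

text \<open>The residue field of \<open>E\<close> is that of the whole field.\<close>

definition full_residue :: "'a set \<Rightarrow> bool" where
  "full_residue E \<longleftrightarrow> (\<forall>c\<in>carrier R. v c \<le> 1 \<longrightarrow> (\<exists>a\<in>E. v (c \<ominus> a) < 1))"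

text \<open>As \<open>n\<close> is invertible in the residue field, \<open>s\<close> is a simple root of \<open>X\<^sup>n - s\<^sup>n\<close>, and \<open>E\<close> contains an
approximation of it.\<close>

lemma unit_root_mem:
  fixes n :: nat
  assumes E: "subfield E R" "complete_on E" "full_residue E"
    and s: "s \<in> carrier R" "v s = 1" "s [^] n \<in> E" and n: "0 < n" "v ([n] \<cdot> \<one>) = 1"
  shows "s \<in> E"
proof -
  note Ec = subfield_closed[OF E(1)]
  obtain a where a: "a \<in> E" "v (s \<ominus> a) < 1" using E(3) s unfolding full_residue_def by force
  have y: "s [^] n \<in> carrier R" "v (s [^] n) \<le> 1" using s(1,2) by (simp_all add: abs_pow)
  note ev = eval_binomial[OF s(1) y(1) n(1)]
  have "eval (monom \<one> (n - 1) @ [\<ominus> (s [^] n)]) s = \<zero>"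
    unfolding ev(1) using y(1) by (simp add: r_right_minus_eq)
  moreover have "v (eval (deriv (monom \<one> (n - 1) @ [\<ominus> (s [^] n)])) s) = 1"
    unfolding ev(2) using s(1,2) n(2) by (simp add: abs_mult abs_pow)
  ultimately show ?thesis
    using hensel_mem[OF E(1,2) binomial_ball[OF E(1) s(3) y(2)] s(1)] s(2) a by simp
qed

text \<open>The powers of \<open>x\<close> below \<open>d\<close> have absolute values in distinct cosets of the value group of \<open>E\<close>. Terms
of a polynomial expression thus have distinct absolute values and cannot cancel.\<close>

lemma eval_distinct_cosets:
  assumes E: "subfield E R" and x: "x \<in> carrier R" "x \<noteq> \<zero>"
    and distinct: "\<And>i a. \<lbrakk>0 < i; i < d; a \<in> E; a \<noteq> \<zero>\<rbrakk> \<Longrightarrow> v x ^ i \<noteq> v a"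
    and r: "set r \<subseteq> E" "length r \<le> d" "eval r x \<noteq> \<zero>"
  shows "\<exists>i<length r. \<exists>a\<in>E. a \<noteq> \<zero> \<and> v (eval r x) = v a * v x ^ i"
  using r
proof (induction r)
  case (Cons a r)
  note Ec = subfield_closed[OF E]
  let ?n = "length r"
  have a: "a \<in> E" "a \<in> carrier R" and rE: "set r \<subseteq> E" using Cons.prems Ec(1) by auto
  have rc: "eval r x \<in> carrier R" using eval_in_carrier[OF _ x(1)] rE Ec(1) by blast
  have lead: "v (a \<otimes> x [^] ?n) = v a * v x ^ ?n" using a x by (simp add: abs_mult abs_pow)
  consider "a = \<zero>" | "a \<noteq> \<zero>" "eval r x = \<zero>" | "a \<noteq> \<zero>" "eval r x \<noteq> \<zero>" by blast
  then show ?case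
  proof cases
    case 1
    then have "eval (a # r) x = eval r x" using rc x by simp
    then show ?thesis using Cons.IH[OF rE] Cons.prems by (auto intro: less_SucI)
  next
    case 2
    then have "v (eval (a # r) x) = v a * v x ^ ?n" using lead a x by simp
    then show ?thesis using a(1) 2(1) by auto
  next
    case 3
    obtain i b where ib: "i < ?n" "b \<in> E" "b \<noteq> \<zero>" "v (eval r x) = v b * v x ^ i"
      using Cons.IH[OF rE] Cons.prems 3(2) by auto
    have bc: "b \<in> carrier R" using ib(2) Ec(1) by blast
    have "v (eval r x) \<noteq> v (a \<otimes> x [^] ?n)"
    proof
      assume "v (eval r x) = v (a \<otimes> x [^] ?n)"
      then have "v b * v x ^ i = v a * v x ^ (?n - i) * v x ^ i"
        using ib lead by (simp add: power_add[symmetric])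
      then have "v b = v a * v x ^ (?n - i)" using abs_pos[OF x] by simp
      then have "v x ^ (?n - i) = v (b \<otimes> inv a)"
        using abs_pos[OF a(2) 3(1)] a(2) bc 3(1) inv_carrier
        by (simp add: abs_mult abs_inv field_simps)
      moreover have "b \<otimes> inv a \<in> E" using ib(2) Ec(4,6) a(1) 3(1) by blast
      moreover have "b \<otimes> inv a \<noteq> \<zero>"
        using integral[of b "inv a"] bc ib(3) inv_carrier inv_nonzero a(2) 3(1) by blast
      moreover have "0 < ?n - i" "?n - i < d" using ib(1) Cons.prems(2) by auto
      ultimately show False using distinct by blast
    qed
    then have "v (eval (a # r) x) = max (v a * v x ^ ?n) (v b * v x ^ i)"
      using abs_add_neq[of "a \<otimes> x [^] ?n" "eval r x"] a x rc lead ib(4) by simp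
    then show ?thesis
      using a(1) 3(1) ib(1-3) by (auto simp: max_def intro: less_SucI)
  qed
qed simp

text \<open>Let \<open>d\<close> be the order of \<open>\<bar>x\<bar>\<close> modulo the value group of \<open>E\<close>; it divides \<open>m\<close>. Write \<open>x\<^sup>d = s b\<close> with
\<open>b \<in> E\<close> and \<open>\<bar>s\<bar> = 1\<close>. Then \<open>s\<close> is a root of order \<open>m/d\<close> of a unit of \<open>E\<close>, so \<open>s\<close> and \<open>x\<^sup>d\<close> lie in \<open>E\<close>.
Hence \<open>E(x)\<close> is spanned by \<open>1, x, \<dots>, x\<^sup>d\<^sup>-\<^sup>1\<close>, whose absolute values represent distinct cosets.\<close>

lemma adjoin_tame_root:
  fixes m :: nat
  assumes E: "subfield E R" "complete_on E" "full_residue E"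
    and alg: "\<And>x. x \<in> carrier R \<Longrightarrow> (algebraic over E) x"
    and x: "x \<in> carrier R" "x \<noteq> \<zero>" "x [^] m \<in> E" and m: "0 < m" "v ([m] \<cdot> \<one>) = 1"
  shows "subfield (simple_extension E x) R"
    and "\<And>y. \<lbrakk>y \<in> simple_extension E x; y \<noteq> \<zero>\<rbrakk> \<Longrightarrow> \<exists>i. \<exists>a\<in>E. a \<noteq> \<zero> \<and> v y = v a * v x ^ i"
proof -
  note Ec = subfield_closed[OF E(1)]
  show "subfield (simple_extension E x) R"
    using simple_extension_is_subfield[OF E(1) x(1)] alg[OF x(1)] by simp
  let ?P = "\<lambda>i. 0 < i \<and> (\<exists>a\<in>E. a \<noteq> \<zero> \<and> v x ^ i = v a)"
  have vx: "0 < v x" using abs_pos x by blast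
  have xm0: "x [^] m \<noteq> \<zero>" using abs_pow[OF x(1), of m] vx by auto
  have Pm: "?P m" using x m(1) xm0 abs_pow[OF x(1), of m] by auto
  define d where "d = (LEAST i. ?P i)"
  have Pd: "?P d" unfolding d_def using Pm by (rule LeastI)
  then obtain b where b: "b \<in> E" "b \<noteq> \<zero>" "v x ^ d = v b" and d: "0 < d" by blast
  have min: "\<not> ?P i" if "i < d" for i using that not_less_Least unfolding d_def by blast
  have bc: "b \<in> carrier R" "inv b \<in> E" "inv b \<in> carrier R" 
    using b(1,2) Ec(1,6) by blast+
  \<comment> \<open>Otherwise \<open>m mod d\<close> would be a smaller exponent that brings \<open>\<bar>x\<bar>\<close> into the value group.\<close>
  have "d dvd m"
  proof (rule ccontr)
    assume "\<not> d dvd m"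
    then have pos: "0 < m mod d" by (simp add: dvd_eq_mod_eq_0)
    obtain j where j: "j = m div d" by simp
    have "v x ^ m = (v x ^ d) ^ j * v x ^ (m mod d)"
      unfolding j power_mult[symmetric] power_add[symmetric] by simp
    moreover have "v (b [^] j) = (v x ^ d) ^ j" "v (x [^] m) = v x ^ m"
      using b(3) abs_pow bc(1) x(1) by auto
    moreover have bj: "b [^] j \<in> E" "b [^] j \<in> carrier R" "0 < v (b [^] j)"
      using Ec(9) b(1) bc(1) abs_pow abs_pos[OF bc(1) b(2)] by auto
    moreover from bj have bj0: "b [^] j \<noteq> \<zero>" by auto
    ultimately have "v x ^ (m mod d) = v (x [^] m \<otimes> inv (b [^] j))"
      using x(1) inv_carrier[OF bj(2) bj0] vx by (simp add: abs_mult abs_inv field_simps)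
    moreover have "x [^] m \<otimes> inv (b [^] j) \<in> E" using Ec(4,6) x(3) bj(1) bj0 by blast
    moreover have "x [^] m \<otimes> inv (b [^] j) \<noteq> \<zero>"
      using integral[of "x [^] m" "inv (b [^] j)"] xm0 x(1) inv_carrier inv_nonzero bj(2) bj0 by blast
    ultimately have "?P (m mod d)" using pos by blast
    then show False using min[of "m mod d"] d by simp
  qed
  then obtain j where j: "m = d * j" by blast
  have j0: "0 < j" "v ([j] \<cdot> \<one>) = 1" using m j abs_nat_dvd[OF m(2), of j] by auto
  define s where "s = x [^] d \<otimes> inv b"
  have sc: "s \<in> carrier R" unfolding s_def using x bc by simp
  have s1: "v s = 1" unfolding s_def using x bc b abs_pos[OF bc(1) b(2)]
    by (simp add: abs_mult abs_pow abs_inv)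
  have "s [^] j = x [^] m \<otimes> inv b [^] j"
    unfolding s_def j using x(1) bc(3) by (simp add: nat_pow_distrib nat_pow_pow)
  then have "s [^] j \<in> E" using x(3) bc(2) Ec(4,9) by simp
  then have sE: "s \<in> E" using unit_root_mem[OF E sc s1 _ j0] by blast
  have "x [^] d = s \<otimes> b"
    unfolding s_def using x(1) bc b(2) field_Units by (simp add: m_assoc)
  then have xd: "x [^] d \<in> E" using sE b(1) Ec(4) by simp
  let ?g = "replicate (d - 1) \<zero> @ [\<ominus> (x [^] d)]"
  have g: "set ?g \<subseteq> E" "length ?g = d" using xd Ec(5,7) d by auto
  have xdc: "x [^] d \<in> carrier R" using x(1) by simp
  have "eval (\<one> # ?g) x = \<zero>"
    using eval_binomial(1)[OF x(1) xdc d] x(1) by (simp add: monom_def r_right_minus_eq)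
  note root = this
  show "\<exists>i. \<exists>a\<in>E. a \<noteq> \<zero> \<and> v y = v a * v x ^ i" if y: "y \<in> simple_extension E x" "y \<noteq> \<zero>" for y
  proof -
    obtain r where r: "set r \<subseteq> E" "length r = d" "y = eval r x"
      using simple_extension_eval[OF E(1) x(1) g(1) root y(1)] g(2) by auto
    show ?thesis
      using eval_distinct_cosets[OF E(1) x(1,2) _ r(1), of d] r(2,3) y(2) min by blast
  qed
qed

end

section \<open>Perfect residue fields\<close>

context ring
begin

lemma add_pow_consistent: "add_pow (R\<lparr>carrier := S\<rparr>) (n::nat) x = [n] \<cdot> x"
  by (simp add: add_pow_def nat_pow_def)

lemma deriv_consistent:
  assumes "subring S R" shows "ring.deriv (R\<lparr>carrier := S\<rparr>) = deriv"
proof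
  interpret S: ring "R\<lparr>carrier := S\<rparr>" by (rule subring_is_ring[OF assms(1)])
  show "S.deriv p = deriv p" for p by (induction p) (simp_all add: add_pow_consistent)
qed

lemma normalize_zeros: "set p \<subseteq> {\<zero>} \<Longrightarrow> normalize p = []"
  by (induction p) auto

end

lemma (in ring_hom_ring) deriv_hom: "set p \<subseteq> carrier R \<Longrightarrow> deriv (map h p) = map h (R.deriv p)"
proof (induction p)
  case (Cons a p)
  have "h (add_pow R n a) = add_pow S n (h a)" for n :: nat
    using Cons.prems by (induction n) auto
  then show ?case using Cons by simp
qed simp

context nonarch_absolute_value
begin

context
  fixes K
  assumes K: "subfield K R"
begin

lemma valuation_ring_subring: "subring {x \<in> K. v x \<le> 1} R"
  using subfield_closed[OF K]
  by (intro subringI) (auto simp: abs_uminus intro: abs_mult_le1 abs_add_le)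

lemma valuation_ideal_ideal: "ideal (valuation_ideal v K) (valuation_ring R v K)"
proof -
  let ?O = "valuation_ring R v K"
  note Kc = subfield_closed[OF K]
  interpret O: ring ?O
    unfolding valuation_ring_def by (rule subring_is_ring[OF valuation_ring_subring])
  show ?thesis
  proof (rule idealI[OF O.ring_axioms])
    show "subgroup (valuation_ideal v K) (add_monoid ?O)"
    proof (rule O.add.subgroupI)
      show "valuation_ideal v K \<noteq> {}" using Kc(7) by (auto simp: valuation_ideal_def)
      show "\<ominus>\<^bsub>?O\<^esub> a \<in> valuation_ideal v K" if a: "a \<in> valuation_ideal v K" for a
      proof -
        have "\<ominus>\<^bsub>?O\<^esub> a = \<ominus> a"
          using a Kc(1,5) abs_uminus
          by (intro O.minus_equality) (auto simp: valuation_ring_def valuation_ideal_def l_neg)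
        then show ?thesis using a Kc(1,5) abs_uminus by (auto simp: valuation_ideal_def)
      qed
    qed (use Kc(1,2) in \<open>auto simp: valuation_ring_def valuation_ideal_def intro: abs_add_less\<close>)
  qed (use Kc(1,4) in \<open>auto simp: valuation_ring_def valuation_ideal_def intro: abs_mult_less1\<close>)
qed

abbreviation (input) residue :: "'a \<Rightarrow> 'a set" where
  "residue \<equiv> (+>\<^bsub>valuation_ring R v K\<^esub>) (valuation_ideal v K)"

lemma residue_hom: "ring_hom_ring (valuation_ring R v K) (residue_field R v K) residue"
  unfolding residue_field_def by (rule ideal.rcos_ring_hom_ring[OF valuation_ideal_ideal])

lemma residue_eq_iff:
  assumes "a \<in> K" "b \<in> K" "v a \<le> 1" "v b \<le> 1"
  shows "residue a = residue b \<longleftrightarrow> v (a \<ominus> b) < 1"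
proof -
  interpret H: ring_hom_ring "valuation_ring R v K" "residue_field R v K" residue by (rule residue_hom)
  have "a \<ominus>\<^bsub>valuation_ring R v K\<^esub> b = a \<ominus> b"
    unfolding valuation_ring_def using subring_a_minus[OF valuation_ring_subring] assms by simp
  then show ?thesis
    using H.R.quotient_eq_iff_same_a_r_cos[OF valuation_ideal_ideal, of a b] assms
      subfield_closed(3)[OF K]
    by (simp add: valuation_ring_def valuation_ideal_def)
qed

lemma residue_zero_iff:
  assumes "a \<in> K" "v a \<le> 1"
  shows "residue a = \<zero>\<^bsub>residue_field R v K\<^esub> \<longleftrightarrow> v a < 1"
proof -
  interpret H: ring_hom_ring "valuation_ring R v K" "residue_field R v K" residue by (rule residue_hom)
  have "residue \<zero> = \<zero>\<^bsub>residue_field R v K\<^esub>"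
    using H.hom_zero by (simp add: valuation_ring_def)
  moreover have "residue a = residue \<zero> \<longleftrightarrow> v (a \<ominus> \<zero>) < 1"
    using assms subfield_closed(7)[OF K] by (intro residue_eq_iff) auto
  ultimately show ?thesis using subfield_closed(1)[OF K assms(1)] by (simp add: minus_eq)
qed

lemma residue_lift:
  assumes "set p \<subseteq> carrier (residue_field R v K)"
  obtains P where "set P \<subseteq> {x \<in> K. v x \<le> 1}" "p = map residue P"
proof -
  have "carrier (residue_field R v K) = residue ` carrier (valuation_ring R v K)"
    unfolding residue_field_def FactRing_def A_RCOSETS_def RCOSETS_def a_r_coset_def by auto
  then have "\<exists>x. (x \<in> K \<and> v x \<le> 1) \<and> y = residue x" if "y \<in> set p" for y
    using assms that unfolding valuation_ring_def by auto
  then obtain f where f: "\<And>y. y \<in> set p \<Longrightarrow> (f y \<in> K \<and> v (f y) \<le> 1) \<and> y = residue (f y)" by metis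
  show ?thesis
    by (rule that[of "map f p"]) (use f in \<open>auto simp: map_idI[symmetric] intro!: map_idI[symmetric]\<close>)
qed

text \<open>The residue of the value at \<open>c\<close> depends only on the reduction of the polynomial. Both lists are padded
with leading zeros to a common length, where equal reductions mean coefficientwise congruence.\<close>

lemma eval_cong_residue:
  assumes A: "set A \<subseteq> {x \<in> K. v x \<le> 1}" and B: "set B \<subseteq> {x \<in> K. v x \<le> 1}"
    and eq: "ring.normalize (residue_field R v K) (map residue A) =
      ring.normalize (residue_field R v K) (map residue B)" (is "?N = _")
    and c: "c \<in> carrier R" "v c \<le> 1"
  shows "v (eval A c \<ominus> eval B c) < 1"
proof -
  note Kc = subfield_closed[OF K]
  interpret H: ring_hom_ring "valuation_ring R v K" "residue_field R v K" residue by (rule residue_hom)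
  have AB: "set A \<subseteq> carrier R" "set B \<subseteq> carrier R" using A B Kc(1) by auto
  let ?z = "\<zero>\<^bsub>residue_field R v K\<^esub>"
  have diff: "v (eval P c \<ominus> eval Q c) < 1"
    if "length P = length Q" "set P \<subseteq> {x \<in> K. v x \<le> 1}" "set Q \<subseteq> {x \<in> K. v x \<le> 1}" 
      "map residue P = map residue Q" for P Q
    using that
  proof (induction P Q rule: list_induct2)
    case Nil
    then show ?case by (simp add: minus_eq)
  next
    case (Cons a P b Q)
    have ab: "a \<in> carrier R" "b \<in> carrier R" "set P \<subseteq> carrier R" "set Q \<subseteq> carrier R"
      using Cons.prems Kc(1) by auto
    then have e: "eval P c \<in> carrier R" "eval Q c \<in> carrier R" "c [^] length Q \<in> carrier R"
      using eval_in_carrier c by auto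
    have "v (a \<ominus> b) < 1" using Cons.prems residue_eq_iff[of a b] by simp
    then have "v ((a \<ominus> b) \<otimes> c [^] length Q) < 1"
      using ab c by (intro abs_mult_less1(2)) (auto simp: abs_pow power_le_one abs_nonneg)
    moreover have "v (eval P c \<ominus> eval Q c) < 1" using Cons by simp
    moreover have "eval (a # P) c \<ominus> eval (b # Q) c =
        (a \<ominus> b) \<otimes> c [^] length Q \<oplus> (eval P c \<ominus> eval Q c)"
    proof -
      have "a \<otimes> y \<oplus> p \<ominus> (b \<otimes> y \<oplus> q) = (a \<ominus> b) \<otimes> y \<oplus> (p \<ominus> q)"
        if "y \<in> carrier R" "p \<in> carrier R" "q \<in> carrier R" for y p q
        using that ab(1,2) by algebra
      then show ?thesis using e Cons.hyps by simp
    qed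
    ultimately show ?case using ab e by (simp add: abs_add_less)
  qed
  have pad: "map residue (replicate n \<zero> @ P) = replicate (n + length P - length N) ?z @ N"
    if "set P \<subseteq> {x \<in> K. v x \<le> 1}" "N = ring.normalize (residue_field R v K) (map residue P)" for n P N
  proof -
    have "residue \<zero> = ?z" using residue_zero_iff[OF Kc(7)] by simp
    moreover have "length N \<le> length P"
      using H.S.normalize_length_le[of "map residue P"] that(2) by simp
    moreover have "map residue P = replicate (length P - length N) ?z @ N"
      using H.S.normalize_trick[of "map residue P"] that(2) by simp
    ultimately show ?thesis by (simp add: replicate_add[symmetric] flip: append_assoc)
  qed
  have "v (eval (replicate (length B) \<zero> @ A) c \<ominus> eval (replicate (length A) \<zero> @ B) c) < 1"
  proof (rule diff)
    show "map residue (replicate (length B) \<zero> @ A) = map residue (replicate (length A) \<zero> @ B)"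
      unfolding pad[OF A refl] pad[OF B eq] by (simp add: add.commute)
  qed (use A B Kc(7) in auto)
  then show ?thesis using eval_replicate AB c(1) by simp
qed

text \<open>The reduction of a minimal residual polynomial is irreducible: if it had two nonconstant factors, the
lift of one of them would be small at \<open>c\<close>, hence residual, but too short. If the derivative were
small at \<open>c\<close>, then by minimality of
the degree all its coefficients would be small, so the reduction would have derivative 0. A perfect
field has no irreducible polynomial of this kind, because it would be a common divisor of itself and
its derivative.\<close>

lemma perfect_residue_separable:
  assumes perfect: "perfect_field (residue_field R v K)"
    and c: "c \<in> carrier R" "v c \<le> 1" and g: "min_residual_poly K c g"
  shows "v (eval (deriv (\<one> # g)) c) = 1"
proof (rule ccontr)
  assume ne: "\<not> ?thesis"
  note Kc = subfield_closed[OF K]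
  let ?O = "valuation_ring R v K" and ?k = "residue_field R v K" and ?G = "\<one> # g"
  let ?h = "map residue ?G"
  interpret k: field ?k using perfect unfolding perfect_field_def by blast
  interpret H: ring_hom_ring ?O ?k residue by (rule residue_hom)
  have Oc: "carrier ?O = {x \<in> K. v x \<le> 1}" by (simp add: valuation_ring_def)
  have G: "set ?G \<subseteq> {x \<in> K. v x \<le> 1}" "v (eval ?G c) < 1"
    using g unfolding min_residual_poly_def residual_poly_def by auto
  then have Gc: "set ?G \<subseteq> carrier R" using Kc(1) by auto
  have "v (eval (deriv ?G) c) \<le> 1"
    using G(1) Gc by (intro eval_ball c deriv_carrier deriv_ball) auto
  with ne have small: "v (eval (deriv ?G) c) < 1" by simp
  have dK: "set (deriv ?G) \<subseteq> K" "\<forall>a\<in>set (deriv ?G). v a \<le> 1"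
  proof -
    show "set (deriv ?G) \<subseteq> K" using G(1) Kc(10) by (intro deriv_closed) auto
    show "\<forall>a\<in>set (deriv ?G). v a \<le> 1" using G(1) by (intro deriv_ball[OF Gc]) auto
  qed
  then have d0: "\<forall>a\<in>set (deriv ?G). v a < 1"
    using min_residual_poly_small[OF g dK _ small] by simp
  have "residue a = \<zero>\<^bsub>?k\<^esub>" if "a \<in> set (deriv ?G)" for a
    using that d0 dK residue_zero_iff[of a] by blast
  then have "set (map residue (deriv ?G)) \<subseteq> {\<zero>\<^bsub>?k\<^esub>}" unfolding set_map by blast
  moreover have "k.deriv ?h = map residue (deriv ?G)"
    using H.deriv_hom[of ?G] G(1) Oc deriv_consistent[OF valuation_ring_subring]
    by (simp add: valuation_ring_def)
  ultimately have der: "formal_derivative ?k ?h = []"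
    using k.formal_derivative_eq[of ?h] k.normalize_zeros by simp
  have h1: "residue \<one> = \<one>\<^bsub>?k\<^esub>" using H.hom_one by (simp add: valuation_ring_def)
  have hset: "set ?h \<subseteq> carrier ?k" using H.hom_closed G(1) Oc by auto
  then have hpoly: "?h \<in> carrier (poly_ring ?k)"
    unfolding univ_poly_carrier[symmetric] polynomial_def by (simp add: h1)
  have irr: "pirreducible\<^bsub>?k\<^esub> (carrier ?k) ?h"
  proof (rule k.pirreducibleI[OF k.carrier_is_subring hpoly])
    show "?h \<noteq> []" by simp
    show "?h \<notin> Units (poly_ring ?k)"
    proof
      assume "?h \<in> Units (poly_ring ?k)"
      then have "g = []" unfolding k.univ_poly_carrier_units by auto
      then show False using G(2) by simp
    qed
    fix p q
    assume p: "p \<in> carrier (poly_ring ?k)" and q: "q \<in> carrier (poly_ring ?k)"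
      and hpq: "?h = p \<otimes>\<^bsub>poly_ring ?k\<^esub> q"
    have pq: "polynomial\<^bsub>?k\<^esub> (carrier ?k) p" "polynomial\<^bsub>?k\<^esub> (carrier ?k) q"
      using p q univ_poly_carrier by blast+
    have mult: "?h = k.poly_mult p q" using hpq by (simp add: univ_poly_mult)
    have ne: "p \<noteq> []" "q \<noteq> []" 
      using mult k.poly_mult_zero[OF k.polynomial_incl[OF pq(2)]] k.poly_mult_zero[OF k.polynomial_incl[OF pq(1)]]
      by auto
    have deg: "length g = (length p - 1) + (length q - 1)"
      using k.poly_mult_degree_eq[OF k.carrier_is_subring pq] mult ne by (metis diff_Suc_1 length_Cons length_map)
    obtain P where P: "set P \<subseteq> {x \<in> K. v x \<le> 1}" "p = map residue P"
      using residue_lift k.polynomial_incl[OF pq(1)] by blast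
    obtain Q where Q: "set Q \<subseteq> {x \<in> K. v x \<le> 1}" "q = map residue Q"
      using residue_lift k.polynomial_incl[OF pq(2)] by blast
    have PQc: "set P \<subseteq> carrier R" "set Q \<subseteq> carrier R" using P Q Kc(1) by auto
    have PQO: "set P \<subseteq> carrier ?O" "set Q \<subseteq> carrier ?O" using P Q Oc by auto
    have cons: "H.R.poly_mult P Q = poly_mult P Q"
      unfolding valuation_ring_def poly_mult_consistent[OF valuation_ring_subring] ..
    have PQset: "set (poly_mult P Q) \<subseteq> {x \<in> K. v x \<le> 1}"
      using H.R.poly_mult_in_carrier[OF PQO] unfolding cons Oc .
    have "k.normalize (map residue (poly_mult P Q)) = ?h"
      using H.poly_mult_hom'[OF PQO] unfolding cons mult P(2) Q(2) .
    also have "\<dots> = k.normalize ?h"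
      using k.normalize_polynomial hpoly univ_poly_carrier by metis
    finally have "v (eval (poly_mult P Q) c \<ominus> eval ?G c) < 1"
      by (rule eval_cong_residue[OF PQset G(1) _ c])
    then have "v (eval (poly_mult P Q) c \<ominus> \<zero>) < 1"
      using abs_minus_trans[OF _ _ zero_closed, of "eval (poly_mult P Q) c" "eval ?G c" 1] G(2)
        eval_in_carrier[OF Gc c(1)] eval_in_carrier[OF poly_mult_in_carrier[OF PQc] c(1)] by (simp add: minus_eq)
    then have "v (eval P c \<otimes> eval Q c) < 1"
      using eval_poly_mult[OF PQc c(1)] eval_in_carrier[OF PQc(1) c(1)] eval_in_carrier[OF PQc(2) c(1)] by (simp add: minus_eq)
    moreover have e: "eval P c \<in> carrier R" "eval Q c \<in> carrier R" "v (eval P c) \<le> 1" "v (eval Q c) \<le> 1"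
      using eval_in_carrier[OF _ c(1)] PQc eval_ball[OF PQc(1) _ c] eval_ball[OF PQc(2) _ c] P(1) Q(1)
      by blast+
    ultimately have "v (eval P c) < 1 \<or> v (eval Q c) < 1"
      by (cases "v (eval P c) = 1") (auto simp: abs_mult)
    moreover have long: "length g < length S"
      if "set S \<subseteq> {x \<in> K. v x \<le> 1}" "s = map residue S" "polynomial\<^bsub>?k\<^esub> (carrier ?k) s" "s \<noteq> []" "v (eval S c) < 1" for s S
    proof -
      have "S \<noteq> []" using that(2,4) by auto
      then obtain a S' where S: "S = a # S'" by (cases S) auto
      then have "residue a \<noteq> \<zero>\<^bsub>?k\<^esub>" using that(2,3) k.lead_coeff_not_zero by auto
      then have "v a = 1" using residue_zero_iff[of a] that(1) S by auto
      then have "residual_poly K c S" using that(1,5) S unfolding residual_poly_def by auto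
      then show ?thesis using g unfolding min_residual_poly_def by blast
    qed
    ultimately have "length g < length p \<or> length g < length q"
      using long[OF P pq(1) ne(1)] long[OF Q pq(2) ne(2)] P(2) Q(2) by auto
    then have "length q - 1 = 0 \<or> length p - 1 = 0" using deg ne by (cases p; cases q) auto
    then show "p \<in> Units (poly_ring ?k) \<or> q \<in> Units (poly_ring ?k)"
      using k.univ_poly_units'[OF k.carrier_is_subfield] p q ne by blast
  qed
  have "separable_poly ?k (carrier ?k) ?h"
    using perfect irr hpoly unfolding perfect_field_def by blast
  then have gcd: "isgcd (poly_ring ?k) \<one>\<^bsub>poly_ring ?k\<^esub> ?h []"
    unfolding separable_poly_def der .
  interpret UP: domain "poly_ring ?k" by (rule k.univ_poly_is_domain[OF k.carrier_is_subring])
  have "?h divides\<^bsub>poly_ring ?k\<^esub> []"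
    using UP.divides_zero[OF hpoly] by (simp add: univ_poly_zero)
  moreover have "?h divides\<^bsub>poly_ring ?k\<^esub> ?h" using UP.divides_refl[OF hpoly] .
  ultimately have "?h divides\<^bsub>poly_ring ?k\<^esub> \<one>\<^bsub>poly_ring ?k\<^esub>"
    using gcd hpoly unfolding isgcd_def by blast
  then have "?h \<in> Units (poly_ring ?k)"
    using UP.divides_unit[OF _ hpoly UP.Units_one_closed] by blast
  then show False using k.pirreducibleE(2)[OF k.carrier_is_subring hpoly irr] by blast
qed

end

end

section \<open>Indices of value groups\<close>

definition pos_subgroup :: "real set \<Rightarrow> bool" where
  "pos_subgroup H \<longleftrightarrow> (\<forall>x\<in>H. 0 < x) \<and> 1 \<in> H \<and> (\<forall>x\<in>H. \<forall>y\<in>H. x * y \<in> H) \<and> (\<forall>x\<in>H. inverse x \<in> H)"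

text \<open>Cosets are counted as sets of reals. They do not depend on the group in which they are formed, so
indices in different groups can be compared without passing to quotient groups.\<close>

definition coset_index :: "real set \<Rightarrow> real set \<Rightarrow> nat" where
  "coset_index H C = card ((\<lambda>x. (\<lambda>c. c * x) ` C) ` H)"

lemma rcosets_real_mult_group:
  "rcosets\<^bsub>real_mult_group\<lparr>carrier := H\<rparr>\<^esub> C = (\<lambda>x. (\<lambda>c. c * x) ` C) ` H"
  by (auto simp: RCOSETS_def r_coset_def real_mult_group_def)

lemma ramification_index_eq: "ramification_index F v U V = coset_index (value_group F v U) (value_group F v V)"
  by (simp add: ramification_index_def coset_index_def rcosets_real_mult_group)

lemma pos_subgroup_pow: "\<lbrakk>pos_subgroup H; x \<in> H\<rbrakk> \<Longrightarrow> x ^ n \<in> H"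
  by (induction n) (auto simp: pos_subgroup_def)

lemma pos_subgroup_power_int: "\<lbrakk>pos_subgroup H; x \<in> H\<rbrakk> \<Longrightarrow> x powi k \<in> H"
  using pos_subgroup_pow[of H x "nat k"] pos_subgroup_pow[of H "inverse x" "nat (- k)"]
  by (auto simp: power_int_def pos_subgroup_def)

lemma coset_eq_iff:
  assumes C: "pos_subgroup C" and "0 < x" "0 < y"
  shows "(\<lambda>c. c * x) ` C = (\<lambda>c. c * y) ` C \<longleftrightarrow> (\<exists>c\<in>C. x = c * y)"
proof
  assume "(\<lambda>c. c * x) ` C = (\<lambda>c. c * y) ` C"
  moreover have "1 * x \<in> (\<lambda>c. c * x) ` C" using C unfolding pos_subgroup_def by blast
  ultimately show "\<exists>c\<in>C. x = c * y" by auto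
next
  assume "\<exists>c\<in>C. x = c * y"
  then obtain c where c: "c \<in> C" "x = c * y" by blast
  have "0 < c" using C c(1) unfolding pos_subgroup_def by blast
  have "a * x = (a * c) * y" "a * y = (a * inverse c) * x" for a
    using \<open>0 < c\<close> by (simp_all add: c(2))
  moreover have "a * c \<in> C" "a * inverse c \<in> C" if "a \<in> C" for a
    using C c(1) that unfolding pos_subgroup_def by blast+
  ultimately show "(\<lambda>c. c * x) ` C = (\<lambda>c. c * y) ` C" by (metis (no_types, lifting) image_cong image_subset_iff image_eqI subset_antisym)
qed

text \<open>Lagrange's theorem in the quotient of \<open>H\<close> by \<open>C\<close>.\<close>

lemma pow_index_mem:
  assumes H: "pos_subgroup H" and C: "pos_subgroup C" "C \<subseteq> H" and "0 < coset_index H C" and x: "x \<in> H"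
  shows "x ^ coset_index H C \<in> C"
proof -
  let ?G = "real_mult_group\<lparr>carrier := H\<rparr>"
  have G: "comm_group ?G"
  proof (rule comm_groupI)
    show "\<exists>y\<in>carrier ?G. y \<otimes>\<^bsub>?G\<^esub> x = \<one>\<^bsub>?G\<^esub>" if "x \<in> carrier ?G" for x
      using H that by (intro bexI[of _ "inverse x"]) (auto simp: real_mult_group_def pos_subgroup_def)
  qed (use H in \<open>auto simp: real_mult_group_def pos_subgroup_def\<close>)
  interpret G: comm_group ?G by (rule G)
  have inv: "inv\<^bsub>?G\<^esub> x = inverse x" if "x \<in> H" for x
    using H that by (intro G.inv_equality) (auto simp: real_mult_group_def pos_subgroup_def)
  have "subgroup C ?G"
    using C H inv by (intro G.subgroupI) (auto simp: real_mult_group_def pos_subgroup_def subset_iff)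
  then interpret N: normal C ?G using G.normal_iff_subgroup by blast
  interpret Q: group "?G Mod C" by (rule N.factorgroup_is_group)
  have carrier: "carrier (?G Mod C) = (\<lambda>x. (\<lambda>c. c * x) ` C) ` H"
    by (simp add: FactGroup_def rcosets_real_mult_group)
  have "finite (carrier (?G Mod C))" "order (?G Mod C) = coset_index H C"
    using assms(4) unfolding carrier coset_index_def order_def by (auto intro: card_ge_0_finite)
  moreover have "C #>\<^bsub>?G\<^esub> x \<in> carrier (?G Mod C)" using x by (simp add: carrier_FactGroup)
  ultimately have "(C #>\<^bsub>?G\<^esub> x) [^]\<^bsub>?G Mod C\<^esub> coset_index H C = C"
    using Q.pow_order_eq_1[of "C #>\<^bsub>?G\<^esub> x"] by simp
  then have "C #>\<^bsub>?G\<^esub> (x [^]\<^bsub>?G\<^esub> coset_index H C) = C" using N.FactGroup_pow[of x "coset_index H C"] x by simp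
  moreover have "x [^]\<^bsub>?G\<^esub> n = x ^ n" for n :: nat
    by (induction n) (simp_all add: real_mult_group_def nat_pow_def)
  moreover have "\<one>\<^bsub>?G\<^esub> \<otimes>\<^bsub>?G\<^esub> y \<in> C #>\<^bsub>?G\<^esub> y" for y
    using N.one_closed unfolding r_coset_def by blast
  ultimately show ?thesis by (metis real_mult_group_def mult_1 monoid.simps(1,2) partial_object.update_convs(1))
qed

lemma discrete_gap:
  assumes C: "pos_subgroup C" and "discrete C"
  obtains \<theta> where "0 < \<theta>" "\<theta> < 1" "\<And>c. \<lbrakk>c \<in> C; c < 1\<rbrakk> \<Longrightarrow> c \<le> \<theta>"
proof -
  have "1 isolated_in C" using assms unfolding pos_subgroup_def by (blast dest: discreteD)
  then obtain e where e: "0 < e" "\<And>y. \<lbrakk>y \<in> C; dist 1 y < e\<rbrakk> \<Longrightarrow> y = 1"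
    unfolding isolated_in_dist_Ex_iff by blast
  show ?thesis
  proof (rule that[of "max (1/2) (1 - e)"])
    fix c assume "c \<in> C" "c < 1"
    then have "\<not> dist 1 c < e" using e(2) by blast
    then show "c \<le> max (1/2) (1 - e)" using \<open>c < 1\<close> by (auto simp: dist_real_def)
  qed (use e(1) in auto)
qed

text \<open>The gap below 1 in \<open>C\<close> is inherited by groups of exponent \<open>n\<close> over \<open>C\<close>, by taking \<open>n\<close>-th roots.\<close>

lemma discrete_gap_finite_index:
  assumes C: "pos_subgroup C" "discrete C" and n: "0 < n" and H: "\<And>x. x \<in> H \<Longrightarrow> 0 < x \<and> x ^ n \<in> C"
  obtains \<theta> where "0 < \<theta>" "\<theta> < 1" "\<And>x. \<lbrakk>x \<in> H; x < 1\<rbrakk> \<Longrightarrow> x \<le> \<theta>"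
proof -
  obtain t where t: "0 < t" "t < 1" "\<And>c. \<lbrakk>c \<in> C; c < 1\<rbrakk> \<Longrightarrow> c \<le> t"
    using discrete_gap[OF C] by blast
  show ?thesis
  proof (rule that)
    show "0 < root n t" "root n t < 1" using t n by auto
    fix x assume x: "x \<in> H" "x < 1"
    have "x ^ n < 1" using H[OF x(1)] x(2) n power_strict_mono[of x 1 n] by simp
    then have "x ^ n \<le> t" using t(3) H[OF x(1)] by blast
    then have "root n (x ^ n) \<le> root n t" using n by simp
    then show "x \<le> root n t" using H[OF x(1)] n by (simp add: real_root_power_cancel)
  qed
qed

text \<open>The generator is the infimum \<open>\<rho>\<close> of the elements above 1. It is attained: otherwise two elements of \<open>C\<close>
close to \<open>\<rho>\<close> would have a quotient inside the gap around 1.\<close>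

lemma discrete_subgroup_cyclic:
  assumes C: "pos_subgroup C" "discrete C" and ne: "C \<noteq> {1}"
  obtains \<rho> where "1 < \<rho>" "C = range (\<lambda>k::int. \<rho> powr real_of_int k)"
proof -
  note Cp = C(1)[unfolded pos_subgroup_def]
  obtain \<theta> where \<theta>: "0 < \<theta>" "\<theta> < 1" "\<And>c. \<lbrakk>c \<in> C; c < 1\<rbrakk> \<Longrightarrow> c \<le> \<theta>"
    using discrete_gap[OF C] by blast
  have gap: "1 / \<theta> \<le> c" if "c \<in> C" "1 < c" for c
  proof -
    have "inverse c < 1" using that(2) by (simp add: inverse_less_1_iff)
    then have "inverse c \<le> \<theta>" using \<theta>(3) Cp that by blast
    then show ?thesis using \<theta>(1) that(2) by (simp add: field_simps)
  qed
  let ?S = "{c \<in> C. 1 < c}"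
  obtain c where c: "c \<in> C" "c \<noteq> 1" using ne Cp by blast
  have "0 < c" using c Cp by blast
  have "c \<in> ?S \<or> inverse c \<in> ?S"
    using c Cp \<open>0 < c\<close> by (auto simp: one_less_inverse_iff)
  then have S: "?S \<noteq> {}" by blast
  have bdd: "bdd_below ?S" by (rule bdd_belowI[of _ 1]) auto
  define \<rho> where "\<rho> = Inf ?S"
  have low: "\<rho> \<le> c" if "c \<in> ?S" for c unfolding \<rho>_def using cInf_lower[OF that bdd] .
  have g1: "1 < 1 / \<theta>" using \<theta> by simp
  have "1 / \<theta> \<le> \<rho>" unfolding \<rho>_def using cInf_greatest[OF S] gap by blast
  then have \<rho>1: "1 < \<rho>" using g1 by linarith
  have \<rho>C: "\<rho> \<in> C"
  proof (rule ccontr)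
    assume notin: "\<rho> \<notin> C"
    have "\<rho> < \<rho> * (1 / \<theta>)" using mult_strict_left_mono[OF g1, of \<rho>] \<rho>1 by simp
    then obtain c where c: "c \<in> ?S" "c < \<rho> * (1 / \<theta>)"
      using cInf_lessD[OF S] unfolding \<rho>_def by blast
    then have "\<rho> < c" using low[OF c(1)] notin by (cases "c = \<rho>") auto
    then obtain c' where c': "c' \<in> ?S" "c' < c" using cInf_lessD[OF S] unfolding \<rho>_def by blast
    have "c * inverse c' \<in> C" using Cp c(1) c'(1) by blast
    moreover have "1 < c * inverse c'" using c'(1,2) by (simp add: field_simps)
    ultimately have "1 / \<theta> \<le> c * inverse c'" by (rule gap)
    moreover have "c * inverse c' < 1 / \<theta>"
    proof -
      have "c < c' * (1 / \<theta>)" 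
        using c(2) low[OF c'(1)] g1 by (meson less_le_trans mult_right_mono less_imp_le zero_less_one order_trans)
      then show ?thesis using c'(1) by (simp add: field_simps)
    qed
    ultimately show False by simp
  qed
  have pw: "\<rho> powr real_of_int k \<in> C" for k
    using pos_subgroup_power_int[OF C(1) \<rho>C] \<rho>1 powr_real_of_int'[of \<rho> k] by simp
  have "x \<in> range (\<lambda>k::int. \<rho> powr real_of_int k)" if x: "x \<in> C" for x
  proof -
    have x0: "0 < x" using x Cp by blast
    define k where "k = \<lfloor>log \<rho> x\<rfloor>"
    define y where "y = x * \<rho> powr real_of_int (- k)"
    have yC: "y \<in> C" unfolding y_def using x pw Cp by blast
    have y: "y = \<rho> powr (log \<rho> x - k)"
      using x0 \<rho>1 by (simp add: y_def powr_diff powr_minus_divide)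
    have "0 \<le> log \<rho> x - k" "log \<rho> x - k < 1" unfolding k_def by linarith+
    then have "1 \<le> y" "y < \<rho>"
      unfolding y using \<rho>1 powr_less_mono[of "log \<rho> x - k" 1 \<rho>] by (auto intro: ge_one_powr_ge_zero)
    then have "y = 1" using low[of y] yC by fastforce
    then have "x = \<rho> powr real_of_int k"
      using \<rho>1 by (simp add: y_def powr_minus_divide)
    then show ?thesis by blast
  qed
  then have "C = range (\<lambda>k::int. \<rho> powr real_of_int k)" using pw by blast
  then show ?thesis using that \<rho>1 by blast
qed

lemma powr_frac_mem_iff:
  assumes "1 < \<rho>" "C = range (\<lambda>k::int. \<rho> powr real_of_int k)" "0 < e"
  shows "0 < x \<and> x ^ e \<in> C \<longleftrightarrow> (\<exists>k::int. x = \<rho> powr (real_of_int k / real e))"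
proof
  assume "0 < x \<and> x ^ e \<in> C"
  then obtain k :: int where x: "0 < x" "x ^ e = \<rho> powr real_of_int k" using assms(2) by auto
  have "x = (x powr e) powr (1 / e)" using x(1) assms(3) by (simp add: powr_powr)
  also have "\<dots> = \<rho> powr (real_of_int k / real e)"
    using x by (simp add: powr_realpow powr_powr)
  finally show "\<exists>k::int. x = \<rho> powr (real_of_int k / real e)" by blast
next
  assume "\<exists>k::int. x = \<rho> powr (real_of_int k / real e)"
  then obtain k :: int where x: "x = \<rho> powr (real_of_int k / real e)" by blast
  have "x ^ e = \<rho> powr real_of_int k"
    unfolding x using assms(1,3) by (simp add: powr_powr flip: powr_realpow)
  then show "0 < x \<and> x ^ e \<in> C" using x assms(1,2) by auto
qed

text \<open>The \<open>e\<close>-th roots of elements of \<open>C\<close> are the powers of \<open>\<rho>\<close> with exponents \<open>k/e\<close>, and the coset of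
such a power is determined by \<open>k\<close> modulo \<open>e\<close>.\<close>

lemma index_powr_frac:
  assumes \<rho>: "1 < \<rho>" "C = range (\<lambda>k::int. \<rho> powr real_of_int k)" and C: "pos_subgroup C" and e: "0 < e"
  shows "coset_index {x. 0 < x \<and> x ^ e \<in> C} C = e"
proof -
  let ?f = "\<lambda>k::int. \<rho> powr (real_of_int k / real e)"
  let ?coset = "\<lambda>x. (\<lambda>c. c * x) ` C"
  have H: "{x. 0 < x \<and> x ^ e \<in> C} = range ?f" using powr_frac_mem_iff[OF \<rho> e] by auto
  have eq: "?coset (?f i) = ?coset (?f j) \<longleftrightarrow> int e dvd i - j" for i j
  proof -
    have "?coset (?f i) = ?coset (?f j) \<longleftrightarrow> (\<exists>k::int. ?f i = \<rho> powr k * ?f j)"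
      using coset_eq_iff[OF C, of "?f i" "?f j"] \<rho> by auto
    also have "\<dots> \<longleftrightarrow> (\<exists>k::int. real_of_int i / e = k + real_of_int j / e)"
      using \<rho>(1) by (simp add: powr_inj flip: powr_add)
    also have "\<dots> \<longleftrightarrow> (\<exists>k. i = int e * k + j)"
    proof (intro ex_cong1)
      fix k :: int
      have "real_of_int i / e = k + real_of_int j / e \<longleftrightarrow> real_of_int i = real_of_int (int e * k + j)"
        using e by (simp add: field_simps)
      then show "real_of_int i / e = k + real_of_int j / e \<longleftrightarrow> i = int e * k + j"
        by (simp only: of_int_eq_iff)
    qed
    also have "\<dots> \<longleftrightarrow> int e dvd i - j" by (auto simp: dvd_def algebra_simps)
    finally show ?thesis .
  qed
  have "?coset ` range ?f = (\<lambda>k. ?coset (?f k)) ` {0..<int e}"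
  proof -
    have mod: "?coset (?f k) \<in> (\<lambda>k. ?coset (?f k)) ` {0..<int e}" for k
    proof (rule image_eqI)
      show "?coset (?f k) = ?coset (?f (k mod int e))"
        unfolding eq by (simp add: minus_mod_eq_mult_div)
      show "k mod int e \<in> {0..<int e}" using e by simp
    qed
    have "?coset ` range ?f = range (\<lambda>k. ?coset (?f k))" by (rule image_image)
    also have "\<dots> = (\<lambda>k. ?coset (?f k)) ` {0..<int e}"
    proof (rule subset_antisym)
      show "range (\<lambda>k. ?coset (?f k)) \<subseteq> (\<lambda>k. ?coset (?f k)) ` {0..<int e}"
        by (rule image_subsetI) (rule mod)
      show "(\<lambda>k. ?coset (?f k)) ` {0..<int e} \<subseteq> range (\<lambda>k. ?coset (?f k))"
        by (rule image_mono) simp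
    qed
    finally show ?thesis .
  qed
  moreover have "inj_on (\<lambda>k. ?coset (?f k)) {0..<int e}"
  proof (rule inj_onI)
    fix i j assume ij: "i \<in> {0..<int e}" "j \<in> {0..<int e}" "?coset (?f i) = ?coset (?f j)"
    then have "i mod int e = j mod int e" using iffD1[OF eq ij(3)] by (simp only: mod_eq_dvd_iff)
    then show "i = j" using ij by simp
  qed
  ultimately show ?thesis unfolding coset_index_def H by (simp add: card_image)
qed

text \<open>An overgroup of a cyclic group is determined by its index \<open>e\<close>: by Lagrange it consists of \<open>e\<close>-th roots
of elements of \<open>C\<close>, and the group of all these roots has no more cosets than \<open>H\<close>.\<close>

lemma finite_index_eq:
  assumes \<rho>: "1 < \<rho>" "C = range (\<lambda>k::int. \<rho> powr real_of_int k)"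
    and H: "pos_subgroup H" and C: "pos_subgroup C" "C \<subseteq> H" and pos: "0 < coset_index H C"
  shows "H = {x. 0 < x \<and> x ^ coset_index H C \<in> C}" (is "H = ?R")
proof -
  let ?coset = "\<lambda>x. (\<lambda>c. c * x) ` C"
  have sub: "H \<subseteq> ?R" using pow_index_mem[OF H C pos] H unfolding pos_subgroup_def by blast
  have card: "card (?coset ` ?R) = card (?coset ` H)"
    using index_powr_frac[OF \<rho> C(1) pos] unfolding coset_index_def .
  have "finite (?coset ` ?R)"
    using pos card unfolding coset_index_def by (intro card_ge_0_finite) simp
  then have eq: "?coset ` H = ?coset ` ?R"
    using card sub by (intro card_subset_eq) auto
  have "x \<in> H" if x: "x \<in> ?R" for x
  proof -
    obtain y where y: "y \<in> H" "?coset x = ?coset y" using eq x by blast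
    have "0 < y" using y(1) H unfolding pos_subgroup_def by blast
    then obtain c where "c \<in> C" "x = c * y" using coset_eq_iff[OF C(1), of x y] x y(2) by blast
    then show ?thesis using y(1) C(2) H unfolding pos_subgroup_def by blast
  qed
  then show ?thesis using sub by blast
qed

text \<open>If \<open>C\<close> is generated by \<open>\<rho>\<close>, then \<open>A\<close> and \<open>B\<close> correspond to the exponents with denominators \<open>a\<close> and \<open>b\<close>,
and by Bezout's identity the sums of such exponents are those with denominator \<open>lcm a b\<close>. A trivial
\<open>C\<close> has to be treated separately; then all groups are trivial.\<close>

lemma index_product_lcm:
  assumes C: "pos_subgroup C" "discrete C" 
    and A: "pos_subgroup A" "C \<subseteq> A" and B: "pos_subgroup B" "C \<subseteq> B" and H: "pos_subgroup H" 
    and prod: "H = {a * b | a b. a \<in> A \<and> b \<in> B}"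
    and fin: "0 < coset_index A C" "0 < coset_index B C"
  shows "coset_index H C = lcm (coset_index A C) (coset_index B C)"
proof (cases "C = {1}")
  case True
  have triv: "D = {1}" if D: "pos_subgroup D" "C \<subseteq> D" "0 < coset_index D C" for D
  proof -
    have "x = 1" if "x \<in> D" for x
    proof -
      have "x ^ coset_index D C = 1" using pow_index_mem[OF D(1) C(1) D(2,3) that] True by simp
      moreover have "0 < x" using D(1) that unfolding pos_subgroup_def by blast
      ultimately show ?thesis using power_eq_1_iff[of x "coset_index D C"] D(3) by auto
    qed
    then show ?thesis using D(1) unfolding pos_subgroup_def by blast
  qed
  have "A = {1}" "B = {1}" using triv A B fin by blast+
  then show ?thesis using True unfolding prod by (simp add: coset_index_def)
next
  case False
  obtain \<rho> where \<rho>: "1 < \<rho>" "C = range (\<lambda>k::int. \<rho> powr real_of_int k)"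
    using discrete_subgroup_cyclic[OF C False] by blast
  define a where "a = coset_index A C"
  define b where "b = coset_index B C"
  define l where "l = lcm a b"
  have pos: "0 < a" "0 < b" "0 < l" using fin by (auto simp: a_def b_def l_def intro: lcm_pos_nat)
  have AR: "A = {x. 0 < x \<and> x ^ a \<in> C}" and BR: "B = {x. 0 < x \<and> x ^ b \<in> C}"
    unfolding a_def b_def using finite_index_eq[OF \<rho>] A B C fin by blast+
  have "H = {x. 0 < x \<and> x ^ l \<in> C}"
  proof (intro Set.set_eqI iffI)
    fix x assume "x \<in> H"
    then obtain y z where yz: "x = y * z" "y \<in> A" "z \<in> B" unfolding prod by blast
    obtain k m where km: "l = a * k" "l = b * m" unfolding l_def by (meson dvd_def dvd_lcm1 dvd_lcm2)
    have "y ^ l = (y ^ a) ^ k" unfolding km(1) power_mult ..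
    moreover have "z ^ l = (z ^ b) ^ m" unfolding km(2) power_mult ..
    ultimately have "y ^ l \<in> C" "z ^ l \<in> C"
      using yz(2,3) pos_subgroup_pow[OF C(1), of "y ^ a" k] pos_subgroup_pow[OF C(1), of "z ^ b" m]
      unfolding AR BR by auto
    then have "x ^ l \<in> C" using C(1) unfolding yz(1) pos_subgroup_def by (simp add: power_mult_distrib)
    moreover have "0 < x" using \<open>x \<in> H\<close> H unfolding pos_subgroup_def by blast
    ultimately show "x \<in> {x. 0 < x \<and> x ^ l \<in> C}" by blast
  next
    fix x assume "x \<in> {x. 0 < x \<and> x ^ l \<in> C}"
    then obtain k :: int where x: "x = \<rho> powr (real_of_int k / real l)"
      using powr_frac_mem_iff[OF \<rho> pos(3)] by blast
    obtain s t where st: "s * int a + t * int b = int (gcd a b)"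
      using bezout_int[of "int a" "int b"] by auto
    have "real_of_int k / real l = real_of_int (k * t) / real a + real_of_int (k * s) / real b"
    proof -
      have "real (gcd a b) * real l = real a * real b"
        unfolding l_def by (metis of_nat_mult prod_gcd_lcm_nat)
      moreover have g: "real_of_int s * real a + real_of_int t * real b = real (gcd a b)"
        using arg_cong[OF st, of real_of_int] by simp
      moreover have "0 < gcd a b" using pos by simp
      ultimately have "1 / real l = (real_of_int s * real a + real_of_int t * real b) / (real a * real b)"
        using pos by (simp add: field_simps)
      also have "\<dots> = real_of_int t / real a + real_of_int s / real b"
        using pos by (simp add: field_simps)
      finally have "real_of_int k * (1 / real l) = real_of_int k * (real_of_int t / real a + real_of_int s / real b)"
        by simp
      then show ?thesis by (simp add: distrib_left)
    qed
    then have "x = \<rho> powr (real_of_int (k * t) / real a) * \<rho> powr (real_of_int (k * s) / real b)"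
      unfolding x by (simp add: powr_add)
    moreover have "\<rho> powr (real_of_int (k * t) / real a) \<in> A" "\<rho> powr (real_of_int (k * s) / real b) \<in> B"
      unfolding AR BR mem_Collect_eq powr_frac_mem_iff[OF \<rho> pos(1)] powr_frac_mem_iff[OF \<rho> pos(2)] by blast+
    ultimately show "x \<in> H" unfolding prod by blast
  qed
  then have "coset_index H C = l" using index_powr_frac[OF \<rho> C(1) pos(3)] by simp
  then show ?thesis by (simp add: l_def a_def b_def)
qed

context nonarch_absolute_value
begin

lemma value_group_subgroup:
  assumes "subfield E R" shows "pos_subgroup (value_group R v E)"
proof -
  note Ec = subfield_closed[OF assms]
  have 1: "v x * v y \<in> value_group R v E" if "x \<in> E - {\<zero>}" "y \<in> E - {\<zero>}" for x y
  proof -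
    have "x \<otimes> y \<in> E - {\<zero>}" using that Ec(1,4) integral[of x y] by blast
    moreover have "v x * v y = v (x \<otimes> y)" using that Ec(1) abs_mult by simp
    ultimately show ?thesis unfolding value_group_def by blast
  qed
  have 2: "inverse (v x) \<in> value_group R v E" if "x \<in> E - {\<zero>}" for x
  proof -
    have "inv x \<in> E - {\<zero>}" using that Ec(1,6) inv_nonzero by blast
    moreover have "inverse (v x) = v (inv x)" using that Ec(1) abs_inv by simp
    ultimately show ?thesis unfolding value_group_def by blast
  qed
  have 3: "1 \<in> value_group R v E"
    using Ec(8) abs_one unfolding value_group_def by (metis DiffI image_eqI singletonD zero_not_one)
  show ?thesis
    unfolding pos_subgroup_def using 1 2 3 Ec(1) abs_pos by (auto simp: value_group_def)
qed

text \<open>In a linear combination of such elements the nonzero terms have distinct absolute values.\<close>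

lemma independent_of_distinct_cosets:
  assumes K: "subfield K R" and Us: "set Us \<subseteq> carrier R - {\<zero>}"
    and distinct: "sorted_wrt (\<lambda>u w. \<forall>a\<in>K. v u \<noteq> v a * v w) Us"
  shows "independent K Us"
    and "\<And>x. \<lbrakk>x \<in> Span K Us; x \<noteq> \<zero>\<rbrakk> \<Longrightarrow> \<exists>u\<in>set Us. \<exists>a\<in>K. a \<noteq> \<zero> \<and> v x = v a * v u"
proof -
  note Kc = subfield_closed[OF K]
  have "independent K Us \<and> (\<forall>x\<in>Span K Us. x \<noteq> \<zero> \<longrightarrow> (\<exists>u\<in>set Us. \<exists>a\<in>K. a \<noteq> \<zero> \<and> v x = v a * v u))"
    using Us distinct
  proof (induction Us)
    case Nil
    then show ?case by simp
  next
    case (Cons u Us)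
    then have u: "u \<in> carrier R" "u \<noteq> \<zero>" and Us: "set Us \<subseteq> carrier R"
      and IH: "independent K Us" "\<And>x. \<lbrakk>x \<in> Span K Us; x \<noteq> \<zero>\<rbrakk> \<Longrightarrow> \<exists>w\<in>set Us. \<exists>a\<in>K. a \<noteq> \<zero> \<and> v x = v a * v w"
      and new: "\<And>w a. \<lbrakk>w \<in> set Us; a \<in> K\<rbrakk> \<Longrightarrow> v u \<noteq> v a * v w"
      by auto
    have "u \<notin> Span K Us" using IH(2)[of u] u(2) new by blast
    then have "independent K (u # Us)" using IH(1) u(1) by (intro li_Cons)
    moreover have "\<exists>w\<in>set (u # Us). \<exists>a\<in>K. a \<noteq> \<zero> \<and> v x = v a * v w"
      if x: "x \<in> Span K (u # Us)" "x \<noteq> \<zero>" for x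
    proof -
      obtain k y where ky: "k \<in> K" "y \<in> Span K Us" "x = k \<otimes> u \<oplus> y"
        using x(1) line_extension_mem_iff by auto
      have c: "k \<in> carrier R" "y \<in> carrier R"
        using ky Kc(1) Span_subgroup_props(1)[OF K Us] by auto
      consider "k = \<zero>" | "k \<noteq> \<zero>" "y = \<zero>" | "k \<noteq> \<zero>" "y \<noteq> \<zero>" by blast
      then show ?thesis
      proof cases
        case 1
        then have "x = y" using ky(3) u c by simp
        then show ?thesis using IH(2)[of y] ky(2) x(2) by auto
      next
        case 2
        then have "v x = v k * v u" using ky(3) u c by (simp add: abs_mult)
        then show ?thesis using ky(1) 2(1) by auto
      next
        case 3
        then obtain w a where w: "w \<in> set Us" "a \<in> K" "a \<noteq> \<zero>" "v y = v a * v w"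
          using IH(2) ky(2) by blast
        have ac: "a \<in> carrier R" using w(2) Kc(1) by blast
        have "v y \<noteq> v (k \<otimes> u)"
        proof
          assume "v y = v (k \<otimes> u)"
          then have "v u = v (inv k \<otimes> a) * v w"
            using w(4) c u ac inv_carrier[OF c(1) 3(1)] abs_pos[OF c(1) 3(1)] 3(1)
            by (simp add: abs_mult abs_inv field_simps)
          then show False using new[OF w(1), of "inv k \<otimes> a"] Kc(4,6) ky(1) 3(1) w(2) by blast
        qed
        then have "v x = max (v k * v u) (v a * v w)"
          using abs_add_neq[of "k \<otimes> u" y] c u ky(3) w(4) by (simp add: abs_mult)
        then show ?thesis using ky(1) 3(1) w(1-3) by (auto simp: max_def)
      qed
    qed
    ultimately show ?case by blast
  qed
  then show "independent K Us"
    "\<And>x. \<lbrakk>x \<in> Span K Us; x \<noteq> \<zero>\<rbrakk> \<Longrightarrow> \<exists>u\<in>set Us. \<exists>a\<in>K. a \<noteq> \<zero> \<and> v x = v a * v u"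
    by blast+
qed

text \<open>Representatives of distinct cosets are linearly independent, so their number is bounded by the
dimension; the index is then the cardinality of a finite nonempty set.\<close>

lemma index_pos:
  assumes K: "subfield K R" and fin: "finite_dimension K (carrier R)" and E: "subfield E R"
  shows "0 < coset_index (value_group R v E) (value_group R v K)"
proof -
  note Ec = subfield_closed[OF E]
  let ?C = "value_group R v K"
  let ?coset = "\<lambda>x. (\<lambda>c. c * x) ` ?C"
  let ?T = "?coset ` value_group R v E"
  obtain n where n: "dimension n K (carrier R)" using fin by blast
  have Cp: "pos_subgroup ?C" by (rule value_group_subgroup[OF K])
  have "finite ?T"
  proof (rule ccontr)
    assume "infinite ?T"
    then obtain S where S: "S \<subseteq> ?T" "finite S" "card S = Suc n"
      using infinite_arbitrarily_large by blast
    obtain xs where xs: "set xs = S" "distinct xs" using finite_distinct_list[OF S(2)] by blast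
    have "\<forall>s\<in>S. \<exists>x\<in>E - {\<zero>}. s = ?coset (v x)" using S(1) unfolding value_group_def by blast
    then obtain f where f: "\<And>s. s \<in> S \<Longrightarrow> f s \<in> E - {\<zero>} \<and> s = ?coset (v (f s))" by metis
    have "sorted_wrt (\<lambda>s t. \<forall>a\<in>K. v (f s) \<noteq> v a * v (f t)) xs"
    proof (rule sorted_wrt_mono_rel[of _ "(\<noteq>)"])
      show "sorted_wrt (\<noteq>) xs" using xs(2) by (simp add: sorted_wrt_iff_nth_less distinct_conv_nth)
      fix s t assume st: "s \<in> set xs" "t \<in> set xs" "s \<noteq> t"
      show "\<forall>a\<in>K. v (f s) \<noteq> v a * v (f t)"
      proof (intro ballI notI)
        fix a assume a: "a \<in> K" "v (f s) = v a * v (f t)"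
        have p: "0 < v (f s)" "0 < v (f t)"
          using f st(1,2) xs(1) Ec(1) abs_pos by blast+
        have "a \<noteq> \<zero>" using a(2) p(1) by auto
        then have "v a \<in> ?C" using a(1) unfolding value_group_def by blast
        then have "?coset (v (f s)) = ?coset (v (f t))" using coset_eq_iff[OF Cp p] a(2) by blast
        then show False using f st xs(1) by metis
      qed
    qed
    then have "independent K (map f xs)"
      using f xs(1) Ec(1) by (intro independent_of_distinct_cosets(1)[OF K]) (auto simp: sorted_wrt_map)
    moreover have "set (map f xs) \<subseteq> carrier R" using f xs(1) Ec(1) by auto
    ultimately have "length (map f xs) \<le> n" using independent_length_le_dimension[OF K n] by blast
    then show False using S(3) xs distinct_card[OF xs(2)] by simp
  qed
  moreover have "?T \<noteq> {}" using value_group_subgroup[OF E] unfolding pos_subgroup_def by blast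
  ultimately show ?thesis unfolding coset_index_def by (simp add: card_gt_0_iff)
qed

section \<open>The value group of a tame compositum\<close>

text \<open>The characteristic is the additive order of 1, and \<open>n\<close> times 1 vanishes in the residue field.\<close>

lemma ring_char_residue_field_dvd:
  fixes n :: nat
  assumes K: "subfield K R" and small: "v ([n] \<cdot> \<one>) < 1"
  shows "ring_char (residue_field R v K) dvd n"
proof -
  let ?k = "residue_field R v K"
  let ?res = "(+>\<^bsub>valuation_ring R v K\<^esub>) (valuation_ideal v K)"
  interpret H: ring_hom_ring "valuation_ring R v K" ?k ?res by (rule residue_hom[OF K])
  have "[m] \<cdot> \<one> \<in> carrier (valuation_ring R v K)" for m :: nat
    using subfield_closed(8,10)[OF K] abs_nat_le1 by (simp add: valuation_ring_def)
  then have "?res ([m] \<cdot> \<one>) = add_pow ?k m \<one>\<^bsub>?k\<^esub>" for m :: nat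
  proof (induction m)
    case 0
    show ?case using H.hom_zero by (simp add: valuation_ring_def)
  next
    case (Suc m)
    have "?res ([m] \<cdot> \<one> \<oplus> \<one>) = ?res ([m] \<cdot> \<one>) \<oplus>\<^bsub>?k\<^esub> ?res \<one>"
      using H.hom_add[OF Suc.prems[of m] Suc.prems[of 1]] by (simp add: valuation_ring_def)
    moreover have "?res \<one> = \<one>\<^bsub>?k\<^esub>" using H.hom_one by (simp add: valuation_ring_def)
    ultimately show ?case using Suc.IH[OF Suc.prems] by simp
  qed
  then have "add_pow ?k n \<one>\<^bsub>?k\<^esub> = \<zero>\<^bsub>?k\<^esub>"
    using residue_zero_iff[OF K, of "[n] \<cdot> \<one>"] small subfield_closed(8,10)[OF K] by simp
  then show ?thesis
    unfolding ring_char_def using H.S.add.pow_eq_id[of "\<one>\<^bsub>?k\<^esub>" n]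
    by (simp add: add_pow_def)
qed

text \<open>Zorn's lemma: both conditions are inherited by unions of chains.\<close>

lemma exists_maximal_subfield:
  assumes M: "subfield M R" "value_group R v M \<subseteq> \<Gamma>"
  obtains E where "subfield E R" "M \<subseteq> E" "value_group R v E \<subseteq> \<Gamma>"
    "\<And>E'. \<lbrakk>subfield E' R; E \<subseteq> E'; value_group R v E' \<subseteq> \<Gamma>\<rbrakk> \<Longrightarrow> E' = E"
proof -
  let ?S = "{E. subfield E R \<and> M \<subseteq> E \<and> value_group R v E \<subseteq> \<Gamma>}"
  have "\<exists>E\<in>?S. \<forall>E'\<in>?S. E \<subseteq> E' \<longrightarrow> E' = E"
  proof (rule subset_Zorn_nonempty)
    show "?S \<noteq> {}" using M by blast
    fix \<C> assume C: "\<C> \<noteq> {}" "subset.chain ?S \<C>"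
    then have "subfield (\<Union>\<C>) R"
      unfolding subset_chain_def by (intro chain_Union_subfield) blast+
    moreover have "value_group R v (\<Union>\<C>) \<subseteq> \<Gamma>" "M \<subseteq> \<Union>\<C>"
      using C unfolding subset_chain_def value_group_def by blast+
    ultimately show "\<Union>\<C> \<in> ?S" by blast
  qed
  then show ?thesis using that by (auto 0 4)
qed

text \<open>An extension of complete discretely valued fields with the same residue field and value group is
trivial. For \<open>x\<close> outside \<open>W\<close> take \<open>w \<in> W\<close> whose distance to \<open>x\<close> is within the factor \<open>1/\<theta>\<close> of the infimum.
Approximating the leading term of \<open>x - w\<close> by an element of \<open>W\<close> reduces the distance by the factor \<open>\<theta>\<close>,
below the infimum.\<close>

lemma dense_complete_subfield_eq:
  assumes W: "subfield W R" "complete_on W" and L: "subfield L R" "W \<subseteq> L"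
    and residue: "\<And>c. \<lbrakk>c \<in> L; v c \<le> 1\<rbrakk> \<Longrightarrow> \<exists>a\<in>W. v (c \<ominus> a) < 1"
    and val: "\<And>x. \<lbrakk>x \<in> L; x \<noteq> \<zero>\<rbrakk> \<Longrightarrow> \<exists>w\<in>W. w \<noteq> \<zero> \<and> v w = v x"
    and gap: "0 < \<theta>" "\<theta> < 1" "\<And>x. \<lbrakk>x \<in> L; v x < 1\<rbrakk> \<Longrightarrow> v x \<le> \<theta>"
  shows "L = W"
proof (rule ccontr)
  note Lc = subfield_closed[OF L(1)] and Wc = subfield_closed[OF W(1)]
  assume "L \<noteq> W"
  then obtain x where x: "x \<in> L" "x \<notin> W" using L(2) by blast
  have xc: "x \<in> carrier R" using x(1) Lc(1) by blast
  have "W \<subseteq> carrier R" using Wc(1) by blast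
  then obtain d where d: "0 < d" "\<And>w. w \<in> W \<Longrightarrow> d \<le> v (x \<ominus> w)"
    using complete_on_dist_pos[OF W(2) _ xc x(2)] by blast
  let ?S = "(\<lambda>w. v (x \<ominus> w)) ` W"
  have S: "?S \<noteq> {}" "bdd_below ?S" using Wc(7) d(2) by (auto intro!: bdd_belowI[of _ d])
  define I where "I = Inf ?S"
  have "d \<le> I" unfolding I_def using d(2) S(1) by (intro cInf_greatest) auto
  then have I: "0 < I" using d(1) by simp
  have low: "I \<le> v (x \<ominus> w)" if "w \<in> W" for w
    unfolding I_def using that S(2) by (intro cInf_lower) auto
  have "I < I / \<theta>" using I gap(1,2) by (simp add: field_simps)
  then obtain w where w: "w \<in> W" "v (x \<ominus> w) < I / \<theta>"
    using cInf_lessD[OF S(1)] unfolding I_def by blast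
  define z where "z = x \<ominus> w"
  have z: "z \<in> L" "z \<in> carrier R" "0 < v z" "z \<noteq> \<zero>"
  proof -
    show "z \<in> L" unfolding z_def using x(1) w(1) L(2) Lc(3) by blast
    then show "z \<in> carrier R" by (rule Lc(1))
    show "0 < v z" unfolding z_def using low[OF w(1)] I by linarith
    then show "z \<noteq> \<zero>" by auto
  qed
  obtain t where t: "t \<in> W" "t \<noteq> \<zero>" "v t = v z" using val[OF z(1,4)] by blast
  have tc: "t \<in> carrier R" "inv t \<in> carrier R" "inv t \<in> L" "t \<otimes> inv t = \<one>"
    using t(1,2) Wc(1) inv_carrier Wc(6) L(2) field_Units by auto
  have "v (z \<otimes> inv t) = 1" using z tc t abs_inv[OF tc(1) t(2)] by (simp add: abs_mult)
  then obtain a where a: "a \<in> W" "v (z \<otimes> inv t \<ominus> a) < 1"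
    using residue[of "z \<otimes> inv t"] Lc(4)[OF z(1) tc(3)] by auto
  have ac: "a \<in> carrier R" "a \<in> L" using a(1) Wc(1) L(2) by auto
  let ?y = "z \<otimes> inv t \<ominus> a"
  have y: "?y \<in> carrier R" "?y \<in> L" "v ?y \<le> \<theta>"
    using Lc(3,4) z tc ac gap(3)[OF _ a(2)] by auto
  have wc: "w \<in> carrier R" using w(1) Wc(1) by blast
  have "x \<ominus> (w \<oplus> t \<otimes> a) = t \<otimes> ?y"
  proof -
    have "t \<otimes> ?y = (t \<otimes> inv t) \<otimes> z \<ominus> t \<otimes> a" using tc(1,2) z(2) ac(1) by algebra
    also have "\<dots> = x \<ominus> (w \<oplus> t \<otimes> a)" unfolding tc(4) z_def using xc wc tc(1) ac(1) by algebra
    finally show ?thesis ..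
  qed
  then have "v (x \<ominus> (w \<oplus> t \<otimes> a)) = v z * v ?y" using tc(1) y(1) t(3) by (simp add: abs_mult)
  also have "\<dots> \<le> v z * \<theta>" using y(3) z(3) by (intro mult_left_mono) auto
  also have "\<dots> < I" using w(2) gap(1) unfolding z_def[symmetric] by (simp add: field_simps)
  finally have "v (x \<ominus> (w \<oplus> t \<otimes> a)) < I" .
  moreover have "w \<oplus> t \<otimes> a \<in> W" using Wc(2,4) w(1) t(1) a(1) by blast
  ultimately show False using low by fastforce
qed

text \<open>Write \<open>x\<^sup>n = u k\<close> with a unit \<open>u\<close> of \<open>L\<close>, and \<open>u = q a\<close> with \<open>a \<in> W\<close> and \<open>q\<close> a one-unit. The one-unit
has an \<open>n\<close>-th root \<open>r\<close> in \<open>L\<close>, and \<open>y = x/r\<close> satisfies \<open>y\<^sup>n = a k\<close>.\<close>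

lemma divide_root_of_unit_part:
  fixes n :: nat
  assumes L: "subfield L R" "complete_on L" and W: "subfield W R" "W \<subseteq> L"
    and residue: "\<And>c. \<lbrakk>c \<in> L; v c \<le> 1\<rbrakk> \<Longrightarrow> \<exists>a\<in>W. v (c \<ominus> a) < 1"
    and n: "0 < n" "v ([n] \<cdot> \<one>) = 1"
    and x: "x \<in> L" "x \<noteq> \<zero>" and k: "k \<in> W" "k \<noteq> \<zero>" "v x ^ n = v k"
  obtains y where "y \<in> L" "v y = v x" "y [^] n \<in> W"
proof -
  note Lc = subfield_closed[OF L(1)] and Wc = subfield_closed[OF W(1)]
  have xc: "x \<in> carrier R" "x [^] n \<in> carrier R" "x [^] n \<in> L" using x(1) Lc(1,9) by auto
  have kc: "k \<in> carrier R" "inv k \<in> carrier R" "inv k \<in> L" "inv k \<otimes> k = \<one>" "v k \<noteq> 0"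
    using k(1,2) Wc(1) inv_carrier Wc(6) W(2) field_Units abs_eq_0_iff by auto
  define u where "u = x [^] n \<otimes> inv k"
  have u: "u \<in> L" "u \<in> carrier R" unfolding u_def using Lc(4) xc kc by auto
  have u1: "v u = 1"
    unfolding u_def using xc kc k(2,3) by (simp add: abs_mult abs_pow abs_inv)
  have xu: "x [^] n = u \<otimes> k" unfolding u_def using xc kc by (simp add: m_assoc)
  obtain a where a: "a \<in> W" "v (u \<ominus> a) < 1" using residue[OF u(1)] u1 by auto
  have ac: "a \<in> carrier R" "a \<in> L" using a(1) Wc(1) W(2) by auto
  have a1: "v a = 1"
    using abs_eq_of_close[OF ac(1) u(2)] a(2) u1 abs_minus_commute[OF u(2) ac(1)] by simp
  then have a0: "a \<noteq> \<zero>" by auto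
  have ai: "inv a \<in> carrier R" "inv a \<in> L" "v (inv a) = 1" "a \<otimes> inv a = \<one>" "inv a \<otimes> a = \<one>"
    using inv_carrier[OF ac(1) a0] Lc(6)[OF ac(2) a0] abs_inv[OF ac(1) a0] a1 field_Units ac(1) a0 by auto
  define q where "q = u \<otimes> inv a"
  have q: "q \<in> L" "q \<in> carrier R" unfolding q_def using Lc(4) u ai by auto
  have "q \<ominus> \<one> = (u \<ominus> a) \<otimes> inv a"
  proof -
    have "(u \<ominus> a) \<otimes> inv a = u \<otimes> inv a \<ominus> a \<otimes> inv a" using u(2) ac(1) ai(1) by algebra
    then show ?thesis unfolding q_def ai(4) by simp
  qed
  then have "v (q \<ominus> \<one>) < 1" using a(2) ai u(2) ac(1) by (simp add: abs_mult)
  then obtain r where r: "r \<in> L" "v r = 1" "r [^] n = q"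
    using one_unit_root[OF L q(1) _ n] by blast
  have r0: "r \<noteq> \<zero>" using r(2) by auto
  have q0: "q \<noteq> \<zero>" using abs_pow[of r n] r Lc(1) by auto
  have rc: "r \<in> carrier R" "inv r \<in> carrier R" "inv r \<in> L" "inv r \<otimes> r = \<one>"
    using r(1) r0 Lc(1,6) field_Units by auto
  define y where "y = x \<otimes> inv r"
  have y: "y \<in> L" "y \<in> carrier R" unfolding y_def using Lc(4) x(1) xc rc by auto
  have "y \<otimes> r = x" unfolding y_def using xc rc by (simp add: m_assoc)
  then have "y [^] n \<otimes> q = x [^] n" using nat_pow_distrib[OF y(2) rc(1), of n] r(3) by simp
  also have "\<dots> = (a \<otimes> k) \<otimes> q"
  proof -
    have "(a \<otimes> k) \<otimes> q = (a \<otimes> inv a) \<otimes> (u \<otimes> k)" unfolding q_def using ac(1) kc(1) u(2) ai(1) by algebra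
    then show ?thesis unfolding ai(4) xu using u(2) kc(1) by simp
  qed
  finally have "y [^] n = a \<otimes> k"
    using m_rcancel[OF q0 q(2), of "y [^] n" "a \<otimes> k"] y(2) ac(1) kc(1) by simp
  then have "y [^] n \<in> W" using Wc(4) a(1) k(1) by simp
  moreover have "v y = v x" unfolding y_def using xc rc r abs_inv[OF rc(1) r0] by (simp add: abs_mult)
  ultimately show ?thesis using that y(1) by blast
qed

text \<open>The inclusion of the left side in the product is the substance. It says that a subfield maximal among
those with values in the product is the whole field, which is the argument by adjunction of residues
and radicals described at the beginning.\<close>

theorem value_group_tame_compositum:
  assumes K: "subfield K R" and L: "subfield L R" "K \<subseteq> L" and M: "subfield M R" "K \<subseteq> M"
    and fin: "finite_dimension K (carrier R)" and gen: "generate_field R (L \<union> M) = carrier R"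
    and complete: "complete_on K" and discrete: "discrete (value_group R v K)"
    and perfect: "perfect_field (residue_field R v K)"
    and tame: "v ([coset_index (value_group R v L) (value_group R v K)] \<cdot> \<one>) = 1"
  shows "value_group R v (carrier R) = {a * b | a b. a \<in> value_group R v L \<and> b \<in> value_group R v M}"
    (is "_ = ?\<Gamma>")
proof -
  define n where "n = coset_index (value_group R v L) (value_group R v K)"
  have n: "0 < n" "v ([n] \<cdot> \<one>) = 1" using index_pos[OF K fin L(1)] tame by (simp_all add: n_def)
  note Lc = subfield_closed[OF L(1)] and Mc = subfield_closed[OF M(1)] and Kc = subfield_closed[OF K]
  note GL = value_group_subgroup[OF L(1)] and GM = value_group_subgroup[OF M(1)] and GK = value_group_subgroup[OF K]
  have mem: "v x \<in> value_group R v E" if "x \<in> E" "x \<noteq> \<zero>" for x E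
    using that unfolding value_group_def by blast
  have comp: "complete_on E" if "subfield E R" "K \<subseteq> E" for E
    using complete_on_subfield[OF K complete fin that] .
  have alg: "(algebraic over E) x" if "K \<subseteq> E" "x \<in> carrier R" for E x
    using finite_dimension_imp_algebraic[OF K carrier_is_subring fin that(2)] algebraic_mono[OF that(1)] by blast
  have sep: "\<exists>h. residual_poly K c h \<and> v (eval (deriv h) c) = 1" if c: "c \<in> carrier R" "v c \<le> 1" for c
  proof -
    obtain p where "residual_poly K c p" using exists_residual_poly[OF K c(1) alg[OF order_refl c(1)]] by blast
    then obtain g where g: "min_residual_poly K c g" using exists_min_residual_poly[OF K c] by blast
    then show ?thesis
      using perfect_residue_separable[OF K perfect c g] unfolding min_residual_poly_def by blast
  qed
  have res_mono: "residual_poly E c h" if "residual_poly K c h" "K \<subseteq> E" for E c h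
    using that unfolding residual_poly_def by blast
  have "value_group R v M \<subseteq> ?\<Gamma>" using GL unfolding pos_subgroup_def by force
  then obtain E where E: "subfield E R" "M \<subseteq> E" "value_group R v E \<subseteq> ?\<Gamma>"
    and max: "\<And>E'. \<lbrakk>subfield E' R; E \<subseteq> E'; value_group R v E' \<subseteq> ?\<Gamma>\<rbrakk> \<Longrightarrow> E' = E"
    using exists_maximal_subfield[OF M(1)] by blast
  note Ec = subfield_closed[OF E(1)]
  have KE: "K \<subseteq> E" using M(2) E(2) by blast
  have Ecar: "E \<subseteq> carrier R" using Ec(1) by blast
  note Ecomp = comp[OF E(1) KE]
  have adjoin_mem: "x \<in> E" if x: "x \<in> carrier R" "subfield (simple_extension E x) R"
    "\<And>y. \<lbrakk>y \<in> simple_extension E x; y \<noteq> \<zero>\<rbrakk> \<Longrightarrow> v y \<in> ?\<Gamma>" for x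
  proof -
    have "simple_extension E x = E"
    proof (rule max[OF x(2)])
      show "E \<subseteq> simple_extension E x" using simple_extension_incl[OF Ecar x(1)] .
      show "value_group R v (simple_extension E x) \<subseteq> ?\<Gamma>" using x(3) unfolding value_group_def by blast
    qed
    then show ?thesis using simple_extension_mem[OF subfieldE(1)[OF E(1)] x(1)] by simp
  qed
  \<comment> \<open>Every residue is separable over the residue field of \<open>K\<close>, so its lift can be adjoined.\<close>
  have full: "full_residue E"
    unfolding full_residue_def
  proof (intro ballI impI)
    fix c assume c: "c \<in> carrier R" "v c \<le> 1"
    obtain h where h: "residual_poly K c h" "v (eval (deriv h) c) = 1" using sep[OF c] by blast
    obtain c' where c': "c' \<in> carrier R" "v (c' \<ominus> c) < 1" "subfield (simple_extension E c') R"
      and val: "\<And>y. \<lbrakk>y \<in> simple_extension E c'; y \<noteq> \<zero>\<rbrakk> \<Longrightarrow> \<exists>a\<in>E. a \<noteq> \<zero> \<and> v y = v a"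
      using adjoin_residue[OF E(1) _ alg[OF KE] c res_mono[OF h(1) KE] h(2)]
        comp[OF carrier_is_subfield] Kc(1) by blast
    have "c' \<in> E"
    proof (rule adjoin_mem[OF c'(1,3)])
      fix y assume "y \<in> simple_extension E c'" "y \<noteq> \<zero>"
      then obtain a where a: "a \<in> E" "a \<noteq> \<zero>" "v y = v a" using val by blast
      show "v y \<in> ?\<Gamma>" unfolding a(3) by (rule subsetD[OF E(3) mem[OF a(1,2)]])
    qed
    moreover have "v (c \<ominus> c') < 1" using c' c(1) abs_minus_commute by simp
    ultimately show "\<exists>a\<in>E. v (c \<ominus> a) < 1" by blast
  qed
  define W where "W = E \<inter> L"
  have W: "subfield W R" "K \<subseteq> W" "W \<subseteq> L" "W \<subseteq> E"
    unfolding W_def using subfield_inter[OF E(1) L(1)] KE L(2) by auto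
  \<comment> \<open>The root found in \<open>L\<close> is also the root that \<open>E\<close> contains near the same residue.\<close>
  have residue: "\<exists>a\<in>W. v (c \<ominus> a) < 1" if c: "c \<in> L" "v c \<le> 1" for c
  proof -
    have cc: "c \<in> carrier R" using c(1) Lc(1) by blast
    obtain h where h: "residual_poly K c h" "v (eval (deriv h) c) = 1" using sep[OF cc c(2)] by blast
    then have hK: "set h \<subseteq> K" "\<forall>a\<in>set h. v a \<le> 1" "v (eval h c) < 1" unfolding residual_poly_def by auto
    have hc: "set h \<subseteq> carrier R" "set h \<subseteq> L" "set h \<subseteq> E" using hK(1) Kc(1) L(2) KE by auto
    obtain y where y: "y \<in> L" "v y \<le> 1" "v (y \<ominus> c) < 1" "eval h y = \<zero>"
      using hensel[OF L(1) comp[OF L] hc(2) hK(2) c hK(3) h(2)] by blast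
    have yc: "y \<in> carrier R" using y(1) Lc(1) by blast
    have "v (eval (deriv h) y \<ominus> eval (deriv h) c) < 1"
      using eval_close[OF deriv_carrier[OF hc(1)] deriv_ball[OF hc(1) hK(2)] yc y(2) cc c(2)] y(3) by simp
    then have "v (eval (deriv h) y) = 1"
      using abs_eq_of_close[OF eval_in_carrier[OF deriv_carrier[OF hc(1)] yc]
          eval_in_carrier[OF deriv_carrier[OF hc(1)] cc]] h(2) by simp
    moreover obtain a where "a \<in> E" "v (y \<ominus> a) < 1" using full yc y(2) unfolding full_residue_def by blast
    ultimately have "y \<in> E" using hensel_mem[OF E(1) Ecomp hc(3) hK(2) yc y(2,4)] by blast
    moreover have "v (c \<ominus> y) < 1" using y(3) abs_minus_commute[OF yc cc] by simp
    ultimately show ?thesis using y(1) unfolding W_def by blast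
  qed
  have KL: "value_group R v K \<subseteq> value_group R v L" using L(2) unfolding value_group_def by blast
  have pow: "v x ^ n \<in> value_group R v K" if "x \<in> L" "x \<noteq> \<zero>" for x
    using pow_index_mem[OF GL GK KL _ mem[OF that]] n(1) unfolding n_def by blast
  have val: "\<exists>w\<in>W. w \<noteq> \<zero> \<and> v w = v x" if x: "x \<in> L" "x \<noteq> \<zero>" for x
  proof -
    obtain k where k: "k \<in> K" "k \<noteq> \<zero>" "v x ^ n = v k" using pow[OF x] unfolding value_group_def by blast
    \<comment> \<open>Among the elements of \<open>L\<close> with the same absolute value as \<open>x\<close> there is a radical over \<open>W\<close>.\<close>
    have "k \<in> W" using k(1) W(2) by blast
    then obtain y where y: "y \<in> L" "v y = v x" "y [^] n \<in> W"
      using divide_root_of_unit_part[OF L(1) comp[OF L] W(1,3) residue n x _ k(2,3)] by blast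
    have yc: "y \<in> carrier R" using y(1) Lc(1) by blast
    have y0: "y \<noteq> \<zero>" using y(2) abs_pos[of x] x Lc(1) by auto
    have yE: "y [^] n \<in> E" using y(3) W(4) by blast
    note root = adjoin_tame_root[OF E(1) Ecomp full alg[OF KE] yc y0 yE n]
    have "y \<in> E"
    proof (rule adjoin_mem[OF yc root(1)])
      fix z assume "z \<in> simple_extension E y" "z \<noteq> \<zero>"
      then obtain i a where a: "a \<in> E" "a \<noteq> \<zero>" "v z = v a * v y ^ i" using root(2) by blast
      have "v a \<in> ?\<Gamma>" by (rule subsetD[OF E(3) mem[OF a(1,2)]])
      then obtain b c where bc: "v a = b * c" "b \<in> value_group R v L" "c \<in> value_group R v M" by blast
      have "b * v y ^ i \<in> value_group R v L"
        using bc(2) pos_subgroup_pow[OF GL mem[OF y(1) y0]] GL unfolding pos_subgroup_def by blast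
      moreover have "v z = (b * v y ^ i) * c" using a(3) bc(1) by simp
      ultimately show "v z \<in> ?\<Gamma>" using bc(3) by blast
    qed
    then show ?thesis using y(1,2) y0 unfolding W_def by blast
  qed
  obtain \<theta> where \<theta>: "0 < \<theta>" "\<theta> < 1" "\<And>a. \<lbrakk>a \<in> value_group R v L; a < 1\<rbrakk> \<Longrightarrow> a \<le> \<theta>"
  proof (rule discrete_gap_finite_index[OF GK discrete n(1), of "value_group R v L"])
    show "0 < a \<and> a ^ n \<in> value_group R v K" if "a \<in> value_group R v L" for a
      using that pow GL unfolding pos_subgroup_def value_group_def by blast
  qed blast
  have "v x \<le> \<theta>" if "x \<in> L" "v x < 1" for x
    using \<theta>(1,3) mem[OF that(1)] that(2) by (cases "x = \<zero>") auto
  then have "L = W"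
    using dense_complete_subfield_eq[OF W(1) comp[OF W(1,2)] L(1) W(3) residue val \<theta>(1,2)] by blast
  then have "L \<union> M \<subseteq> E" using W(4) E(2) by blast
  moreover have "L \<union> M \<subseteq> carrier R" using Lc(1) Mc(1) by blast
  ultimately have "carrier R \<subseteq> E" using generate_field_min_subfield1[OF _ E(1)] gen by blast
  then have "value_group R v (carrier R) \<subseteq> ?\<Gamma>" using E(3) unfolding value_group_def by blast
  moreover have "?\<Gamma> \<subseteq> value_group R v (carrier R)"
  proof -
    have "a \<in> value_group R v (carrier R)" if "a \<in> value_group R v L \<union> value_group R v M" for a
      using that Lc(1) Mc(1) unfolding value_group_def by blast
    then show ?thesis
      using value_group_subgroup[OF carrier_is_subfield] unfolding pos_subgroup_def by blast
  qed
  ultimately show ?thesis by blast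
qed

end

theorem corollary1p5:
  fixes F :: "('a, 'b) ring_scheme"
    and K L M :: "'a set"
    and abs\<^sub>K abs\<^sub>F :: "'a \<Rightarrow> real"
  assumes "field F"
    and "subfield K F" and "subfield L F" and "subfield M F"
    and "K \<subseteq> L" and "K \<subseteq> M"
    and "ring.finite_dimension F K (carrier F)"
    and "separable_extension F K"
    and "generate_field F (L \<union> M) = carrier F"
    and "complete_discrete_absolute_value (F\<lparr>carrier := K\<rparr>) abs\<^sub>K"
    and "absolute_value F abs\<^sub>F" and "\<forall>x\<in>K. abs\<^sub>F x = abs\<^sub>K x"
    and "tamely_ramified F abs\<^sub>F L K"
    and "perfect_field (residue_field F abs\<^sub>K K)"
  shows "ramification_index F abs\<^sub>F (carrier F) K =
    lcm (ramification_index F abs\<^sub>F L K) (ramification_index F abs\<^sub>F M K)"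
proof -
  note K = assms(2) and L = assms(3) and M = assms(4) and fin = assms(7)
  have eq: "abs\<^sub>K x = abs\<^sub>F x" if "x \<in> K" for x using assms(12) that by simp
  interpret A: absolute_value F abs\<^sub>F by (rule assms(11))
  interpret K: complete_discrete_absolute_value "F\<lparr>carrier := K\<rparr>" abs\<^sub>K by (rule assms(10))
  note Kc = A.subfield_closed[OF K]
  interpret nonarch_absolute_value F abs\<^sub>F
  proof (rule A.nonarch_from_subfield[OF K])
    show "abs\<^sub>F (x \<oplus>\<^bsub>F\<^esub> y) \<le> max (abs\<^sub>F x) (abs\<^sub>F y)" if "x \<in> K" "y \<in> K" for x y
      using K.abs_ultrametric[of x y] that Kc(2) eq by simp
  qed
  have complete: "complete_on K"
    using mcomplete_imp_complete_on[OF K eq] K.abs_complete by simp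
  have "value_group (F\<lparr>carrier := K\<rparr>) abs\<^sub>K K = value_group F abs\<^sub>F K"
    unfolding value_group_def using eq by (auto intro!: image_cong)
  then have discrete: "discrete (value_group F abs\<^sub>F K)" using K.value_group_discrete by simp
  have "{x \<in> K. abs\<^sub>K x \<le> 1} = {x \<in> K. abs\<^sub>F x \<le> 1}" "{x \<in> K. abs\<^sub>K x < 1} = {x \<in> K. abs\<^sub>F x < 1}"
    using eq by auto
  then have perfect: "perfect_field (residue_field F abs\<^sub>F K)"
    using assms(14) unfolding residue_field_def valuation_ring_def valuation_ideal_def by simp
  let ?e = "\<lambda>E. coset_index (value_group F abs\<^sub>F E) (value_group F abs\<^sub>F K)"
  have e: "0 < ?e L" "0 < ?e M" using index_pos[OF K fin] L M by blast+
  have tame: "abs\<^sub>F (add_pow F (?e L) \<one>\<^bsub>F\<^esub>) = 1"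
  proof (rule ccontr)
    assume "\<not> ?thesis"
    then have "ring_char (residue_field F abs\<^sub>F K) dvd ?e L"
      using ring_char_residue_field_dvd[OF K] abs_nat_le1[of "?e L"] by simp
    then show False
      using assms(13) e(1) unfolding tamely_ramified_def ramification_index_eq by auto
  qed
  have sub: "value_group F abs\<^sub>F K \<subseteq> value_group F abs\<^sub>F E" if "K \<subseteq> E" for E
    using that unfolding value_group_def by blast
  show ?thesis
    unfolding ramification_index_eq
    using index_product_lcm[OF value_group_subgroup[OF K] discrete value_group_subgroup[OF L] sub[OF assms(5)]
        value_group_subgroup[OF M] sub[OF assms(6)] value_group_subgroup[OF A.carrier_is_subfield]
        value_group_tame_compositum[OF K L assms(5) M assms(6) fin assms(9) complete discrete perfect tame] e] .
qed

end
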